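(* Let $(M,g)$ be a Kähler–Einstein manifold of complex dimension $n$ such that $g$ is a radial Kähler metric. Then $a_3=0$ if and only if $(M,g)$ is biholomorphically isometric to $\mathbb C^n$, $\mathbb C\mathrm H^2$ or $\mathbb C\mathrm P^2$ with (a multiple of) their standard metric.
   Context: Radial metric: a Kähler metric $g$ with Kähler form $\omega$ on $M$ is radial if for every $p\in M$ there is a coordinate neighborhood $U$ of $p$ with holomorphic coordinates $z_1,\dots,z_n$ such that $\omega|_U$ has a Kähler potential depending only on $|z|^2=|z_1|^2+\dots+|z_n|^2$. Kähler–Einstein means that the Ricci tensor is a constant multiple of $g$. The standard metrics are the flat metric on $\mathbb C^n$, the complex hyperbolic metric on $\mathbb C\mathrm H^2$ and the Fubini–Study metric on $\mathbb C\mathrm P^2$. The coefficient $a_3$ is the coefficient of $m^{n-3}$ in the Tian–Yau–Catlin–Zelditch (TYCZ) asymptotic expansion $\varepsilon_{mg}\sim\sum_{j\ge0}a_jm^{n-j}$ (normalized by $a_0\equiv1$) of the $\varepsilon$-function (distortion function/Bergman kernel on the diagonal) of $mg$; it is the function on $M$ given by the following formula of Lu and Engliš: $$a_3=-\tfrac18\Delta\Delta\sigma+\tfrac1{24}\mathrm{div\,div}(R,\mathrm{Ric})-\tfrac16\mathrm{div\,div}(\sigma\mathrm{Ric})+\tfrac1{48}\Delta(|R|^2-4|\mathrm{Ric}|^2+8\sigma^2)-\tfrac1{48}\sigma(\sigma^2+|R|^2-4|\mathrm{Ric}|^2)-\tfrac1{24}\big(\sigma_3(\mathrm{Ric})-\mathrm{Ric}(R,R)+R(\mathrm{Ric},\mathrm{Ric})\big).$$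 Here (summation over repeated indices, norms with respect to $g$, a comma denoting covariant differentiation): $R_{i\bar jk\bar l}=\frac{\partial^2 g_{i\bar j}}{\partial z_k\partial\bar z_l}-g^{p\bar q}\frac{\partial g_{i\bar q}}{\partial z_k}\frac{\partial g_{p\bar j}}{\partial\bar z_l}$, $\mathrm{Ric}_{i\bar j}=g^{l\bar m}R_{i\bar jl\bar m}$ (note the sign convention), $\sigma=g^{i\bar j}\mathrm{Ric}_{i\bar j}$, $\Delta=g^{i\bar j}\frac{\partial^2}{\partial z_i\partial\bar z_j}$, $|D'\sigma|^2=g^{j\bar i}\frac{\partial\sigma}{\partial z_i}\frac{\partial\sigma}{\partial\bar z_j}$, $|D'\mathrm{Ric}|^2=g^{\alpha\bar i}g^{j\bar\beta}g^{\gamma\bar k}\mathrm{Ric}_{i\bar j,k}\overline{\mathrm{Ric}_{\alpha\bar\beta,\gamma}}$, $\mathrm{div\,div}(\sigma\mathrm{Ric})=2|D'\sigma|^2+g^{\beta\bar i}g^{j\bar\alpha}\mathrm{Ric}_{i\bar j}\frac{\partial^2\sigma}{\partial z_\alpha\partial\bar z_\beta}+\sigma\Delta\sigma$, $\sigma_3(\mathrm{Ric})=g^{\delta\bar i}g^{j\bar\alpha}g^{\beta\bar\gamma}\mathrm{Ric}_{i\bar j}\mathrm{Ric}_{\alpha\bar\beta}\mathrm{Ric}_{\gamma\bar\delta}$, $R(\mathrm{Ric},\mathrm{Ric})=g^{\alpha\bar i}g^{j\bar\beta}g^{\gamma\bar k}g^{l\bar\delta}R_{i\bar jk\bar l}\mathrm{Ric}_{\beta\bar\alpha}\mathrm{Ric}_{\delta\bar\gamma}$,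 $\mathrm{Ric}(R,R)=g^{\alpha\bar i}g^{j\bar\beta}g^{\gamma\bar k}g^{\delta\bar p}g^{q\bar\epsilon}\mathrm{Ric}_{i\bar j}R_{\beta\bar\gamma p\bar q}R_{k\bar\alpha\epsilon\bar\delta}$, $\mathrm{div\,div}(R,\mathrm{Ric})=-g^{\beta\bar i}g^{j\bar\alpha}\mathrm{Ric}_{i\bar j}\frac{\partial^2\sigma}{\partial z_\alpha\partial\bar z_\beta}-2|D'\mathrm{Ric}|^2-g^{\alpha\bar i}g^{j\bar\beta}g^{\gamma\bar k}g^{l\bar\delta}\mathrm{Ric}_{i\bar j,k\bar l}R_{\beta\bar\alpha\delta\bar\gamma}-R(\mathrm{Ric},\mathrm{Ric})+\sigma_3(\mathrm{Ric})$.
   Formalization: Proved for n ≥ 2 (for n = 1, a_3 vanishes identically, also on CP^1), and "biholomorphically isometric" is local: each point has a neighbourhood isometric to an open set of one model with one multiple (a flat ball or torus has a_3 = 0 but is not globally C^n). *)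

theory Defs
  imports "HOL-Analysis.Analysis"
begin

section \<open>Calculus on \<open>\<complex>\<^sup>n\<close>\<close>

text \<open>The Wirtinger derivatives \<open>\<partial>f/\<partial>z\<^sub>k\<close> (\<open>pd\<close>) and \<open>\<partial>f/\<partial>z\<^sub>k*\<close> (\<open>pdbar\<close>).  In comments, a
  star marks complex conjugates and barred indices.\<close>

definition pd :: "(complex^'n \<Rightarrow> complex) \<Rightarrow> 'n::finite \<Rightarrow> complex^'n \<Rightarrow> complex" where
  "pd f k z = (frechet_derivative f (at z) (axis k 1)
                 - \<i> * frechet_derivative f (at z) (axis k \<i>)) / 2"

definition pdbar :: "(complex^'n \<Rightarrow> complex) \<Rightarrow> 'n::finite \<Rightarrow> complex^'n \<Rightarrow> complex" where
  "pdbar f k z = (frechet_derivative f (at z) (axis k 1)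
                 + \<i> * frechet_derivative f (at z) (axis k \<i>)) / 2"

text \<open>Real differentiability of class \<open>C\<^sup>k\<close> and \<open>C\<^sup>\<infinity>\<close>, for functions on an open set.\<close>

fun Ck_on :: "nat \<Rightarrow> ('v::real_normed_vector \<Rightarrow> 'w::real_normed_vector) \<Rightarrow> 'v set \<Rightarrow> bool" where
  "Ck_on 0 f S \<longleftrightarrow> continuous_on S f"
| "Ck_on (Suc k) f S \<longleftrightarrow> (\<forall>x\<in>S. f differentiable (at x)) \<and>
     (\<forall>v. Ck_on k (\<lambda>x. frechet_derivative f (at x) v) S)"

definition smooth_on :: "('v::real_normed_vector \<Rightarrow> 'w::real_normed_vector) \<Rightarrow> 'v set \<Rightarrow> bool" where
  "smooth_on f S \<longleftrightarrow> (\<forall>k. Ck_on k f S)"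

text \<open>Holomorphic maps between open subsets of \<open>\<complex>\<^sup>n\<close> and \<open>\<complex>\<^sup>m\<close>: the real derivative exists and
  is complex linear.\<close>

definition holo_on :: "(complex^'n::finite \<Rightarrow> complex^'m::finite) \<Rightarrow> (complex^'n) set \<Rightarrow> bool" where
  "holo_on f S \<longleftrightarrow> (\<forall>z\<in>S. \<exists>D. (f has_derivative D) (at z) \<and> (\<forall>c v. D (c *s v) = c *s D v))"

text \<open>The matrix \<open>\<partial>\<^sup>2\<Phi>/\<partial>z\<^sub>i\<partial>z\<^sub>j*\<close>: the metric whose Kaehler form has potential \<open>\<Phi>\<close>.\<close>

definition levi :: "(complex^'n \<Rightarrow> real) \<Rightarrow> complex^'n::finite \<Rightarrow> complex^'n^'n" where
  "levi \<Phi> z = (\<chi> i j. pd (pdbar (\<lambda>w. complex_of_real (\<Phi> w)) j) i z)"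

text \<open>Pullback of a Hermitian form along a holomorphic map.\<close>

definition pullback :: "(complex^'n \<Rightarrow> complex^'m) \<Rightarrow> (complex^'m \<Rightarrow> complex^'m^'m) \<Rightarrow>
    complex^'n::finite \<Rightarrow> complex^'n^'n" where
  "pullback f h z = (\<chi> i j. \<Sum>a\<in>(UNIV::'m::finite set). \<Sum>b\<in>UNIV.
      pd (\<lambda>w. f w $ a) i z * cnj (pd (\<lambda>w. f w $ b) j z) * h (f z) $ a $ b)"


section \<open>Kaehler manifolds\<close>

text \<open>A chart is a pair of a domain and a coordinate map whose values outside the domain are
  irrelevant.  A Hermitian metric is given by its coefficient matrices
  \<open>gmat X c z $ i $ j = g\<^bsub>i j*\<^esub>(z)\<close> with respect to the charts \<open>c\<close> of the atlas, as
  functions of the coordinates \<open>z\<close>.\<close>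

type_synonym ('a, 'n) chart = "'a set \<times> ('a \<Rightarrow> complex^'n)"

record ('a, 'n) hmfd =
  under :: "'a topology"
  atlas :: "('a, 'n) chart set"
  gmat :: "('a, 'n) chart \<Rightarrow> complex^'n \<Rightarrow> complex^'n^'n"

definition cinv :: "('a, 'n) chart \<Rightarrow> complex^'n::finite \<Rightarrow> 'a" where
  "cinv c = inv_into (fst c) (snd c)"

definition is_chart :: "'a topology \<Rightarrow> ('a, 'n::finite) chart \<Rightarrow> bool" where
  "is_chart T c \<longleftrightarrow> openin T (fst c) \<and> open (snd c ` fst c) \<and>
     homeomorphic_map (subtopology T (fst c)) (top_of_set (snd c ` fst c)) (snd c)"

definition transition :: "('a, 'n) chart \<Rightarrow> ('a, 'n) chart \<Rightarrow> complex^'n::finite \<Rightarrow> complex^'n" where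
  "transition c d = snd d \<circ> cinv c"

definition compatible :: "('a, 'n::finite) chart \<Rightarrow> ('a, 'n) chart \<Rightarrow> bool" where
  "compatible c d \<longleftrightarrow> holo_on (transition c d) (snd c ` (fst c \<inter> fst d)) \<and>
                     holo_on (transition d c) (snd d ` (fst c \<inter> fst d))"

definition complex_manifold :: "('a, 'n::finite) hmfd \<Rightarrow> bool" where
  "complex_manifold X \<longleftrightarrow>
     Hausdorff_space (under X) \<and> second_countable (under X) \<and>
     (\<forall>c\<in>atlas X. is_chart (under X) c) \<and>
     topspace (under X) \<subseteq> (\<Union>c\<in>atlas X. fst c) \<and>
     (\<forall>c\<in>atlas X. \<forall>d\<in>atlas X. compatible c d)"

text \<open>Arbitrary holomorphic coordinates, i.e. the charts of the maximal atlas.\<close>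

definition holomorphic_chart :: "('a, 'n::finite) hmfd \<Rightarrow> ('a, 'n) chart \<Rightarrow> bool" where
  "holomorphic_chart X c \<longleftrightarrow> is_chart (under X) c \<and> (\<forall>d\<in>atlas X. compatible c d)"

definition kaehler_manifold :: "('a, 'n::finite) hmfd \<Rightarrow> bool" where
  "kaehler_manifold X \<longleftrightarrow> complex_manifold X \<and>
     (\<forall>c\<in>atlas X.
        (\<forall>i j. smooth_on (\<lambda>z. gmat X c z $ i $ j) (snd c ` fst c)) \<and>
        (\<forall>z\<in>snd c ` fst c.
           (\<forall>i j. gmat X c z $ i $ j = cnj (gmat X c z $ j $ i)) \<and>
           (\<forall>v. v \<noteq> 0 \<longrightarrow>
              0 < Re (\<Sum>i\<in>UNIV. \<Sum>j\<in>UNIV. gmat X c z $ i $ j * v $ i * cnj (v $ j))) \<and>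
           (\<forall>i j k. pd (\<lambda>w. gmat X c w $ i $ j) k z = pd (\<lambda>w. gmat X c w $ k $ j) i z))) \<and>
     (\<forall>c\<in>atlas X. \<forall>d\<in>atlas X. \<forall>z\<in>snd c ` (fst c \<inter> fst d).
        gmat X c z = pullback (transition c d) (gmat X d) z)"

definition kaehler_potential :: "('a, 'n::finite) hmfd \<Rightarrow> 'a set \<Rightarrow> ('a \<Rightarrow> real) \<Rightarrow> bool" where
  "kaehler_potential X U \<Phi> \<longleftrightarrow>
     (\<forall>c\<in>atlas X. smooth_on (\<Phi> \<circ> cinv c) (snd c ` (U \<inter> fst c)) \<and>
        (\<forall>z\<in>snd c ` (U \<inter> fst c). gmat X c z = levi (\<Phi> \<circ> cinv c) z))"

definition radial :: "('a, 'n::finite) hmfd \<Rightarrow> bool" where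
  "radial X \<longleftrightarrow> (\<forall>p\<in>topspace (under X). \<exists>c f. holomorphic_chart X c \<and> p \<in> fst c \<and>
     kaehler_potential X (fst c) (\<lambda>q. f ((norm (snd c q))\<^sup>2)))"


section \<open>Curvature and the coefficient \<open>a\<^sub>3\<close>\<close>

text \<open>Throughout, \<open>G\<close> is the coefficient matrix of a Kaehler metric in local coordinates.
  \<open>ginv G i j\<close> is \<open>g\<^bsup>i j*\<^esup>\<close>, with the first (unbarred) index contracted against unbarred lower
  indices and the second against barred ones: \<open>\<Sum>j. g\<^bsup>i j*\<^esup> g\<^bsub>k j*\<^esub> = \<delta>\<^bsub>ik\<^esub>\<close>; hence the transpose.
  In \<open>curv\<close>, \<open>ric\<close> etc. the index arguments are listed in the order in which they occur in
  \<open>R\<^bsub>i j* k l*\<^esub>\<close>, \<open>Ric\<^bsub>i j*, k l*\<^esub>\<close>.\<close>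

type_synonym 'n mfun = "complex^'n \<Rightarrow> complex^'n^'n"

definition ginv :: "'n::finite mfun \<Rightarrow> 'n \<Rightarrow> 'n \<Rightarrow> complex^'n \<Rightarrow> complex" where
  "ginv G i j z = matrix_inv (G z) $ j $ i"

definition curv :: "'n::finite mfun \<Rightarrow> 'n \<Rightarrow> 'n \<Rightarrow> 'n \<Rightarrow> 'n \<Rightarrow> complex^'n \<Rightarrow> complex" where
  "curv G i j k l z = pd (pdbar (\<lambda>w. G w $ i $ j) l) k z
     - (\<Sum>p\<in>UNIV. \<Sum>q\<in>UNIV. ginv G p q z * pd (\<lambda>w. G w $ i $ q) k z * pdbar (\<lambda>w. G w $ p $ j) l z)"

definition ric :: "'n::finite mfun \<Rightarrow> 'n \<Rightarrow> 'n \<Rightarrow> complex^'n \<Rightarrow> complex" where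
  "ric G i j z = (\<Sum>l\<in>UNIV. \<Sum>m\<in>UNIV. ginv G l m z * curv G i j l m z)"

definition scal :: "'n::finite mfun \<Rightarrow> complex^'n \<Rightarrow> complex" where
  "scal G z = (\<Sum>i\<in>UNIV. \<Sum>j\<in>UNIV. ginv G i j z * ric G i j z)"

definition lap :: "'n::finite mfun \<Rightarrow> (complex^'n \<Rightarrow> complex) \<Rightarrow> complex^'n \<Rightarrow> complex" where
  "lap G u z = (\<Sum>i\<in>UNIV. \<Sum>j\<in>UNIV. ginv G i j z * pd (pdbar u j) i z)"

text \<open>Covariant derivatives with respect to the connection
  \<open>\<Gamma>\<^sup>p\<^bsub>ki\<^esub> = g\<^bsup>p q*\<^esup> \<partial>\<^sub>k g\<^bsub>i q*\<^esub>\<close>, whose mixed Christoffel symbols vanish: \<open>ric1 G i j k\<close> is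
  \<open>Ric\<^bsub>i j*, k\<^esub>\<close> and \<open>ric2 G i j k l\<close> is \<open>Ric\<^bsub>i j*, k l*\<^esub>\<close>.\<close>

definition ric1 :: "'n::finite mfun \<Rightarrow> 'n \<Rightarrow> 'n \<Rightarrow> 'n \<Rightarrow> complex^'n \<Rightarrow> complex" where
  "ric1 G i j k z = pd (ric G i j) k z
     - (\<Sum>p\<in>UNIV. \<Sum>q\<in>UNIV. ginv G p q z * pd (\<lambda>w. G w $ i $ q) k z * ric G p j z)"

definition ric2 :: "'n::finite mfun \<Rightarrow> 'n \<Rightarrow> 'n \<Rightarrow> 'n \<Rightarrow> 'n \<Rightarrow> complex^'n \<Rightarrow> complex" where
  "ric2 G i j k l z = pdbar (ric1 G i j k) l z
     - (\<Sum>p\<in>UNIV. \<Sum>q\<in>UNIV. ginv G p q z * pdbar (\<lambda>w. G w $ p $ j) l z * ric1 G i q k z)"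

definition norm2_R :: "'n::finite mfun \<Rightarrow> complex^'n \<Rightarrow> complex" where
  "norm2_R G z = (\<Sum>i\<in>UNIV. \<Sum>j\<in>UNIV. \<Sum>k\<in>UNIV. \<Sum>l\<in>UNIV.
     \<Sum>\<alpha>\<in>UNIV. \<Sum>\<beta>\<in>UNIV. \<Sum>\<gamma>\<in>UNIV. \<Sum>\<delta>\<in>UNIV.
       ginv G i \<alpha> z * ginv G \<beta> j z * ginv G k \<gamma> z * ginv G \<delta> l z *
       curv G i j k l z * cnj (curv G \<alpha> \<beta> \<gamma> \<delta> z))"

definition norm2_Ric :: "'n::finite mfun \<Rightarrow> complex^'n \<Rightarrow> complex" where
  "norm2_Ric G z = (\<Sum>i\<in>UNIV. \<Sum>j\<in>UNIV. \<Sum>\<alpha>\<in>UNIV. \<Sum>\<beta>\<in>UNIV.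
       ginv G i \<alpha> z * ginv G \<beta> j z * ric G i j z * cnj (ric G \<alpha> \<beta> z))"

definition norm2_Dscal :: "'n::finite mfun \<Rightarrow> complex^'n \<Rightarrow> complex" where
  "norm2_Dscal G z = (\<Sum>i\<in>UNIV. \<Sum>j\<in>UNIV. ginv G i j z * pd (scal G) i z * pdbar (scal G) j z)"

definition norm2_DRic :: "'n::finite mfun \<Rightarrow> complex^'n \<Rightarrow> complex" where
  "norm2_DRic G z = (\<Sum>i\<in>UNIV. \<Sum>j\<in>UNIV. \<Sum>k\<in>UNIV. \<Sum>\<alpha>\<in>UNIV. \<Sum>\<beta>\<in>UNIV. \<Sum>\<gamma>\<in>UNIV.
       ginv G i \<alpha> z * ginv G \<beta> j z * ginv G k \<gamma> z * ric1 G i j k z * cnj (ric1 G \<alpha> \<beta> \<gamma> z))"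

text \<open>The contraction \<open>g\<^bsup>i \<beta>*\<^esup> g\<^bsup>\<alpha> j*\<^esup> Ric\<^bsub>i j*\<^esub> \<partial>\<^sup>2\<sigma>/\<partial>z\<^sub>\<alpha>\<partial>z\<^sub>\<beta>*\<close>.\<close>

definition ric_hess_scal :: "'n::finite mfun \<Rightarrow> complex^'n \<Rightarrow> complex" where
  "ric_hess_scal G z = (\<Sum>i\<in>UNIV. \<Sum>j\<in>UNIV. \<Sum>\<alpha>\<in>UNIV. \<Sum>\<beta>\<in>UNIV.
       ginv G i \<beta> z * ginv G \<alpha> j z * ric G i j z * pd (pdbar (scal G) \<beta>) \<alpha> z)"

definition divdiv_scal_Ric :: "'n::finite mfun \<Rightarrow> complex^'n \<Rightarrow> complex" where
  "divdiv_scal_Ric G z = 2 * norm2_Dscal G z + ric_hess_scal G z + scal G z * lap G (scal G) z"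

definition sigma3_Ric :: "'n::finite mfun \<Rightarrow> complex^'n \<Rightarrow> complex" where
  "sigma3_Ric G z = (\<Sum>i\<in>UNIV. \<Sum>j\<in>UNIV. \<Sum>\<alpha>\<in>UNIV. \<Sum>\<beta>\<in>UNIV. \<Sum>\<gamma>\<in>UNIV. \<Sum>\<delta>\<in>UNIV.
       ginv G i \<delta> z * ginv G \<alpha> j z * ginv G \<gamma> \<beta> z * ric G i j z * ric G \<alpha> \<beta> z * ric G \<gamma> \<delta> z)"

definition R_Ric_Ric :: "'n::finite mfun \<Rightarrow> complex^'n \<Rightarrow> complex" where
  "R_Ric_Ric G z = (\<Sum>i\<in>UNIV. \<Sum>j\<in>UNIV. \<Sum>k\<in>UNIV. \<Sum>l\<in>UNIV.
     \<Sum>\<alpha>\<in>UNIV. \<Sum>\<beta>\<in>UNIV. \<Sum>\<gamma>\<in>UNIV. \<Sum>\<delta>\<in>UNIV.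
       ginv G i \<alpha> z * ginv G \<beta> j z * ginv G k \<gamma> z * ginv G \<delta> l z *
       curv G i j k l z * ric G \<beta> \<alpha> z * ric G \<delta> \<gamma> z)"

definition Ric_R_R :: "'n::finite mfun \<Rightarrow> complex^'n \<Rightarrow> complex" where
  "Ric_R_R G z = (\<Sum>i\<in>UNIV. \<Sum>j\<in>UNIV. \<Sum>k\<in>UNIV. \<Sum>p\<in>UNIV. \<Sum>q\<in>UNIV.
     \<Sum>\<alpha>\<in>UNIV. \<Sum>\<beta>\<in>UNIV. \<Sum>\<gamma>\<in>UNIV. \<Sum>\<delta>\<in>UNIV. \<Sum>\<epsilon>\<in>UNIV.
       ginv G i \<alpha> z * ginv G \<beta> j z * ginv G k \<gamma> z * ginv G p \<delta> z * ginv G \<epsilon> q z *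
       ric G i j z * curv G \<beta> \<gamma> p q z * curv G k \<alpha> \<epsilon> \<delta> z)"

definition divdiv_R_Ric :: "'n::finite mfun \<Rightarrow> complex^'n \<Rightarrow> complex" where
  "divdiv_R_Ric G z = - ric_hess_scal G z - 2 * norm2_DRic G z
     - (\<Sum>i\<in>UNIV. \<Sum>j\<in>UNIV. \<Sum>k\<in>UNIV. \<Sum>l\<in>UNIV.
        \<Sum>\<alpha>\<in>UNIV. \<Sum>\<beta>\<in>UNIV. \<Sum>\<gamma>\<in>UNIV. \<Sum>\<delta>\<in>UNIV.
          ginv G i \<alpha> z * ginv G \<beta> j z * ginv G k \<gamma> z * ginv G \<delta> l z *
          ric2 G i j k l z * curv G \<beta> \<alpha> \<delta> \<gamma> z)
     - R_Ric_Ric G z + sigma3_Ric G z"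

definition a3 :: "'n::finite mfun \<Rightarrow> complex^'n \<Rightarrow> complex" where
  "a3 G z =
     - (1/8) * lap G (lap G (scal G)) z
     + (1/24) * divdiv_R_Ric G z
     - (1/6) * divdiv_scal_Ric G z
     + (1/48) * lap G (\<lambda>w. norm2_R G w - 4 * norm2_Ric G w + 8 * (scal G w)\<^sup>2) z
     - (1/48) * scal G z * ((scal G z)\<^sup>2 + norm2_R G z - 4 * norm2_Ric G z)
     - (1/24) * (sigma3_Ric G z - Ric_R_R G z + R_Ric_Ric G z)"

definition kaehler_einstein :: "('a, 'n::finite) hmfd \<Rightarrow> bool" where
  "kaehler_einstein X \<longleftrightarrow> (\<exists>\<kappa>::real. \<forall>c\<in>atlas X. \<forall>z\<in>snd c ` fst c. \<forall>i j.
     ric (gmat X c) i j z = complex_of_real \<kappa> * gmat X c z $ i $ j)"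

definition a3_vanishes :: "('a, 'n::finite) hmfd \<Rightarrow> bool" where
  "a3_vanishes X \<longleftrightarrow> (\<forall>c\<in>atlas X. \<forall>z\<in>snd c ` fst c. a3 (gmat X c) z = 0)"


section \<open>Holomorphic isometries\<close>

text \<open>\<open>F\<close> is a biholomorphic isometry from the open set \<open>V\<close> of \<open>X\<close> onto the open set \<open>W\<close> of \<open>Y\<close>.\<close>

definition biholomorphic_isometry ::
    "('a, 'n::finite) hmfd \<Rightarrow> ('b, 'm::finite) hmfd \<Rightarrow> 'a set \<Rightarrow> 'b set \<Rightarrow> ('a \<Rightarrow> 'b) \<Rightarrow> bool" where
  "biholomorphic_isometry X Y V W F \<longleftrightarrow>
     openin (under X) V \<and> openin (under Y) W \<and>
     homeomorphic_map (subtopology (under X) V) (subtopology (under Y) W) F \<and>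
     (\<forall>c\<in>atlas X. \<forall>d\<in>atlas Y.
        (let S = {p \<in> V \<inter> fst c. F p \<in> fst d}; f = snd d \<circ> F \<circ> cinv c in
           holo_on f (snd c ` S) \<and>
           holo_on (snd c \<circ> inv_into V F \<circ> cinv d) (snd d ` F ` S) \<and>
           (\<forall>z\<in>snd c ` S. gmat X c z = pullback f (gmat Y d) z)))"

definition locally_biholomorphically_isometric ::
    "('a, 'n::finite) hmfd \<Rightarrow> ('b, 'm::finite) hmfd \<Rightarrow> bool" where
  "locally_biholomorphically_isometric X Y \<longleftrightarrow>
     (\<forall>p\<in>topspace (under X). \<exists>V W F. p \<in> V \<and> biholomorphic_isometry X Y V W F)"

definition rescale :: "real \<Rightarrow> ('a, 'n::finite) hmfd \<Rightarrow> ('a, 'n) hmfd" where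
  "rescale r X = X\<lparr>gmat := \<lambda>c z. r *\<^sub>R gmat X c z\<rparr>"


section \<open>The standard metrics\<close>

definition flat_space :: "(complex^'n, 'n::finite) hmfd" where
  "flat_space = \<lparr>under = euclidean, atlas = {(UNIV, \<lambda>z. z)}, gmat = (\<lambda>_ _. mat 1)\<rparr>"

definition hyperbolic_plane :: "(complex^2, 2) hmfd" where
  "hyperbolic_plane = \<lparr>under = top_of_set (ball 0 1), atlas = {(ball 0 1, \<lambda>z. z)},
     gmat = (\<lambda>_. levi (\<lambda>z. - ln (1 - (norm z)\<^sup>2)))\<rparr>"

text \<open>\<open>\<complex>P\<^sup>2\<close> as the space of lines in \<open>\<complex>\<^sup>3\<close> with the quotient topology, the three standard affine
  charts and the Fubini--Study metric.  In an affine chart \<open>affine_rep i L\<close> is the vector of the line \<open>L\<close>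
  whose \<open>i\<close>-th homogeneous coordinate is 1.\<close>

definition line :: "complex^3 \<Rightarrow> (complex^3) set" where
  "line v = range (\<lambda>c. c *s v)"

definition projective_topology :: "(complex^3) set topology" where
  "projective_topology =
     topology (\<lambda>U. U \<subseteq> line ` (- {0}) \<and> open {v. v \<noteq> 0 \<and> line v \<in> U})"

definition affine_rep :: "3 \<Rightarrow> (complex^3) set \<Rightarrow> complex^3" where
  "affine_rep i L = (THE v. v \<in> L \<and> v $ i = 1)"

definition affine_chart :: "3 \<Rightarrow> 3 \<Rightarrow> 3 \<Rightarrow> ((complex^3) set, 2) chart" where
  "affine_chart i j k =
     (line ` {v. v $ i \<noteq> 0}, \<lambda>L. vector [affine_rep i L $ j, affine_rep i L $ k])"

definition projective_plane :: "((complex^3) set, 2) hmfd" where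
  "projective_plane = \<lparr>under = projective_topology,
     atlas = {affine_chart 1 2 3, affine_chart 2 1 3, affine_chart 3 1 2},
     gmat = (\<lambda>_. levi (\<lambda>z. ln (1 + (norm z)\<^sup>2)))\<rparr>"

lemma istopology_projective:
  "istopology (\<lambda>U. U \<subseteq> line ` (- {0}) \<and> open {v. v \<noteq> 0 \<and> line v \<in> U})"
proof -
  have "{v. v \<noteq> 0 \<and> line v \<in> S \<inter> T} = {v. v \<noteq> 0 \<and> line v \<in> S} \<inter> {v. v \<noteq> 0 \<and> line v \<in> T}" for S T
    by auto
  moreover have "{v. v \<noteq> 0 \<and> line v \<in> \<Union>\<K>} = (\<Union>K\<in>\<K>. {v. v \<noteq> 0 \<and> line v \<in> K})" for \<K>
    by auto
  ultimately show ?thesis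
    unfolding istopology_def by (auto simp: open_Int intro!: open_UN)
qed

lemma openin_projective_topology:
  "openin projective_topology U \<longleftrightarrow> U \<subseteq> line ` (- {0}) \<and> open {v. v \<noteq> 0 \<and> line v \<in> U}"
  unfolding projective_topology_def using topology_inverse'[OF istopology_projective] by simp

end

theory Submission
  imports Defs "HOL-Complex_Analysis.Cauchy_Integral_Formula"
begin

text \<open>
  For a Kaehler--Einstein metric with \<open>Ric = \<kappa> g\<close> in dimension \<open>n\<close> the formula for \<open>a\<^sub>3\<close> collapses to
  \<open>48 a\<^sub>3 = \<Delta>|R|\<^sup>2 + (2 - n) \<kappa> |R|\<^sup>2 - n (n - 2)\<^sup>2 \<kappa>\<^sup>3\<close>.  For a potential \<open>f(|z|\<^sup>2)\<close> put \<open>x = |z|\<^sup>2\<close>, \<open>y = x f'(x)\<close>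
  and \<open>\<delta> = f''/f'\<^sup>2 - \<kappa>/(n + 1)\<close>.  The curvature tensor is then determined by \<open>g\<close>, \<open>\<partial>|z|\<^sup>2\<close> and \<open>\<delta>\<close>, with
  \<open>|R|\<^sup>2 = 2n\<kappa>\<^sup>2/(n + 1) + n (n - 1) (n + 1) (n + 2) \<delta>\<^sup>2\<close>, and the Einstein equation reads \<open>\<delta> = C y\<^bsup>- n - 1\<^esup>\<close>.
  Hence \<open>a\<^sub>3 = 0\<close> is a polynomial equation in \<open>1/y\<close>, which forces \<open>C = 0\<close> and then \<open>n = 2\<close> or \<open>\<kappa> = 0\<close>; and
  \<open>\<delta> = 0\<close> integrates to the potential of a space form.  Conversely, the curvature tensor of a space form
  is \<open>\<mu> (g\<^bsub>ij*\<^esub> g\<^bsub>kl*\<^esub> + g\<^bsub>il*\<^esub> g\<^bsub>kj*\<^esub>)\<close>, a shape that every holomorphic isometry preserves.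
\<close>

text \<open>Metric coefficients exist only in atlas charts, whereas a radial chart lies in the
  maximal atlas. So the metric of an atlas chart is treated as the pullback of a radial matrix along
  a transition map. This needs the curvature to be a tensor, hence derivatives of holomorphic maps
  of several variables to be holomorphic again, which is obtained from Cauchy estimates on complex
  lines. A local isometry read in charts is another such pullback, so one setting serves both
  implications. The origin of a radial chart is special: smoothness of f(t) is extracted from that
  of f(|z|^2) only for t > 0, and at z = 0 the form \<partial>|z|^2 vanishes, so the Einstein
  equation no longer separates the coefficients of the curvature. The equations are therefore solved
  on the punctured chart, and the explicit potential is extended to 0 by continuity. Dimension at
  least two enters through a vector orthogonal to z, which gives f' > 0, and through the
  independence of g and the square of \<partial>|z|^2. In the sign convention used for Ric, \<kappa>
  > 0 is the hyperbolic case.\<close>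

abbreviation (input) sum_UNIV :: "('i \<Rightarrow> 'a::comm_monoid_add) \<Rightarrow> 'a" (binder "\<^bold>\<Sum>" 10) where
  "sum_UNIV f \<equiv> sum f UNIV"

section \<open>Wirtinger derivatives and holomorphic functions\<close>

text \<open>The differential is written with explicit coefficients of dz_k and of its conjugate, so
  that one rule of calculus proves real differentiability and computes both Wirtinger derivatives at
  once. By \<open>has_wd_pd\<close> the coefficients are unique.\<close>

definition has_wd :: "(complex^'n::finite \<Rightarrow> complex) \<Rightarrow> ('n \<Rightarrow> complex) \<Rightarrow> ('n \<Rightarrow> complex) \<Rightarrow>
    complex^'n \<Rightarrow> bool" where
  "has_wd f a b z \<longleftrightarrow> (f has_derivative (\<lambda>v. \<^bold>\<Sum>k. a k * v $ k + b k * cnj (v $ k))) (at z)"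

lemma sum_axis:
  fixes a :: "'n::finite \<Rightarrow> complex"
  shows "(\<^bold>\<Sum>k. a k * axis i c $ k) = a i * c" "(\<^bold>\<Sum>k. a k * cnj (axis i c $ k)) = a i * cnj c"
proof -
  have "(\<^bold>\<Sum>k. a k * axis i c $ k) = (\<Sum>k\<in>{i}. a k * axis i c $ k)"
    by (rule sum.mono_neutral_right) (auto simp: axis_def)
  thus "(\<^bold>\<Sum>k. a k * axis i c $ k) = a i * c" by simp
  have "(\<^bold>\<Sum>k. a k * cnj (axis i c $ k)) = (\<Sum>k\<in>{i}. a k * cnj (axis i c $ k))"
    by (rule sum.mono_neutral_right) (auto simp: axis_def)
  thus "(\<^bold>\<Sum>k. a k * cnj (axis i c $ k)) = a i * cnj c" by simp
qed

lemma has_wd_pd: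
  assumes "has_wd f a b z"
  shows "pd f k z = a k" "pdbar f k z = b k"
proof -
  have D: "frechet_derivative f (at z) = (\<lambda>v. \<^bold>\<Sum>k. a k * v $ k + b k * cnj (v $ k))"
    by (rule frechet_derivative_at[OF assms[unfolded has_wd_def], symmetric])
  show "pd f k z = a k" "pdbar f k z = b k"
    unfolding pd_def pdbar_def D by (simp_all add: sum.distrib sum_axis algebra_simps)
qed

lemma has_wd_cong: "has_wd f a b z \<Longrightarrow> (\<And>k. a k = a' k) \<Longrightarrow> (\<And>k. b k = b' k) \<Longrightarrow> has_wd f a' b' z"
  unfolding has_wd_def by simp

lemma has_wd_imp_differentiable: "has_wd f a b z \<Longrightarrow> f differentiable (at z)"
  unfolding has_wd_def differentiable_def by blast

lemma complex_axis_expansion: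
  fixes v :: "complex^'n::finite"
  shows "v = (\<^bold>\<Sum>k. Re (v $ k) *\<^sub>R axis k 1 + Im (v $ k) *\<^sub>R axis k \<i>)"
proof -
  have "(\<^bold>\<Sum>k. Re (v $ k) *\<^sub>R axis k 1 $ i + Im (v $ k) *\<^sub>R axis k \<i> $ i) =
     (\<^bold>\<Sum>k. if k = i then v $ i else 0)" for i
  proof (rule sum.cong)
    fix k
    have "Re (v $ i) *\<^sub>R 1 + Im (v $ i) *\<^sub>R \<i> = v $ i"
      by (simp add: complex_eq_iff)
    thus "Re (v $ k) *\<^sub>R axis k 1 $ i + Im (v $ k) *\<^sub>R axis k \<i> $ i = (if k = i then v $ i else 0)"
      by (auto simp: axis_def)
  qed simp
  thus ?thesis by (simp add: vec_eq_iff sum_component)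
qed

lemma differentiable_imp_has_wd:
  assumes "f differentiable (at z)"
  shows "has_wd f (\<lambda>k. pd f k z) (\<lambda>k. pdbar f k z) z"
proof -
  define D where "D = frechet_derivative f (at z)"
  have D: "(f has_derivative D) (at z)"
    using assms unfolding D_def by (rule frechet_derivative_works[THEN iffD1])
  interpret bounded_linear D using D by (rule has_derivative_bounded_linear)
  have "D v = (\<^bold>\<Sum>k. pd f k z * v $ k + pdbar f k z * cnj (v $ k))" for v
  proof -
    have "D v = (\<^bold>\<Sum>k. Re (v $ k) *\<^sub>R D (axis k 1) + Im (v $ k) *\<^sub>R D (axis k \<i>))"
      by (subst complex_axis_expansion) (simp add: sum add scaleR)
    also have "\<dots> = (\<^bold>\<Sum>k. pd f k z * v $ k + pdbar f k z * cnj (v $ k))"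
    proof (rule sum.cong)
      fix k
      show "Re (v $ k) *\<^sub>R D (axis k 1) + Im (v $ k) *\<^sub>R D (axis k \<i>) =
        pd f k z * v $ k + pdbar f k z * cnj (v $ k)"
        unfolding pd_def pdbar_def D_def[symmetric]
        by (subst (9 10) complex_eq) (simp add: scaleR_conv_of_real field_simps)
    qed simp
    finally show ?thesis .
  qed
  hence "D = (\<lambda>v. \<^bold>\<Sum>k. pd f k z * v $ k + pdbar f k z * cnj (v $ k))" by blast
  with D show ?thesis unfolding has_wd_def by simp
qed

lemma has_wd_transform:
  assumes "has_wd f a b z" "open S" "z \<in> S" "\<And>w. w \<in> S \<Longrightarrow> f w = g w"
  shows "has_wd g a b z"
  using assms has_derivative_transform_within_open unfolding has_wd_def by blast

lemma has_wd_const [simp]: "has_wd (\<lambda>_. c) (\<lambda>_. 0) (\<lambda>_. 0) z"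
  unfolding has_wd_def by simp

lemma has_wd_coord: "has_wd (\<lambda>w. w $ i) (\<lambda>k. if k = i then 1 else 0) (\<lambda>_. 0) z"
proof -
  have "((\<lambda>w. w $ i) has_derivative (\<lambda>v. v $ i)) (at z)"
    by (rule bounded_linear_imp_has_derivative[OF bounded_linear_vec_nth])
  moreover have "(\<lambda>v. v $ i) = (\<lambda>v. \<^bold>\<Sum>k. (if k = i then 1 else 0) * v $ k + 0 * cnj (v $ k :: complex))"
    by (simp add: mult_delta_left)
  ultimately show ?thesis unfolding has_wd_def by simp
qed

lemma has_wd_cnj:
  assumes "has_wd f a b z"
  shows "has_wd (\<lambda>w. cnj (f w)) (\<lambda>k. cnj (b k)) (\<lambda>k. cnj (a k)) z"
  using assms has_derivative_cnj unfolding has_wd_def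
  by (fastforce simp: add.commute)

lemma has_wd_add:
  assumes "has_wd f a b z" "has_wd g a' b' z"
  shows "has_wd (\<lambda>w. f w + g w) (\<lambda>k. a k + a' k) (\<lambda>k. b k + b' k) z"
  using has_derivative_add[OF assms[unfolded has_wd_def]] unfolding has_wd_def
  by (simp add: sum.distrib algebra_simps)

lemma has_wd_mult:
  assumes "has_wd f a b z" "has_wd g a' b' z"
  shows "has_wd (\<lambda>w. f w * g w) (\<lambda>k. a k * g z + f z * a' k) (\<lambda>k. b k * g z + f z * b' k) z"
  using has_derivative_mult[OF assms[unfolded has_wd_def]] unfolding has_wd_def
  by (simp add: sum.distrib algebra_simps sum_distrib_left)

lemma has_wd_cmult:
  assumes "has_wd f a b z"
  shows "has_wd (\<lambda>w. c * f w) (\<lambda>k. c * a k) (\<lambda>k. c * b k) z"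
  using has_wd_mult[OF has_wd_const assms, of c] by simp

lemma has_wd_uminus:
  assumes "has_wd f a b z"
  shows "has_wd (\<lambda>w. - f w) (\<lambda>k. - a k) (\<lambda>k. - b k) z"
  using has_wd_cmult[OF assms, of "-1"] by simp

lemma has_wd_diff:
  assumes "has_wd f a b z" "has_wd g a' b' z"
  shows "has_wd (\<lambda>w. f w - g w) (\<lambda>k. a k - a' k) (\<lambda>k. b k - b' k) z"
  using has_wd_add[OF assms(1) has_wd_uminus[OF assms(2)]] by simp

lemma has_wd_sum:
  assumes "finite I" "\<And>i. i \<in> I \<Longrightarrow> has_wd (f i) (a i) (b i) z"
  shows "has_wd (\<lambda>w. \<Sum>i\<in>I. f i w) (\<lambda>k. \<Sum>i\<in>I. a i k) (\<lambda>k. \<Sum>i\<in>I. b i k) z"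
  using assms by (induction I rule: finite_induct) (auto intro: has_wd_add)

text \<open>A real-valued \<open>u\<close> has a real differential, by uniqueness of derivatives, so
  the complex expression for it equals its real part, and the real factor \<open>d\<close> acts on
  both coefficient families.\<close>

lemma has_wd_Re_comp:
  assumes "has_wd (\<lambda>w. of_real (u w)) a b z" "(\<phi> has_real_derivative d) (at (u z))"
  shows "has_wd (\<lambda>w. of_real (\<phi> (u w))) (\<lambda>k. of_real d * a k) (\<lambda>k. of_real d * b k) z"
proof -
  let ?D = "\<lambda>v. \<^bold>\<Sum>k. a k * v $ k + b k * cnj (v $ k)"
  have D: "((\<lambda>w. complex_of_real (u w)) has_derivative ?D) (at z)" by (rule assms(1)[unfolded has_wd_def])
  have u: "(u has_derivative (\<lambda>v. Re (?D v))) (at z)"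
    using has_derivative_Re[OF D] by simp
  have "((\<lambda>w. complex_of_real (u w)) has_derivative (\<lambda>v. of_real (Re (?D v)))) (at z)"
    using u by (rule has_derivative_of_real)
  from has_derivative_unique[OF D this] have eq: "?D v = of_real (Re (?D v))" for v
    by (rule fun_cong)
  have "((\<lambda>w. \<phi> (u w)) has_derivative (\<lambda>v. d * Re (?D v))) (at z)"
    using has_derivative_compose[OF u assms(2)[unfolded has_field_derivative_def]] by simp
  hence "((\<lambda>w. complex_of_real (\<phi> (u w))) has_derivative (\<lambda>v. of_real (d * Re (?D v)))) (at z)"
    by (rule has_derivative_of_real)
  moreover have "(\<lambda>v. complex_of_real (d * Re (?D v))) =
      (\<lambda>v. \<^bold>\<Sum>k. of_real d * a k * v $ k + of_real d * b k * cnj (v $ k))"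
  proof
    fix v
    have "complex_of_real (d * Re (?D v)) = of_real d * ?D v"
      unfolding of_real_mult eq[of v, symmetric] by (rule refl)
    thus "complex_of_real (d * Re (?D v)) = (\<^bold>\<Sum>k. of_real d * a k * v $ k + of_real d * b k * cnj (v $ k))"
      by (simp add: sum_distrib_left algebra_simps)
  qed
  ultimately show ?thesis unfolding has_wd_def by simp
qed

lemma norm2_eq_sum: "complex_of_real ((norm w)\<^sup>2) = (\<^bold>\<Sum>i. w $ i * cnj (w $ i))" for w :: "complex^'a::finite"
proof -
  have "(norm w)\<^sup>2 = (\<^bold>\<Sum>i. (norm (w $ i))\<^sup>2)"
    unfolding norm_vec_def L2_set_def by (simp add: sum_nonneg)
  thus ?thesis by (simp only: of_real_sum complex_norm_square)
qed

lemma has_wd_norm2: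
  "has_wd (\<lambda>w. of_real ((norm w)\<^sup>2)) (\<lambda>k. cnj (z $ k)) (\<lambda>k. z $ k) z"
proof -
  have "has_wd (\<lambda>w. \<^bold>\<Sum>i. w $ i * cnj (w $ i))
     (\<lambda>k. \<^bold>\<Sum>i. (if k = i then 1 else 0) * cnj (z $ i) + z $ i * cnj 0)
     (\<lambda>k. \<^bold>\<Sum>i. 0 * cnj (z $ i) + z $ i * cnj (if k = i then 1 else 0)) z"
    by (intro has_wd_sum has_wd_mult has_wd_cnj has_wd_coord) auto
  thus ?thesis unfolding norm2_eq_sum
  proof (rule has_wd_cong)
    fix k
    show "(\<^bold>\<Sum>i. (if k = i then 1 else 0) * cnj (z $ i) + z $ i * cnj 0) = cnj (z $ k)"
      by (subst sum.mono_neutral_right[of _ "{k}"]) auto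
    show "(\<^bold>\<Sum>i. 0 * cnj (z $ i) + z $ i * cnj (if k = i then 1 else 0)) = z $ k"
      by (subst sum.mono_neutral_right[of _ "{k}"]) auto
  qed
qed

lemma has_wd_radial:
  assumes "(\<phi> has_real_derivative d) (at ((norm z)\<^sup>2))"
  shows "has_wd (\<lambda>w. of_real (\<phi> ((norm w)\<^sup>2))) (\<lambda>k. of_real d * cnj (z $ k)) (\<lambda>k. of_real d * z $ k) z"
  using has_wd_Re_comp[OF has_wd_norm2 assms] .

lemma pd_cong_open:
  assumes "open S" "z \<in> S" "\<And>w. w \<in> S \<Longrightarrow> f w = g w"
  shows "pd f k z = pd g k z" "pdbar f k z = pdbar g k z"
proof -
  have "(f has_derivative D) (at z) \<longleftrightarrow> (g has_derivative D) (at z)" for D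
    using assms has_derivative_transform_within_open by metis
  hence "frechet_derivative f (at z) = frechet_derivative g (at z)"
    unfolding frechet_derivative_def by simp
  thus "pd f k z = pd g k z" "pdbar f k z = pdbar g k z" unfolding pd_def pdbar_def by simp_all
qed

section \<open>Holomorphic functions and maps of several variables\<close>

definition hol :: "(complex^'n::finite \<Rightarrow> complex) \<Rightarrow> complex^'n \<Rightarrow> bool" where
  "hol f z \<longleftrightarrow> has_wd f (\<lambda>k. pd f k z) (\<lambda>_. 0) z"

lemma holI:
  assumes "has_wd f a (\<lambda>_. 0) z"
  shows "hol f z"
  unfolding hol_def by (rule has_wd_cong[OF assms]) (simp_all add: has_wd_pd(1)[OF assms])

lemma hol_const: "hol (\<lambda>_. c) z" by (rule holI[OF has_wd_const])
lemma hol_coord: "hol (\<lambda>w. w $ i) z" by (rule holI[OF has_wd_coord])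
lemma hol_mult: "hol f z \<Longrightarrow> hol g z \<Longrightarrow> hol (\<lambda>w. f w * g w) z"
  unfolding hol_def[of f] hol_def[of g] by (drule (1) has_wd_mult) (rule holI, simp)
lemma hol_add: "hol f z \<Longrightarrow> hol g z \<Longrightarrow> hol (\<lambda>w. f w + g w) z"
  unfolding hol_def[of f] hol_def[of g] by (drule (1) has_wd_add) (rule holI, simp)

lemma hol_imp_differentiable: "hol f z \<Longrightarrow> f differentiable (at z)"
  unfolding hol_def by (rule has_wd_imp_differentiable)

lemma hol_transform:
  assumes "hol f z" "open S" "z \<in> S" "\<And>w. w \<in> S \<Longrightarrow> f w = g w"
  shows "hol g z"
  using assms has_wd_transform holI unfolding hol_def[of f] by blast

lemma hol_field_comp:
  assumes "hol f z" "(\<phi> has_field_derivative d) (at (f z))"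
  shows "hol (\<lambda>w. \<phi> (f w)) z"
proof -
  have "((\<lambda>w. \<phi> (f w)) has_derivative (\<lambda>v. d * (\<^bold>\<Sum>k. pd f k z * v $ k + 0 * cnj (v $ k)))) (at z)"
    using has_derivative_compose[OF assms(1)[unfolded hol_def has_wd_def] assms(2)[unfolded has_field_derivative_def]] .
  hence "has_wd (\<lambda>w. \<phi> (f w)) (\<lambda>k. d * pd f k z) (\<lambda>_. 0) z"
    unfolding has_wd_def by (simp add: sum_distrib_left algebra_simps)
  thus ?thesis by (rule holI)
qed

text \<open>\<open>holo_on\<close> asks for a complex linear derivative of the whole map,
  \<open>hol\<close> for vanishing conjugate coefficients of one component. A complex linear map is
  determined by its values on the vectors \<open>axis k 1\<close>, and these values are the
  remaining coefficients.\<close>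

lemma holo_on_iff:
  assumes "open S"
  shows "holo_on f S \<longleftrightarrow> (\<forall>z\<in>S. \<forall>a. hol (\<lambda>w. f w $ a) z)"
proof
  assume L: "holo_on f S"
  show "\<forall>z\<in>S. \<forall>a. hol (\<lambda>w. f w $ a) z"
  proof (intro ballI allI)
    fix z a assume "z \<in> S"
    then obtain D where D: "(f has_derivative D) (at z)" and lin: "\<And>c v. D (c *s v) = c *s D v"
      using L unfolding holo_on_def by blast
    interpret bounded_linear D using D by (rule has_derivative_bounded_linear)
    have "D v $ a = (\<^bold>\<Sum>k. D (axis k 1) $ a * v $ k + 0 * cnj (v $ k))" for v
    proof -
      have "v = (\<^bold>\<Sum>k. (v $ k) *s axis k 1)"
        by (simp add: vec_eq_iff sum_component axis_def mult_delta_right)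
      hence "D v = (\<^bold>\<Sum>k. (v $ k) *s D (axis k 1))" by (metis (no_types, lifting) lin sum sum.cong)
      thus ?thesis by (simp add: sum_component mult.commute)
    qed
    hence "(\<lambda>v. D v $ a) = (\<lambda>v. \<^bold>\<Sum>k. D (axis k 1) $ a * v $ k + 0 * cnj (v $ k))" by blast
    moreover have "((\<lambda>w. f w $ a) has_derivative (\<lambda>v. D v $ a)) (at z)"
      using bounded_linear.has_derivative[OF bounded_linear_vec_nth D] .
    ultimately have "has_wd (\<lambda>w. f w $ a) (\<lambda>k. D (axis k 1) $ a) (\<lambda>_. 0) z" unfolding has_wd_def by simp
    thus "hol (\<lambda>w. f w $ a) z" by (rule holI)
  qed
next
  assume R: "\<forall>z\<in>S. \<forall>a. hol (\<lambda>w. f w $ a) z"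
  show "holo_on f S" unfolding holo_on_def
  proof
    fix z assume "z \<in> S"
    let ?D = "\<lambda>v. \<chi> a. \<^bold>\<Sum>k. pd (\<lambda>w. f w $ a) k z * v $ k"
    have c: "((\<lambda>w. f w $ a) has_derivative (\<lambda>v. \<^bold>\<Sum>k. pd (\<lambda>w. f w $ a) k z * v $ k)) (at z)" for a
      using R \<open>z \<in> S\<close> unfolding hol_def has_wd_def by simp
    have "(f has_derivative ?D) (at z)"
    proof (subst has_derivative_componentwise_within, intro ballI)
      fix b :: "complex^'b" assume "b \<in> Basis"
      then obtain i u where b: "b = axis i u" "u \<in> Basis" unfolding Basis_vec_def by blast
      show "((\<lambda>x. f x \<bullet> b) has_derivative (\<lambda>x. ?D x \<bullet> b)) (at z)"
        unfolding b inner_axis using has_derivative_inner_left[OF c[of i], of u] by simp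
    qed
    moreover have "?D (c *s v) = c *s ?D v" for c v
      by (simp add: vec_eq_iff sum_distrib_left algebra_simps)
    ultimately show "\<exists>D. (f has_derivative D) (at z) \<and> (\<forall>c v. D (c *s v) = c *s D v)" by blast
  qed
qed

text \<open>The inner map has no antiholomorphic derivatives, so the two types do not mix: each
  coefficient family of the composite involves only the same family of \<open>g\<close>.\<close>

lemma has_wd_comp:
  fixes h :: "complex^'n::finite \<Rightarrow> complex^'m::finite"
  assumes g: "has_wd g a b (h z)" and h: "\<And>i. hol (\<lambda>w. h w $ i) z"
  shows "has_wd (\<lambda>w. g (h w)) (\<lambda>k. \<^bold>\<Sum>i. a i * pd (\<lambda>w. h w $ i) k z)
     (\<lambda>k. \<^bold>\<Sum>i. b i * cnj (pd (\<lambda>w. h w $ i) k z)) z"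
proof -
  let ?D = "\<lambda>v. \<chi> a. \<^bold>\<Sum>k. pd (\<lambda>w. h w $ a) k z * v $ k"
  have c: "((\<lambda>w. h w $ a) has_derivative (\<lambda>v. \<^bold>\<Sum>k. pd (\<lambda>w. h w $ a) k z * v $ k)) (at z)" for a
    using h unfolding hol_def has_wd_def by simp
  have "(h has_derivative ?D) (at z)"
  proof (subst has_derivative_componentwise_within, intro ballI)
    fix b :: "complex^'m" assume "b \<in> Basis"
    then obtain i u where b: "b = axis i u" "u \<in> Basis" unfolding Basis_vec_def by blast
    show "((\<lambda>x. h x \<bullet> b) has_derivative (\<lambda>x. ?D x \<bullet> b)) (at z)"
      unfolding b inner_axis using has_derivative_inner_left[OF c[of i], of u] by simp
  qed
  from has_derivative_compose[OF this g[unfolded has_wd_def]]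
  have "((\<lambda>w. g (h w)) has_derivative (\<lambda>v. \<^bold>\<Sum>k. a k * ?D v $ k + b k * cnj (?D v $ k))) (at z)" .
  moreover have "(\<^bold>\<Sum>k. a k * ?D v $ k + b k * cnj (?D v $ k)) =
     (\<^bold>\<Sum>k. (\<^bold>\<Sum>i. a i * pd (\<lambda>w. h w $ i) k z) * v $ k
        + (\<^bold>\<Sum>i. b i * cnj (pd (\<lambda>w. h w $ i) k z)) * cnj (v $ k))" for v
  proof -
    have "(\<^bold>\<Sum>k. a k * ?D v $ k + b k * cnj (?D v $ k)) =
       (\<^bold>\<Sum>i k. a i * pd (\<lambda>w. h w $ i) k z * v $ k + b i * cnj (pd (\<lambda>w. h w $ i) k z) * cnj (v $ k))"
      by (simp add: sum_distrib_left sum.distrib algebra_simps)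
    also have "\<dots> = (\<^bold>\<Sum>k i. a i * pd (\<lambda>w. h w $ i) k z * v $ k + b i * cnj (pd (\<lambda>w. h w $ i) k z) * cnj (v $ k))"
      by (rule sum.swap)
    finally show ?thesis by (simp add: sum_distrib_right sum.distrib)
  qed
  ultimately show ?thesis unfolding has_wd_def by simp
qed

lemma holo_on_imp_continuous_on: "holo_on f S \<Longrightarrow> continuous_on S f"
  unfolding holo_on_def by (meson continuous_at_imp_continuous_on has_derivative_continuous)

lemma holo_on_subset: "holo_on f S \<Longrightarrow> T \<subseteq> S \<Longrightarrow> holo_on f T"
  unfolding holo_on_def by blast

lemma holo_on_cong:
  assumes "open S" "\<And>z. z \<in> S \<Longrightarrow> f z = g z"
  shows "holo_on f S \<longleftrightarrow> holo_on g S"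
proof -
  have "(f has_derivative D) (at z) \<longleftrightarrow> (g has_derivative D) (at z)" if "z \<in> S" for z D
    using has_derivative_transform_within_open[of f D z UNIV S g]
      has_derivative_transform_within_open[of g D z UNIV S f] assms that by auto
  thus ?thesis unfolding holo_on_def by auto
qed

lemma holo_on_compose:
  assumes "holo_on f S" "holo_on g T" "f ` S \<subseteq> T"
  shows "holo_on (g \<circ> f) S"
  unfolding holo_on_def
proof
  fix z assume z: "z \<in> S"
  obtain D where D: "(f has_derivative D) (at z)" "\<And>c v. D (c *s v) = c *s D v"
    using assms(1) z unfolding holo_on_def by blast
  obtain E where E: "(g has_derivative E) (at (f z))" "\<And>c v. E (c *s v) = c *s E v"
    using assms(2,3) z unfolding holo_on_def by blast
  show "\<exists>D. (g \<circ> f has_derivative D) (at z) \<and> (\<forall>c v. D (c *s v) = c *s D v)"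
    using has_derivative_compose[OF D(1) E(1)] D(2) E(2) by (auto simp: o_def intro!: exI)
qed


section \<open>Regularity of holomorphic functions by Cauchy estimates on complex lines\<close>

lemma has_derivative_quadratic:
  fixes f :: "'v::real_normed_vector \<Rightarrow> 'w::real_normed_vector"
  assumes "bounded_linear D" "r > 0"
    and bound: "\<And>h. norm h \<le> r \<Longrightarrow> norm (f (x + h) - f x - D h) \<le> C * (norm h)\<^sup>2"
  shows "(f has_derivative D) (at x)"
  unfolding has_derivative_at
proof
  show "(\<lambda>h. norm (f (x + h) - f x - D h) / norm h) \<midarrow>0\<rightarrow> 0"
  proof (rule Lim_null_comparison)
    show "\<forall>\<^sub>F h in at 0. norm (norm (f (x + h) - f x - D h) / norm h) \<le> C * norm h"
      unfolding eventually_at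
    proof (intro exI conjI ballI impI)
      fix h :: 'v assume h: "h \<noteq> 0 \<and> dist h 0 < r"
      hence "norm (f (x + h) - f x - D h) \<le> C * (norm h)\<^sup>2" using bound by simp
      thus "norm (norm (f (x + h) - f x - D h) / norm h) \<le> C * norm h"
        using h by (simp add: divide_simps power2_eq_square mult.assoc)
    qed fact
    show "(\<lambda>h. C * norm h) \<midarrow>0\<rightarrow> 0" by (auto intro!: tendsto_eq_intros)
  qed
qed fact

lemma hol_line_deriv:
  assumes "hol f (p + t *s v)"
  shows "((\<lambda>t. f (p + t *s v)) has_field_derivative (\<^bold>\<Sum>j. pd f j (p + t *s v) * v $ j)) (at t)"
proof -
  have "((\<lambda>t. p + t *s v) has_derivative (\<lambda>t. t *s v)) (at t)"
    by (auto intro!: derivative_eq_intros bounded_linear_imp_has_derivative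
        simp: linear_conv_bounded_linear[symmetric] linear_iff vec_eq_iff algebra_simps)
  from has_derivative_compose[OF this, of f "\<lambda>u. \<^bold>\<Sum>j. pd f j (p + t *s v) * u $ j"]
  have "((\<lambda>t. f (p + t *s v)) has_derivative (\<lambda>u. \<^bold>\<Sum>j. pd f j (p + t *s v) * (u *s v) $ j)) (at t)"
    using assms unfolding hol_def has_wd_def by simp
  moreover have "(\<lambda>u. \<^bold>\<Sum>j. pd f j (p + t *s v) * (u *s v) $ j) = (*) (\<^bold>\<Sum>j. pd f j (p + t *s v) * v $ j)"
    by (simp add: fun_eq_iff sum_distrib_left algebra_simps)
  ultimately show ?thesis unfolding has_field_derivative_def by simp
qed

lemma norm_vector_smult: "norm (c *s v) = norm c * norm v" for v :: "complex^'n::finite"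
  unfolding norm_vec_def L2_set_def by (simp add: norm_mult power_mult_distrib sum_distrib_left[symmetric] real_sqrt_mult)

lemma norm_axis_complex: "norm (axis j c :: complex^'n::finite) = norm c"
proof -
  have "axis j c = c *s (axis j 1 :: complex^'n)" by (simp add: vec_eq_iff axis_def)
  thus ?thesis by (simp add: norm_vector_smult)
qed

text \<open>Restriction to the complex line through \<open>p\<close> in the direction
  \<open>h\<close> gives a function of one variable on a disc of radius 2R with R = r / |h|.
  Cauchy's inequality bounds its second derivative on the unit disc by 2M / R^2, and Taylor's
  formula at t = 1 turns this into a bound quadratic in |h|.\<close>

lemma hol_taylor:
  fixes f :: "complex^'n::finite \<Rightarrow> complex"
  assumes "r > 0" and hol: "\<And>z. z \<in> cball p (2 * r) \<Longrightarrow> hol f z"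
    and M: "\<And>z. z \<in> cball p (2 * r) \<Longrightarrow> norm (f z) \<le> M" and h: "norm h \<le> r / 2"
  shows "norm (f (p + h) - f p - (\<^bold>\<Sum>j. pd f j p * h $ j)) \<le> 2 * M / r\<^sup>2 * (norm h)\<^sup>2"
proof (cases "h = 0")
  case False
  \<comment> \<open>For |t| \<le> 2R the point \<open>p + t *s h\<close> stays in
    \<open>cball p (2 * r)\<close>. As \<open>R\<close> is at least 2, discs of radius
    \<open>R\<close> about points of the unit disc stay inside that range.\<close>
  define R where "R = r / norm h"
  have R: "R \<ge> 2" using h False unfolding R_def by (simp add: field_simps)
  define \<phi> where "\<phi> = (\<lambda>t. f (p + t *s h))"
  have inb: "p + t *s h \<in> cball p (2 * r)" if "norm t \<le> 2 * R" for t
    using that False by (simp add: dist_norm norm_vector_smult R_def field_simps)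
  have hd: "(\<phi> has_field_derivative (\<^bold>\<Sum>j. pd f j (p + t *s h) * h $ j)) (at t)"
    if "norm t \<le> 2 * R" for t
    unfolding \<phi>_def using that by (intro hol_line_deriv hol inb)
  have hol\<phi>: "\<phi> holomorphic_on ball 0 (2 * R)"
    unfolding holomorphic_on_def field_differentiable_def
    by (auto intro!: exI has_field_derivative_at_within[OF hd])
  have hol\<phi>1: "(deriv ^^ i) \<phi> holomorphic_on ball 0 (2 * R)" for i
    by (rule holomorphic_higher_deriv[OF hol\<phi>]) simp
  have B: "norm ((deriv ^^ 2) \<phi> t) \<le> 2 * M / R\<^sup>2" if "t \<in> cball 0 1" for t
  proof -
    have sub: "cball t R' \<subseteq> ball 0 (2 * R)" if "R' < 2 * R - 1" for R'
    proof
      fix x assume "x \<in> cball t R'"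
      thus "x \<in> ball 0 (2 * R)" using \<open>t \<in> cball 0 1\<close> that norm_triangle_sub[of x t]
        by (simp add: dist_norm norm_minus_commute)
    qed
    have "norm ((deriv ^^ 2) \<phi> t) \<le> fact 2 * M / R ^ 2"
    proof (rule Cauchy_inequality)
      have "cball t R \<subseteq> ball 0 (2 * R)" if "R > 1" using sub that by auto
      hence s: "cball t R \<subseteq> ball 0 (2 * R)" using R by simp
      show "\<phi> holomorphic_on ball t R" "continuous_on (cball t R) \<phi>"
        using s hol\<phi> ball_subset_cball holomorphic_on_subset holomorphic_on_imp_continuous_on
          continuous_on_subset by (meson order_trans)+
      show "R > 0" using R by simp
      fix x assume "norm (t - x) = R"
      hence "x \<in> cball t R" by (simp add: dist_norm)
      hence "norm x \<le> 2 * R" using s by (auto simp: subset_iff)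
      thus "norm (\<phi> x) \<le> M" unfolding \<phi>_def by (intro M inb)
    qed
    thus ?thesis by simp
  qed
  have "norm (((deriv ^^ 0) \<phi>) 1 - (\<Sum>i\<le>1. (deriv ^^ i) \<phi> 0 * (1 - 0) ^ i / fact i))
       \<le> (2 * M / R\<^sup>2) * norm ((1::complex) - 0) ^ Suc 1 / fact 1"
  proof (rule complex_Taylor[of "cball 0 1"])
    fix i :: nat and x :: complex assume "x \<in> cball 0 1"
    hence x: "x \<in> ball 0 (2 * R)" using R by auto
    have "((deriv ^^ i) \<phi> has_field_derivative deriv ((deriv ^^ i) \<phi>) x) (at x)"
      using hol\<phi>1[of i] x by (meson DERIV_deriv_iff_field_differentiable holomorphic_on_imp_differentiable_at open_ball)
    thus "((deriv ^^ i) \<phi> has_field_derivative (deriv ^^ Suc i) \<phi> x) (at x within cball 0 1)"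
      by (simp add: has_field_derivative_at_within)
  qed (use B in \<open>auto simp: numeral_2_eq_2\<close>)
  moreover have "deriv \<phi> 0 = (\<^bold>\<Sum>j. pd f j p * h $ j)"
    using hd[of 0] R by (intro DERIV_imp_deriv) simp
  moreover have "2 * M / R\<^sup>2 = 2 * M / r\<^sup>2 * (norm h)\<^sup>2"
    using False by (simp add: R_def field_simps)
  ultimately show ?thesis unfolding \<phi>_def by (simp add: diff_diff_eq)
qed simp

text \<open>The difference quotients of \<open>f\<close> in a direction converge locally uniformly with a quadratic error,
  so the error can be differentiated in the direction \<open>k\<close> by Cauchy's inequality on a line.\<close>

lemma hol_pd:
  fixes f :: "complex^'n::finite \<Rightarrow> complex"
  assumes "open S" and holS: "\<And>z. z \<in> S \<Longrightarrow> hol f z" and "z \<in> S"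
  shows "hol (pd f k) z"
proof -
  obtain e where e: "e > 0" "cball z e \<subseteq> S" using assms open_contains_cball by blast
  define r where "r = e / 4"
  have r: "r > 0" "cball z (4 * r) \<subseteq> S" using e unfolding r_def by auto
  have contf: "continuous_on (cball z (4 * r)) f"
    using r holS hol_imp_differentiable
    by (meson continuous_at_imp_continuous_on differentiable_imp_continuous_within subsetD)
  have "bounded (f ` cball z (4 * r))"
    by (rule compact_imp_bounded[OF compact_continuous_image[OF contf compact_cball]])
  then obtain M where "\<forall>x\<in>f ` cball z (4 * r). norm x \<le> M"
    unfolding bounded_iff by blast
  hence M: "norm (f w) \<le> M" if "w \<in> cball z (4 * r)" for w using that by blast
  define C where "C = 2 * M / r\<^sup>2"
  have taylor: "norm (f (p + h) - f p - (\<^bold>\<Sum>j. pd f j p * h $ j)) \<le> C * (norm h)\<^sup>2"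
    if "norm h \<le> r / 2" "p \<in> cball z r" for p h
    unfolding C_def
  proof (rule hol_taylor[OF \<open>r > 0\<close>])
    have sub: "cball p (2 * r) \<subseteq> cball z (4 * r)" using that r by (auto simp: subset_cball cball_subset_cball_iff dist_commute)
    fix w assume "w \<in> cball p (2 * r)"
    thus "hol f w" "norm (f w) \<le> M" using sub r holS M by blast+
  qed (use that in auto)
  define q where "q = (\<lambda>s. z + s *s axis k (1::complex))"
  have q: "q s \<in> cball z r" if "s \<in> ball 0 r" for s
    using that by (simp add: q_def dist_norm norm_vector_smult)
  have holf_line: "(\<lambda>s. f (q s + h)) holomorphic_on ball 0 r" if "norm h \<le> r" for h
    unfolding holomorphic_on_def field_differentiable_def
  proof (intro ballI exI)
    fix s assume "s \<in> ball (0::complex) r"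
    hence "q s + h \<in> cball z (4 * r)" using q[of s] that norm_triangle_ineq[of "q s - z" h] r(1)
      by (simp add: dist_norm norm_minus_commute algebra_simps)
    hence "hol f (z + h + s *s axis k 1)" using holS r by (auto simp: q_def algebra_simps)
    from hol_line_deriv[OF this]
    show "((\<lambda>s. f (q s + h)) has_field_derivative
       (\<^bold>\<Sum>j. pd f j (z + h + s *s axis k 1) * axis k 1 $ j)) (at s within ball 0 r)"
      by (simp add: q_def algebra_simps has_field_derivative_at_within)
  qed
  have deriv_line: "deriv (\<lambda>s. f (q s + h)) 0 = pd f k (z + h)" if "norm h \<le> r" for h
  proof -
    have "z + h \<in> cball z (4 * r)" using that r by (simp add: dist_norm)
    hence "hol f (z + h + 0 *s axis k 1)" using holS r by auto
    from hol_line_deriv[OF this] show ?thesis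
      unfolding q_def by (intro DERIV_imp_deriv) (simp add: sum_axis add_ac)
  qed
  have hol\<psi>: "(\<lambda>s. pd f j (q s)) holomorphic_on ball 0 r" for j
  proof -
    define d where "d = r / 2"
    have d: "d > 0" "d \<le> r / 2" using r unfolding d_def by auto
    \<comment> \<open>Difference quotients of \<open>f\<close> in the direction \<open>j\<close>
      with steps d/(n+1), as functions on the line \<open>q\<close>. The Taylor estimate makes them
      converge uniformly to \<open>pd f j\<close>, which is therefore holomorphic along the
      line.\<close>
    define F where "F = (\<lambda>(n::nat) s. (f (q s + axis j (of_real (d / Suc n))) - f (q s)) / of_real (d / Suc n))"
    have dn: "0 < d / Suc n" "d / Suc n \<le> d" for n using d by (auto simp: field_simps)
    have est: "norm (F n s - pd f j (q s)) \<le> C * d * inverse (Suc n)" if "s \<in> ball 0 r" for n s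
    proof -
      let ?h = "axis j (complex_of_real (d / Suc n))"
      have nh: "norm ?h = d / Suc n" using dn[of n] by (simp only: norm_axis_complex norm_of_real abs_of_pos)
      have hr: "norm ?h \<le> r / 2" using nh dn[of n] d by linarith
      have "norm (f (q s + ?h) - f (q s) - pd f j (q s) * of_real (d / Suc n)) \<le> C * (d / Suc n)\<^sup>2"
        using taylor[OF hr q[OF that]] unfolding nh sum_axis .
      moreover have "F n s - pd f j (q s) =
          (f (q s + ?h) - f (q s) - pd f j (q s) * of_real (d / Suc n)) / of_real (d / Suc n)"
        unfolding F_def using dn[of n] by (simp add: diff_divide_distrib del: of_real_divide)
      ultimately have "norm (F n s - pd f j (q s)) \<le> C * (d / Suc n)\<^sup>2 / (d / Suc n)"
        using dn[of n] by (simp add: norm_divide divide_right_mono del: of_real_divide)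
      also have "\<dots> = C * (d / Suc n)" using dn(1)[of n] by (simp only: power2_eq_square) simp
      also have "\<dots> = C * d * inverse (Suc n)" by (simp add: divide_inverse)
      finally show ?thesis .
    qed
    show ?thesis
    proof (rule holomorphic_uniform_sequence[of "ball 0 r" F])
      fix n
      have nz: "complex_of_real (d / Suc n) \<noteq> 0" using dn(1)[of n] unfolding of_real_eq_0_iff by linarith
      have "norm (axis j (complex_of_real (d / Suc n)) :: complex^'n) \<le> r"
        unfolding norm_axis_complex norm_of_real using dn[of n] d by linarith
      from holf_line[OF this] holf_line[of 0] nz r(1)
      show "F n holomorphic_on ball 0 r"
        unfolding F_def by (intro holomorphic_on_divide holomorphic_on_diff holomorphic_on_const) auto
    next
      fix x :: complex assume x: "x \<in> ball 0 r"
      then obtain d' where d': "d' > 0" "cball x d' \<subseteq> ball 0 r"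
        using open_contains_cball open_ball by metis
      have "uniform_limit (cball x d') F (\<lambda>s. pd f j (q s)) sequentially"
        unfolding uniform_limit_iff
      proof (intro allI impI)
        fix \<epsilon> :: real assume "\<epsilon> > 0"
        have "(\<lambda>n. C * d * inverse (Suc n)) \<longlonglongrightarrow> C * d * 0"
          by (intro tendsto_intros LIMSEQ_inverse_real_of_nat)
        hence "\<forall>\<^sub>F n in sequentially. C * d * inverse (Suc n) < \<epsilon>"
          using \<open>\<epsilon> > 0\<close> by (simp add: order_tendstoD)
        thus "\<forall>\<^sub>F n in sequentially. \<forall>s\<in>cball x d'. dist (F n s) (pd f j (q s)) < \<epsilon>"
        proof eventually_elim
          case (elim n)
          show ?case
          proof
            fix s assume "s \<in> cball x d'"
            hence "s \<in> ball 0 r" using d' by blast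
            from est[OF this, of n] elim show "dist (F n s) (pd f j (q s)) < \<epsilon>"
              unfolding dist_norm by linarith
          qed
        qed
      qed
      thus "\<exists>d>0. cball x d \<subseteq> ball 0 r \<and> uniform_limit (cball x d) F (\<lambda>s. pd f j (q s)) sequentially"
        using d' by blast
    qed simp
  qed
  \<comment> \<open>The candidate differential of \<partial>_k f has the coefficients \<partial>_k
    \<partial>_j f, that is, derivatives along the one direction \<open>k\<close> in which the
    functions \<open>pd f j\<close> are already known to be holomorphic.\<close>
  define D where "D = (\<lambda>h::complex^'n. \<^bold>\<Sum>j. deriv (\<lambda>s. pd f j (q s)) 0 * h $ j + 0 * cnj (h $ j))"
  have "(pd f k has_derivative D) (at z)"
  proof (rule has_derivative_quadratic[of _ "r / 2" _ _ "2 * C / r"])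
    show "bounded_linear D" unfolding D_def
      by (simp add: linear_conv_bounded_linear[symmetric] linear_iff sum.distrib algebra_simps
          scaleR_sum_right)
    show "r / 2 > 0" using r by simp
    fix h :: "complex^'n" assume h: "norm h \<le> r / 2"
    \<comment> \<open>\<open>g s\<close> is the first-order Taylor error of \<open>f\<close> at
      \<open>q s\<close>; its derivative at 0 is exactly the error of \<open>D\<close> as an
      approximation to the increment of \<open>pd f k\<close>.\<close>
    define g where "g = (\<lambda>s. f (q s + h) - f (q s + 0) - (\<^bold>\<Sum>j. pd f j (q s) * h $ j))"
    have holg: "g holomorphic_on ball 0 r"
      unfolding g_def using h r by (intro holomorphic_intros holf_line hol\<psi>) auto
    have fd: "(\<lambda>s. f (q s + u)) field_differentiable at 0" if "norm u \<le> r" for u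
      using holf_line[OF that] r by (meson centre_in_ball holomorphic_on_imp_differentiable_at open_ball)
    have fd\<psi>: "(\<lambda>s. pd f j (q s)) field_differentiable at 0" for j
      using hol\<psi> r by (meson centre_in_ball holomorphic_on_imp_differentiable_at open_ball)
    have "(g has_field_derivative (deriv (\<lambda>s. f (q s + h)) 0 - deriv (\<lambda>s. f (q s + 0)) 0
        - (\<^bold>\<Sum>j. deriv (\<lambda>s. pd f j (q s)) 0 * h $ j))) (at 0)"
      unfolding g_def
      by (intro derivative_intros DERIV_cmult_right)
         (use fd[of h] fd[of 0] fd\<psi> h r in \<open>auto simp: DERIV_deriv_iff_field_differentiable\<close>)
    hence dg: "deriv g 0 = pd f k (z + h) - pd f k z - D h"
      using deriv_line[of h] deriv_line[of 0] h r by (simp add: D_def DERIV_imp_deriv)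
    have "norm ((deriv ^^ 1) g 0) \<le> fact 1 * (C * (norm h)\<^sup>2) / (r / 2) ^ 1"
    proof (rule Cauchy_inequality)
      have sub: "cball 0 (r / 2) \<subseteq> ball (0::complex) r" using r by auto
      show "g holomorphic_on ball 0 (r / 2)" "continuous_on (cball 0 (r / 2)) g"
        using sub holg ball_subset_cball holomorphic_on_subset holomorphic_on_imp_continuous_on
          continuous_on_subset by (meson order_trans)+
      fix s :: complex assume "norm (0 - s) = r / 2"
      hence "s \<in> ball 0 r" using r by simp
      from q[OF this] show "norm (g s) \<le> C * (norm h)\<^sup>2" unfolding g_def using taylor[OF h] by simp
    qed (use r in simp)
    thus "norm (pd f k (z + h) - pd f k z - D h) \<le> 2 * C / r * (norm h)\<^sup>2"
      using r by (simp add: dg field_simps)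
  qed
  thus ?thesis unfolding D_def by (intro holI[of _ "\<lambda>j. deriv (\<lambda>s. pd f j (q s)) 0"]) (simp add: has_wd_def)
qed

section \<open>Functions of class \<open>C\<^sup>k\<close>\<close>

lemma Ck_on_cong:
  assumes "open S" "\<And>x. x \<in> S \<Longrightarrow> f x = g x"
  shows "Ck_on k f S \<longleftrightarrow> Ck_on k g S"
  using assms(2)
proof (induction k arbitrary: f g)
  case 0 thus ?case using continuous_on_cong[of S S f g] by simp
next
  case (Suc k)
  have D: "(f has_derivative D) (at x) \<longleftrightarrow> (g has_derivative D) (at x)" if "x \<in> S" for x D
    using has_derivative_transform_within_open[of f D x UNIV S g]
      has_derivative_transform_within_open[of g D x UNIV S f] assms that Suc.prems by auto
  hence "frechet_derivative f (at x) = frechet_derivative g (at x)" if "x \<in> S" for x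
    unfolding frechet_derivative_def using that by simp
  hence "Ck_on k (\<lambda>x. frechet_derivative f (at x) v) S \<longleftrightarrow> Ck_on k (\<lambda>x. frechet_derivative g (at x) v) S" for v
    by (intro Suc.IH) simp
  moreover have "f differentiable (at x) \<longleftrightarrow> g differentiable (at x)" if "x \<in> S" for x
    unfolding differentiable_def using D[OF that] by blast
  ultimately show ?case by simp
qed

lemma Ck_on_SucI:
  assumes "open S" "\<And>x. x \<in> S \<Longrightarrow> (f has_derivative D x) (at x)" "\<And>v. Ck_on k (\<lambda>x. D x v) S"
  shows "Ck_on (Suc k) f S"
proof -
  have "Ck_on k (\<lambda>x. frechet_derivative f (at x) v) S" for v
    using assms(3)[of v] Ck_on_cong[OF assms(1), of "\<lambda>x. frechet_derivative f (at x) v" "\<lambda>x. D x v"]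
      frechet_derivative_at[OF assms(2)] by metis
  thus ?thesis using assms(2) differentiable_def by (auto simp: differentiable_def)
qed

lemma Ck_on_subset: "Ck_on k f S \<Longrightarrow> T \<subseteq> S \<Longrightarrow> Ck_on k f T"
  by (induction k arbitrary: f) (auto intro: continuous_on_subset)

lemma Ck_on_Suc_imp: "Ck_on (Suc k) f S \<Longrightarrow> Ck_on k f S"
proof (induction k arbitrary: f)
  case 0 thus ?case
    by (simp add: continuous_at_imp_continuous_on differentiable_imp_continuous_within)
qed auto

lemma Ck_on_has_derivative:
  "Ck_on (Suc k) f S \<Longrightarrow> x \<in> S \<Longrightarrow> (f has_derivative frechet_derivative f (at x)) (at x)"
  by (simp add: frechet_derivative_works[symmetric])

lemma Ck_on_const: "open S \<Longrightarrow> Ck_on k (\<lambda>_. c) S"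
  by (induction k arbitrary: c) (simp_all)

lemma Ck_on_add:
  "open S \<Longrightarrow> Ck_on k f S \<Longrightarrow> Ck_on k g S \<Longrightarrow> Ck_on k (\<lambda>x. f x + g x) S"
proof (induction k arbitrary: f g)
  case 0 thus ?case by (simp add: continuous_on_add)
next
  case (Suc k)
  show ?case
    by (rule Ck_on_SucI[OF \<open>open S\<close> has_derivative_add[OF Ck_on_has_derivative[OF Suc.prems(2)]
            Ck_on_has_derivative[OF Suc.prems(3)]]]) (use Suc in auto)
qed

lemma Ck_on_sum:
  assumes "open S" "finite I" "\<And>i. i \<in> I \<Longrightarrow> Ck_on k (f i) S"
  shows "Ck_on k (\<lambda>x. \<Sum>i\<in>I. f i x) S"
  using assms(2,3)
  by (induction I rule: finite_induct) (auto intro: Ck_on_add simp: Ck_on_const assms(1))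

lemma Ck_on_linear:
  assumes "bounded_linear L" "open S"
  shows "Ck_on k f S \<Longrightarrow> Ck_on k (\<lambda>x. L (f x)) S"
proof (induction k arbitrary: f)
  case 0 thus ?case using bounded_linear.continuous_on[OF assms(1)] by simp
next
  case (Suc k)
  show ?case
    by (rule Ck_on_SucI[OF \<open>open S\<close> bounded_linear.has_derivative[OF assms(1) Ck_on_has_derivative[OF Suc.prems]]])
       (use Suc in auto)
qed

lemma Ck_on_scaleR:
  fixes f :: "'v::real_normed_vector \<Rightarrow> real" and g :: "'v \<Rightarrow> 'w::real_normed_vector"
  shows "open S \<Longrightarrow> Ck_on k f S \<Longrightarrow> Ck_on k g S \<Longrightarrow> Ck_on k (\<lambda>x. f x *\<^sub>R g x) S"
proof (induction k arbitrary: f g)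
  case 0 thus ?case by (simp add: continuous_on_scaleR)
next
  case (Suc k)
  show ?case
  proof (rule Ck_on_SucI[OF \<open>open S\<close> has_derivative_scaleR[OF Ck_on_has_derivative[OF Suc.prems(2)]
            Ck_on_has_derivative[OF Suc.prems(3)]]])
    fix v
    show "Ck_on k (\<lambda>x. f x *\<^sub>R frechet_derivative g (at x) v + frechet_derivative f (at x) v *\<^sub>R g x) S"
      by (intro Ck_on_add Suc.IH \<open>open S\<close> Ck_on_Suc_imp[OF Suc.prems(2)] Ck_on_Suc_imp[OF Suc.prems(3)])
         (use Suc.prems in auto)
  qed
qed

text \<open>The chain rule produces the derivative of \<open>g\<close> in a direction that depends
  on x. Expanding this direction in a basis leaves a finite sum of scalar functions times
  derivatives of \<open>g\<close> in fixed directions, to which the induction hypothesis applies.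
  Hence the induction is over all \<open>g\<close> with \<open>f\<close> fixed.\<close>

lemma Ck_on_compose:
  fixes f :: "'v::real_normed_vector \<Rightarrow> 'u::euclidean_space" and g :: "'u \<Rightarrow> 'w::real_normed_vector"
  assumes S: "open S" and f: "\<And>k. Ck_on k f S" and "f ` S \<subseteq> T"
  shows "(\<And>k. Ck_on k g T) \<Longrightarrow> Ck_on k (\<lambda>x. g (f x)) S"
proof (induction k arbitrary: g)
  case 0
  have "continuous_on S f" "continuous_on T g" using f[of 0] "0"[of 0] by simp_all
  thus ?case using continuous_on_compose2 \<open>f ` S \<subseteq> T\<close> by auto
next
  case (Suc k)
  have g: "(g has_derivative frechet_derivative g (at (f x))) (at (f x))" if "x \<in> S" for x
    using Ck_on_has_derivative[OF Suc.prems[of "Suc 0"]] assms(3) that by blast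
  show ?case
  proof (rule Ck_on_SucI[OF \<open>open S\<close> has_derivative_compose[OF Ck_on_has_derivative[OF f[of "Suc k"]] g]])
    fix v
    have D: "frechet_derivative g (at (f x)) (frechet_derivative f (at x) v) =
      (\<Sum>b\<in>Basis. (frechet_derivative f (at x) v \<bullet> b) *\<^sub>R frechet_derivative g (at (f x)) b)" if "x \<in> S" for x
    proof -
      interpret bounded_linear "frechet_derivative g (at (f x))"
        using g[OF that] by (rule has_derivative_bounded_linear)
      show ?thesis by (subst euclidean_representation[symmetric]) (simp add: sum scaleR)
    qed
    have "Ck_on k (\<lambda>x. \<Sum>b\<in>Basis. (frechet_derivative f (at x) v \<bullet> b) *\<^sub>R frechet_derivative g (at (f x)) b) S"
    proof (intro Ck_on_sum Ck_on_scaleR S finite_Basis Ck_on_linear[OF bounded_linear_inner_left S])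
      show "Ck_on k (\<lambda>x. frechet_derivative f (at x) v) S" using f[of "Suc k"] by simp
      fix b :: 'u
      have "Ck_on k' (\<lambda>y. frechet_derivative g (at y) b) T" for k' using Suc.prems[of "Suc k'"] by simp
      thus "Ck_on k (\<lambda>x. frechet_derivative g (at (f x)) b) S" by (rule Suc.IH)
    qed
    thus "Ck_on k (\<lambda>x. frechet_derivative g (at (f x)) (frechet_derivative f (at x) v)) S"
      by (subst Ck_on_cong[OF S D])
  qed
qed

text \<open>By \<open>hol_pd\<close> the derivative of a holomorphic map in a fixed direction is
  again holomorphic, so the induction repeats itself.\<close>

lemma Ck_on_holo:
  assumes "open S"
  shows "holo_on f S \<Longrightarrow> Ck_on k f S"
proof (induction k arbitrary: f)
  case 0 thus ?case by (simp add: holo_on_imp_continuous_on)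
next
  case (Suc k)
  have comp: "hol (\<lambda>w. f w $ a) z" if "z \<in> S" for z a
    using Suc.prems that holo_on_iff[OF assms] by blast
  have df: "f differentiable (at z)" if "z \<in> S" for z
    using Suc.prems that unfolding holo_on_def differentiable_def by blast
  have fd: "frechet_derivative f (at z) v $ a = (\<^bold>\<Sum>j. pd (\<lambda>w. f w $ a) j z * v $ j)" if "z \<in> S" for z a v
  proof -
    have "((\<lambda>w. f w $ a) has_derivative (\<lambda>v. frechet_derivative f (at z) v $ a)) (at z)"
      using bounded_linear.has_derivative[OF bounded_linear_vec_nth df[OF that, unfolded frechet_derivative_works]] .
    from has_derivative_unique[OF this comp[OF that, of a, unfolded hol_def has_wd_def]]
    show ?thesis by (simp add: fun_eq_iff)
  qed
  have "Ck_on k (\<lambda>x. frechet_derivative f (at x) v) S" for v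
  proof (rule Suc.IH, subst holo_on_iff[OF assms], intro ballI allI)
    fix z a assume z: "z \<in> S"
    have sumhol: "hol (\<lambda>w. \<Sum>j\<in>J. pd (\<lambda>w. f w $ a) j w * v $ j) z" if "finite J" for J
      using that
      by (induction J rule: finite_induct)
         (auto intro!: hol_const hol_add hol_mult hol_pd[OF assms _ z] comp)
    have "hol (\<lambda>w. \<^bold>\<Sum>j. pd (\<lambda>w. f w $ a) j w * v $ j) z"
      by (rule sumhol) simp
    thus "hol (\<lambda>w. frechet_derivative f (at w) v $ a) z"
      by (rule hol_transform[OF _ assms z]) (simp add: fd)
  qed
  thus ?case using df by simp
qed

text \<open>The two-parameter family c x^a is closed under differentiation, which carries the
  induction; the square root is a = 1/2.\<close>

lemma Ck_on_powr: "Ck_on k (\<lambda>x::real. c * x powr a) {0<..}"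
proof (induction k arbitrary: c a)
  case 0 show ?case by (auto intro!: continuous_intros)
next
  case (Suc k)
  have "((\<lambda>x. c * x powr a) has_derivative (\<lambda>v. v * c * a * x powr (a - 1))) (at x)" if "x \<in> {0<..}" for x
    using that by (auto intro!: derivative_eq_intros simp: field_simps powr_diff)
  thus ?case by (rule Ck_on_SucI[rotated]) (auto simp: Suc.IH)
qed

lemma Ck_on_sqrt: "Ck_on k sqrt {0<..}"
proof -
  have "Ck_on k (\<lambda>x::real. 1 * x powr (1/2)) {0<..} \<longleftrightarrow> Ck_on k sqrt {0<..}"
    by (rule Ck_on_cong) (auto simp: powr_half_sqrt)
  thus ?thesis using Ck_on_powr by blast
qed

lemma Ck_on_id: "open S \<Longrightarrow> Ck_on k (\<lambda>x. x) S"
  by (induction k) (auto simp: Ck_on_const intro!: Ck_on_SucI[where D="\<lambda>_ v. v"] derivative_eq_intros)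

text \<open>Iterated derivatives taken as directional derivatives in the direction 1, the form in
  which \<open>Ck_on\<close> recurses.\<close>

fun dreal :: "nat \<Rightarrow> (real \<Rightarrow> real) \<Rightarrow> real \<Rightarrow> real" where
  "dreal 0 f = f"
| "dreal (Suc k) f = (\<lambda>x. frechet_derivative (dreal k f) (at x) 1)"

lemma Ck_on_dreal: "Ck_on (k + j) f S \<Longrightarrow> Ck_on j (dreal k f) S"
proof (induction k arbitrary: j)
  case (Suc k)
  have "Ck_on (Suc j) (dreal k f) S" using Suc.IH[of "Suc j"] Suc.prems by simp
  thus ?case by simp
qed simp

lemma dreal_has_derivative:
  assumes "\<And>k. Ck_on k f S" "x \<in> S"
  shows "(dreal k f has_real_derivative dreal (Suc k) f x) (at x)"
proof -
  have "Ck_on (Suc 0) (dreal k f) S" by (rule Ck_on_dreal) (rule assms)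
  from Ck_on_has_derivative[OF this assms(2)] have D: "(dreal k f has_derivative frechet_derivative (dreal k f) (at x)) (at x)" .
  interpret bounded_linear "frechet_derivative (dreal k f) (at x)" using D by (rule has_derivative_bounded_linear)
  have "frechet_derivative (dreal k f) (at x) = (*) (dreal (Suc k) f x)"
  proof
    fix y show "frechet_derivative (dreal k f) (at x) y = dreal (Suc k) f x * y"
      using scaleR[of y 1] by (simp add: mult.commute)
  qed
  thus ?thesis using D unfolding has_field_derivative_def by simp
qed

section \<open>Pullback of the curvature tensor\<close>

definition mwd :: "(complex^'n::finite \<Rightarrow> complex^'q::finite^'p::finite) \<Rightarrow> ('n \<Rightarrow> complex^'q^'p) \<Rightarrow>
    ('n \<Rightarrow> complex^'q^'p) \<Rightarrow> complex^'n \<Rightarrow> bool" where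
  "mwd M a b z \<longleftrightarrow> (\<forall>i j. has_wd (\<lambda>w. M w $ i $ j) (\<lambda>k. a k $ i $ j) (\<lambda>k. b k $ i $ j) z)"

lemma mwd_mult:
  assumes "mwd M a b z" "mwd N a' b' z"
  shows "mwd (\<lambda>w. M w ** N w) (\<lambda>k. a k ** N z + M z ** a' k) (\<lambda>k. b k ** N z + M z ** b' k) z"
  unfolding mwd_def
proof (intro allI)
  fix i j
  have "has_wd (\<lambda>w. \<^bold>\<Sum>p. M w $ i $ p * N w $ p $ j)
     (\<lambda>k. \<^bold>\<Sum>p. a k $ i $ p * N z $ p $ j + M z $ i $ p * a' k $ p $ j)
     (\<lambda>k. \<^bold>\<Sum>p. b k $ i $ p * N z $ p $ j + M z $ i $ p * b' k $ p $ j) z"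
    using assms unfolding mwd_def by (intro has_wd_sum has_wd_mult) auto
  thus "has_wd (\<lambda>w. (M w ** N w) $ i $ j) (\<lambda>k. (a k ** N z + M z ** a' k) $ i $ j)
     (\<lambda>k. (b k ** N z + M z ** b' k) $ i $ j) z"
    by (simp add: matrix_matrix_mult_def sum.distrib)
qed

lemma mwd_add:
  assumes "mwd M a b z" "mwd N a' b' z"
  shows "mwd (\<lambda>w. M w + N w) (\<lambda>k. a k + a' k) (\<lambda>k. b k + b' k) z"
  using assms unfolding mwd_def by (auto intro: has_wd_add)

lemma mwd_transform:
  assumes "mwd M a b z" "open S" "z \<in> S" "\<And>w. w \<in> S \<Longrightarrow> M w = N w"
  shows "mwd N a b z"
  unfolding mwd_def
proof (intro allI)
  fix i j
  show "has_wd (\<lambda>w. N w $ i $ j) (\<lambda>k. a k $ i $ j) (\<lambda>k. b k $ i $ j) z"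
    by (rule has_wd_transform[OF _ assms(2,3), of "\<lambda>w. M w $ i $ j"])
       (use assms(1,4) in \<open>auto simp: mwd_def\<close>)
qed

definition mpd :: "(complex^'n::finite \<Rightarrow> complex^'q::finite^'p::finite) \<Rightarrow> 'n \<Rightarrow> complex^'n \<Rightarrow> complex^'q^'p" where
  "mpd M k z = (\<chi> i j. pd (\<lambda>w. M w $ i $ j) k z)"

definition mpdbar :: "(complex^'n::finite \<Rightarrow> complex^'q::finite^'p::finite) \<Rightarrow> 'n \<Rightarrow> complex^'n \<Rightarrow> complex^'q^'p" where
  "mpdbar M k z = (\<chi> i j. pdbar (\<lambda>w. M w $ i $ j) k z)"

lemma mwd_mpd:
  assumes "mwd M a b z"
  shows "mpd M k z = a k" "mpdbar M k z = b k"
  using assms has_wd_pd unfolding mwd_def mpd_def mpdbar_def vec_eq_iff by fastforce+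

definition mdiff :: "(complex^'n::finite \<Rightarrow> complex^'q::finite^'p::finite) \<Rightarrow> complex^'n \<Rightarrow> bool" where
  "mdiff M z \<longleftrightarrow> (\<forall>i j. (\<lambda>w. M w $ i $ j) differentiable (at z))"

lemma mdiff_mwd: "mdiff M z \<Longrightarrow> mwd M (\<lambda>k. mpd M k z) (\<lambda>k. mpdbar M k z) z"
  unfolding mdiff_def mwd_def mpd_def mpdbar_def by (simp add: differentiable_imp_has_wd)

lemma mwd_mdiff: "mwd M a b z \<Longrightarrow> mdiff M z"
  unfolding mdiff_def mwd_def by (blast intro: has_wd_imp_differentiable)

text \<open>The exchanged index order in \<open>ginv\<close> is what turns the quadratic term into a
  product of three matrices. The transformation law of the curvature thereby becomes noncommutative
  matrix algebra.\<close>

lemma curv_matrix: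
  "curv G i j k l z = (mpd (mpdbar G l) k z - mpd G k z ** matrix_inv (G z) ** mpdbar G l z) $ i $ j"
proof -
  have "(mpd G k z ** matrix_inv (G z) ** mpdbar G l z) $ i $ j =
    (\<^bold>\<Sum>p q. ginv G p q z * pd (\<lambda>w. G w $ i $ q) k z * pdbar (\<lambda>w. G w $ p $ j) l z)"
    by (simp add: matrix_matrix_mult_def mpd_def mpdbar_def ginv_def sum_distrib_right sum_distrib_left mult_ac)
  thus ?thesis unfolding curv_def by (simp add: mpd_def mpdbar_def)
qed

text \<open>Rows are indexed by the source coordinates, so this is the transpose of the usual
  Jacobian matrix. The pullback of a Hermitian form then reads P G adj P, and for a composite the
  factors stand in the order of application.\<close>

definition jac :: "(complex^'n::finite \<Rightarrow> complex^'m::finite) \<Rightarrow> complex^'n \<Rightarrow> complex^'m^'n" where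
  "jac h z = (\<chi> i a. pd (\<lambda>w. h w $ a) i z)"

definition adj :: "complex^'m::finite^'n::finite \<Rightarrow> complex^'n^'m" where
  "adj P = (\<chi> b j. cnj (P $ j $ b))"

lemma pullback_matrix: "pullback h G z = jac h z ** G (h z) ** adj (jac h z)"
proof -
  have "(\<^bold>\<Sum>b. (\<^bold>\<Sum>a. P $ i $ a * A $ a $ b) * cnj (P $ j $ b)) =
     (\<^bold>\<Sum>a b. P $ i $ a * cnj (P $ j $ b) * A $ a $ b)"
    for P :: "complex^'b^'a" and A i j
    by (subst sum.swap) (simp add: sum_distrib_left sum_distrib_right mult_ac)
  from this[of "jac h z" _ "G (h z)"] show ?thesis
    unfolding pullback_def adj_def matrix_matrix_mult_def vec_eq_iff by (simp add: jac_def)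
qed

lemma mwd_adj:
  assumes "mwd M a b z"
  shows "mwd (\<lambda>w. adj (M w)) (\<lambda>k. adj (b k)) (\<lambda>k. adj (a k)) z"
  using assms unfolding mwd_def adj_def by (auto intro: has_wd_cnj)

lemma mwd_jac:
  assumes "open S" "holo_on h S" "z \<in> S"
  shows "mwd (jac h) (\<lambda>k. mpd (jac h) k z) (\<lambda>_. 0) z"
    and "mwd (mpd (jac h) k) (\<lambda>l. mpd (mpd (jac h) k) l z) (\<lambda>_. 0) z"
proof -
  have h: "hol (\<lambda>w. h w $ a) z" if "z \<in> S" for a z using assms(2) that holo_on_iff[OF assms(1)] by blast
  have h1: "hol (\<lambda>w. pd (\<lambda>w. h w $ a) i w) z" if "z \<in> S" for a i z by (rule hol_pd[OF assms(1) h that])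
  have h2: "hol (\<lambda>w. pd (\<lambda>w. pd (\<lambda>w. h w $ a) i w) k w) z" if "z \<in> S" for a i k z
    by (rule hol_pd[OF assms(1) h1 that])
  show "mwd (jac h) (\<lambda>k. mpd (jac h) k z) (\<lambda>_. 0) z"
    using h1[OF assms(3)] unfolding mwd_def jac_def mpd_def hol_def by simp
  show "mwd (mpd (jac h) k) (\<lambda>l. mpd (mpd (jac h) k) l z) (\<lambda>_. 0) z"
    using h2[OF assms(3)] unfolding mwd_def jac_def mpd_def hol_def by simp
qed

lemma levi_cong_open:
  assumes "open S" "z \<in> S" "\<And>w. w \<in> S \<Longrightarrow> \<Phi> w = \<Psi> w"
  shows "levi \<Phi> z = levi \<Psi> z"
proof -
  have "pdbar (\<lambda>w. complex_of_real (\<Phi> w)) j w = pdbar (\<lambda>w. complex_of_real (\<Psi> w)) j w" if "w \<in> S" for j w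
    by (rule pd_cong_open(2)[OF assms(1) that]) (simp only: assms(3))
  from pd_cong_open(1)[OF assms(1,2) this]
  have "pd (pdbar (\<lambda>w. complex_of_real (\<Phi> w)) j) i z = pd (pdbar (\<lambda>w. complex_of_real (\<Psi> w)) j) i z" for i j .
  thus ?thesis unfolding levi_def by simp
qed

text \<open>The conjugate Jacobian is antiholomorphic, so the outer derivative \<partial>_i acts
  only on the derivatives of \<Psi>, and no second derivatives of \<open>h\<close> occur.\<close>

lemma levi_comp:
  fixes \<Psi> :: "complex^'m::finite \<Rightarrow> real" and h :: "complex^'n::finite \<Rightarrow> complex^'m"
  assumes "open S" "holo_on h S" "open T" "h ` S \<subseteq> T" "z \<in> S"
    and d1: "\<And>w. w \<in> T \<Longrightarrow> (\<lambda>w. complex_of_real (\<Psi> w)) differentiable (at w)"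
    and d2: "\<And>w j. w \<in> T \<Longrightarrow> pdbar (\<lambda>w. complex_of_real (\<Psi> w)) j differentiable (at w)"
  shows "levi (\<lambda>z. \<Psi> (h z)) z = pullback h (levi \<Psi>) z"
proof -
  let ?\<Psi> = "\<lambda>w. complex_of_real (\<Psi> w)"
  have h: "hol (\<lambda>w. h w $ a) z" if "z \<in> S" for a z using assms(2) that holo_on_iff[OF assms(1)] by blast
  have hT: "h z \<in> T" if "z \<in> S" for z using assms(4) that by blast
  have b: "pdbar (\<lambda>w. ?\<Psi> (h w)) j w = (\<^bold>\<Sum>b. pdbar ?\<Psi> b (h w) * cnj (jac h w $ j $ b))" if "w \<in> S" for j w
    using has_wd_pd(2)[OF has_wd_comp[OF differentiable_imp_has_wd[OF d1[OF hT[OF that]]] h[OF that]]]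
    by (simp add: jac_def)
  have "pd (pdbar (\<lambda>w. ?\<Psi> (h w)) j) i z =
      (\<^bold>\<Sum>b a. jac h z $ i $ a * cnj (jac h z $ j $ b) * pd (pdbar ?\<Psi> b) a (h z))" for i j
  proof -
    have "pd (pdbar (\<lambda>w. ?\<Psi> (h w)) j) i z = pd (\<lambda>w. \<^bold>\<Sum>b. pdbar ?\<Psi> b (h w) * cnj (jac h w $ j $ b)) i z"
      by (rule pd_cong_open[OF assms(1,5) b])
    also have "\<dots> = (\<^bold>\<Sum>b. (\<^bold>\<Sum>a. pd (pdbar ?\<Psi> b) a (h z) * pd (\<lambda>w. h w $ a) i z) * cnj (jac h z $ j $ b)
          + pdbar ?\<Psi> b (h z) * cnj 0)"
    proof (rule has_wd_pd(1)[OF has_wd_sum[OF finite has_wd_mult[OF has_wd_comp[OF differentiable_imp_has_wd] has_wd_cnj]]])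
      show "pdbar ?\<Psi> b differentiable (at (h z))" for b using d2 hT assms(5) by blast
      show "hol (\<lambda>w. h w $ a) z" for a using h assms(5) by blast
      show "has_wd (\<lambda>w. jac h w $ j $ b) (\<lambda>k. mpd (jac h) k z $ j $ b) (\<lambda>k. 0) z" for b
        using mwd_jac(1)[OF assms(1,2,5)] unfolding mwd_def by simp
    qed
    finally show ?thesis by (simp add: sum_distrib_left sum_distrib_right jac_def mult_ac)
  qed
  also have "(\<^bold>\<Sum>b a. jac h z $ i $ a * cnj (jac h z $ j $ b) * pd (pdbar ?\<Psi> b) a (h z)) =
     (\<^bold>\<Sum>a b. jac h z $ i $ a * cnj (jac h z $ j $ b) * pd (pdbar ?\<Psi> b) a (h z))" for i j
    by (rule sum.swap)
  finally show ?thesis unfolding levi_def pullback_def vec_eq_iff by (simp add: jac_def)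
qed

section \<open>The transformation law of the curvature\<close>

lemma matrix_inv_right: "invertible A \<Longrightarrow> A ** matrix_inv A = mat 1"
  and matrix_inv_left: "invertible A \<Longrightarrow> matrix_inv A ** A = mat 1"
  unfolding invertible_def matrix_inv_def by (metis (mono_tags, lifting) someI_ex)+

lemma matrix_add_rdistrib: "(A + B) ** C = A ** C + B ** C"
  for A B :: "'a::ring_1^'n::finite^'m::finite"
  by (simp add: vec_eq_iff matrix_matrix_mult_def sum.distrib algebra_simps)

lemma matrix_sub_rdistrib: "(A - B) ** C = A ** C - B ** C"
  for A B :: "'a::ring_1^'n::finite^'m::finite"
  by (simp add: vec_eq_iff matrix_matrix_mult_def sum_subtractf algebra_simps)

lemma matrix_sub_ldistrib: "A ** (B - C) = A ** B - A ** C"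
  for A :: "'a::ring_1^'n::finite^'m::finite"
  by (simp add: vec_eq_iff matrix_matrix_mult_def sum_subtractf algebra_simps)

text \<open>The index types of source and target may differ, so \<open>P\<close> is rectangular by
  type and is cancelled through its left inverse \<open>Q\<close>: multiply P A adj P N = 1 by
  \<open>P\<close> on the right and by \<open>Q\<close> on the left.\<close>

lemma matrix_inv_pullback:
  fixes P :: "complex^'m::finite^'n::finite" and A :: "complex^'m^'m"
  assumes "Q ** P = mat 1" "invertible A" "invertible (P ** A ** adj P)"
  shows "adj P ** matrix_inv (P ** A ** adj P) ** P = matrix_inv A"
proof -
  let ?N = "matrix_inv (P ** A ** adj P)"
  have "P ** A ** adj P ** ?N = mat 1" using assms(3) by (rule matrix_inv_right)
  hence "P ** (A ** (adj P ** ?N ** P)) = P" by (metis matrix_mul_assoc matrix_mul_lid)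
  hence "A ** (adj P ** ?N ** P) = mat 1"
    using assms(1) by (metis matrix_mul_assoc matrix_mul_lid)
  hence "matrix_inv A ** A ** (adj P ** ?N ** P) = matrix_inv A" by (simp add: matrix_mul_assoc[symmetric])
  thus ?thesis by (simp add: matrix_inv_left[OF assms(2)])
qed

text \<open>With G' = P A adj P and \<open>P\<close> holomorphic, the Leibniz terms containing
  derivatives of \<open>P\<close> are the same in the mixed second derivative of G' and in the
  quadratic term of the curvature. They cancel, and only the curvature of \<open>G\<close> between
  \<open>P\<close> and \<open>adj P\<close> survives.\<close>

lemma curv_pullback:
  fixes G :: "'m::finite mfun" and G' :: "'n::finite mfun"
  assumes S: "open S" "holo_on h S" "z \<in> S" and T: "h ` S \<subseteq> T"
    and G': "\<And>w. w \<in> S \<Longrightarrow> G' w = pullback h G w"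
    and d1: "\<And>w. w \<in> T \<Longrightarrow> mdiff G w" and d2: "\<And>w l. w \<in> T \<Longrightarrow> mdiff (mpdbar G l) w"
    and inv: "Q ** jac h z = mat 1" "invertible (G (h z))" "invertible (G' z)"
  shows "curv G' i j k l z = (\<^bold>\<Sum>a b c d. jac h z $ i $ a * cnj (jac h z $ j $ b) * (jac h z $ k $ c * cnj (jac h z $ l $ d)) * curv G a b c d (h z))"
proof -
  let ?P = "jac h"
  define A0 where "A0 = (\<lambda>w. G (h w))"
  \<comment> \<open>\<open>A k\<close> and \<open>B l\<close> are the \<partial>_k and the conjugate
    \<partial>_l derivatives of \<open>A0\<close>, \<open>C l k\<close> is its mixed second
    derivative, and \<open>D l\<close> is the conjugate derivative of \<open>adj P\<close>.\<close>
  define A where "A = (\<lambda>k w. \<chi> a b. \<^bold>\<Sum>c. mpd G c (h w) $ a $ b * ?P w $ k $ c)"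
  define B where "B = (\<lambda>l w. \<chi> a b. \<^bold>\<Sum>d. mpdbar G d (h w) $ a $ b * cnj (?P w $ l $ d))"
  define C where "C = (\<lambda>l k w. \<chi> a b. \<^bold>\<Sum>d. (\<^bold>\<Sum>c. mpd (mpdbar G d) c (h w) $ a $ b * ?P w $ k $ c) * cnj (?P w $ l $ d))"
  define D where "D = (\<lambda>l w. adj (mpd (jac h) l w))"
  define Ps where "Ps = (\<lambda>w. adj (?P w))"
  have h: "hol (\<lambda>w. h w $ a) z" if "z \<in> S" for a z using S(2) that holo_on_iff[OF S(1)] by blast
  have hT: "h z \<in> T" if "z \<in> S" for z using T that by blast
  have mA: "mwd A0 (\<lambda>k. A k w) (\<lambda>l. B l w) w" if "w \<in> S" for w
    unfolding mwd_def
  proof (intro allI)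
    fix a b
    have "has_wd (\<lambda>w. G w $ a $ b) (\<lambda>k. mpd G k (h w) $ a $ b) (\<lambda>k. mpdbar G k (h w) $ a $ b) (h w)"
      using mdiff_mwd[OF d1[OF hT[OF that]]] unfolding mwd_def by blast
    from has_wd_comp[OF this h[OF that]]
    show "has_wd (\<lambda>w. A0 w $ a $ b) (\<lambda>k. A k w $ a $ b) (\<lambda>l. B l w $ a $ b) w"
      by (simp add: A0_def A_def B_def jac_def)
  qed
  have mP: "mwd ?P (\<lambda>k. mpd ?P k w) (\<lambda>_. 0) w" if "w \<in> S" for w by (rule mwd_jac[OF S(1,2) that])
  have adj0: "adj 0 = 0" by (simp add: adj_def vec_eq_iff)
  have mPs: "mwd Ps (\<lambda>_. 0) (\<lambda>l. D l w) w" if "w \<in> S" for w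
    using mwd_adj[OF mP[OF that]] unfolding Ps_def D_def adj0 by simp
  have mD: "mwd (D l) (\<lambda>_. 0) (\<lambda>k. adj (mpd (mpd ?P l) k z)) z" for l
    using mwd_adj[OF mwd_jac(2)[OF S]] unfolding D_def adj0 by simp
  obtain B' where mB: "mwd (B l) (\<lambda>k. C l k z) (B' l) z" for l
  proof -
    have "\<exists>b'. mwd (B l) (\<lambda>k. C l k z) b' z" for l
    proof -
      have "has_wd (\<lambda>w. B l w $ a $ b) (\<lambda>k. C l k z $ a $ b)
         (\<lambda>k. \<^bold>\<Sum>d. (\<^bold>\<Sum>i. mpdbar (mpdbar G d) i (h z) $ a $ b * cnj (pd (\<lambda>w. h w $ i) k z)) * cnj (?P z $ l $ d) +
             mpdbar G d (h z) $ a $ b * cnj (mpd ?P k z $ l $ d)) z" for a b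
      proof -
        have 1: "has_wd (\<lambda>w. mpdbar G d w $ a $ b) (\<lambda>k. mpd (mpdbar G d) k (h z) $ a $ b)
           (\<lambda>k. mpdbar (mpdbar G d) k (h z) $ a $ b) (h z)" for d
          using mdiff_mwd[OF d2[OF hT[OF S(3)]]] unfolding mwd_def by blast
        have 2: "has_wd (\<lambda>w. ?P w $ l $ d) (\<lambda>k. mpd ?P k z $ l $ d) (\<lambda>_. 0) z" for d
          using mP[OF S(3)] unfolding mwd_def by simp
        from has_wd_sum[OF finite[of UNIV] has_wd_mult[OF has_wd_comp[OF 1 h[OF S(3)]] has_wd_cnj[OF 2]]]
        show ?thesis by (simp add: B_def C_def jac_def)
      qed
      hence "mwd (B l) (\<lambda>k. C l k z) (\<lambda>k. \<chi> a b. \<^bold>\<Sum>d. (\<^bold>\<Sum>i. mpdbar (mpdbar G d) i (h z) $ a $ b * cnj (pd (\<lambda>w. h w $ i) k z)) * cnj (?P z $ l $ d) +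
             mpdbar G d (h z) $ a $ b * cnj (mpd ?P k z $ l $ d)) z"
        unfolding mwd_def by simp
      thus ?thesis by blast
    qed
    thus ?thesis using that by metis
  qed
  have G'_eq: "G' w = ?P w ** A0 w ** Ps w" if "w \<in> S" for w
    using G'[OF that] by (simp add: pullback_matrix A0_def Ps_def)
  have mG': "mwd G' (\<lambda>k. (mpd ?P k w ** A0 w + ?P w ** A k w) ** Ps w)
      (\<lambda>l. ?P w ** B l w ** Ps w + ?P w ** A0 w ** D l w) w" if "w \<in> S" for w
    using mwd_transform[OF mwd_mult[OF mwd_mult[OF mP[OF that] mA[OF that]] mPs[OF that]] S(1) that, of G']
    by (simp add: G'_eq)
  have bar: "mpdbar G' l w = ?P w ** B l w ** Ps w + ?P w ** A0 w ** D l w" if "w \<in> S" for w l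
    by (rule mwd_mpd(2)[OF mG'[OF that]])
  have m1: "mwd (\<lambda>w. ?P w ** B l w ** Ps w)
     (\<lambda>k. (mpd ?P k z ** B l z + ?P z ** C l k z) ** Ps z + ?P z ** B l z ** 0)
     (\<lambda>k. (0 ** B l z + ?P z ** B' l k) ** Ps z + ?P z ** B l z ** D k z) z" for l
    by (rule mwd_mult[OF mwd_mult[OF mP[OF S(3)] mB] mPs[OF S(3)]])
  have m2: "mwd (\<lambda>w. ?P w ** A0 w ** D l w)
     (\<lambda>k. (mpd ?P k z ** A0 z + ?P z ** A k z) ** D l z + ?P z ** A0 z ** 0)
     (\<lambda>k. (0 ** A0 z + ?P z ** B k z) ** D l z + ?P z ** A0 z ** adj (mpd (mpd ?P l) k z)) z" for l
    by (rule mwd_mult[OF mwd_mult[OF mP[OF S(3)] mA[OF S(3)]] mD])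
  have dd: "mpd (mpdbar G' l) k z =
      (mpd ?P k z ** B l z + ?P z ** C l k z) ** Ps z + (mpd ?P k z ** A0 z + ?P z ** A k z) ** D l z"
    using mwd_mpd(1)[OF mwd_transform[OF mwd_add[OF m1 m2] S(1,3) bar[symmetric]]] by simp
  have inv': "Ps z ** matrix_inv (G' z) ** ?P z = matrix_inv (A0 z)"
    unfolding G'_eq[OF S(3)] Ps_def
    by (rule matrix_inv_pullback[OF inv(1)]) (use inv G'_eq[OF S(3)] in \<open>simp_all add: A0_def Ps_def\<close>)
  have A0inv: "A0 z ** matrix_inv (A0 z) = mat 1" "matrix_inv (A0 z) ** A0 z = mat 1"
    using inv(2) matrix_inv_right matrix_inv_left by (simp_all add: A0_def)
  \<comment> \<open>Both outer factors are grouped so that the inverse of G' appears only between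
    \<open>adj P\<close> and \<open>P\<close>, where it collapses to the inverse of
    \<open>A0\<close>.\<close>
  have "mpd G' k z ** matrix_inv (G' z) ** mpdbar G' l z =
     (mpd ?P k z ** A0 z + ?P z ** A k z) ** (Ps z ** matrix_inv (G' z) ** ?P z) ** (B l z ** Ps z + A0 z ** D l z)"
    unfolding bar[OF S(3)] mwd_mpd(1)[OF mG'[OF S(3)]]
    by (simp add: matrix_mul_assoc matrix_add_ldistrib)
  also have "\<dots> = (mpd ?P k z ** A0 z + ?P z ** A k z) ** (matrix_inv (A0 z) ** B l z ** Ps z + matrix_inv (A0 z) ** A0 z ** D l z)"
    unfolding inv' by (simp add: matrix_mul_assoc matrix_add_ldistrib)
  also have "\<dots> = mpd ?P k z ** (A0 z ** matrix_inv (A0 z)) ** B l z ** Ps z + mpd ?P k z ** A0 z ** D l z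
      + (?P z ** A k z ** matrix_inv (A0 z) ** B l z ** Ps z + ?P z ** A k z ** D l z)"
    by (simp add: A0inv(2) matrix_mul_assoc matrix_add_ldistrib matrix_add_rdistrib)
  finally have prod: "mpd G' k z ** matrix_inv (G' z) ** mpdbar G' l z =
      mpd ?P k z ** B l z ** Ps z + mpd ?P k z ** A0 z ** D l z
      + (?P z ** A k z ** matrix_inv (A0 z) ** B l z ** Ps z + ?P z ** A k z ** D l z)"
    unfolding A0inv(1) by simp
  have main: "mpd (mpdbar G' l) k z - mpd G' k z ** matrix_inv (G' z) ** mpdbar G' l z =
     ?P z ** (C l k z - A k z ** matrix_inv (A0 z) ** B l z) ** Ps z"
    unfolding prod dd
    by (simp add: matrix_mul_assoc matrix_add_ldistrib matrix_add_rdistrib matrix_sub_ldistrib matrix_sub_rdistrib)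
  have elem: "(C l k z - A k z ** matrix_inv (A0 z) ** B l z) $ a $ b =
     (\<^bold>\<Sum>c d. ?P z $ k $ c * cnj (?P z $ l $ d) * curv G a b c d (h z))" for a b
  proof -
    have 1: "C l k z $ a $ b = (\<^bold>\<Sum>c d. ?P z $ k $ c * cnj (?P z $ l $ d) * mpd (mpdbar G d) c (h z) $ a $ b)"
      unfolding C_def by (subst sum.swap) (simp add: sum_distrib_right sum_distrib_left mult_ac)
    have "(A k z ** matrix_inv (A0 z) ** B l z) $ a $ b =
      (\<^bold>\<Sum>p. (\<^bold>\<Sum>q. (\<^bold>\<Sum>c. mpd G c (h z) $ a $ q * ?P z $ k $ c) * matrix_inv (A0 z) $ q $ p) *
         (\<^bold>\<Sum>d. mpdbar G d (h z) $ p $ b * cnj (?P z $ l $ d)))"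
      unfolding matrix_matrix_mult_def A_def B_def by simp
    also have "\<dots> = (\<^bold>\<Sum>p. (\<^bold>\<Sum>c q. mpd G c (h z) $ a $ q * ?P z $ k $ c * matrix_inv (A0 z) $ q $ p) *
         (\<^bold>\<Sum>d. mpdbar G d (h z) $ p $ b * cnj (?P z $ l $ d)))"
      by (subst sum.swap) (simp add: sum_distrib_right)
    also have "\<dots> = (\<^bold>\<Sum>p c d. (\<^bold>\<Sum>q. mpd G c (h z) $ a $ q * ?P z $ k $ c * matrix_inv (A0 z) $ q $ p) *
         (mpdbar G d (h z) $ p $ b * cnj (?P z $ l $ d)))"
      by (simp add: sum_product)
    also have "\<dots> = (\<^bold>\<Sum>c d p. (\<^bold>\<Sum>q. mpd G c (h z) $ a $ q * ?P z $ k $ c * matrix_inv (A0 z) $ q $ p) *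
         (mpdbar G d (h z) $ p $ b * cnj (?P z $ l $ d)))"
      by (subst sum.swap, subst (2) sum.swap) simp
    also have "\<dots> = (\<^bold>\<Sum>c d. ?P z $ k $ c * cnj (?P z $ l $ d) *
        (mpd G c (h z) ** matrix_inv (A0 z) ** mpdbar G d (h z)) $ a $ b)"
      unfolding matrix_matrix_mult_def by (simp add: sum_distrib_left sum_distrib_right mult_ac)
    finally show ?thesis using 1
      by (simp add: curv_matrix A0_def sum_subtractf[symmetric] algebra_simps)
  qed
  have "curv G' i j k l z = (\<^bold>\<Sum>b. (\<^bold>\<Sum>a. ?P z $ i $ a * (C l k z - A k z ** matrix_inv (A0 z) ** B l z) $ a $ b) * cnj (?P z $ j $ b))"
    unfolding curv_matrix main Ps_def by (simp add: matrix_matrix_mult_def adj_def)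
  also have "\<dots> = (\<^bold>\<Sum>a b. ?P z $ i $ a * (C l k z - A k z ** matrix_inv (A0 z) ** B l z) $ a $ b * cnj (?P z $ j $ b))"
    by (subst sum.swap) (simp add: sum_distrib_right)
  finally show ?thesis unfolding elem by (simp add: sum_distrib_left sum_distrib_right mult_ac)
qed

section \<open>Contractions of the curvature tensor\<close>

lemma sum4_prod:
  fixes p q :: "'n::finite \<Rightarrow> 'n \<Rightarrow> complex"
  shows "(\<^bold>\<Sum>a b c d. p a b * q c d) =
      (\<^bold>\<Sum>a b. p a b) * (\<^bold>\<Sum>c d. q c d)"
    and "(\<^bold>\<Sum>a b c d. p a d * q c b) =
      (\<^bold>\<Sum>a b. p a b) * (\<^bold>\<Sum>c d. q c d)"
proof -
  show "(\<^bold>\<Sum>a b c d. p a b * q c d) =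
      (\<^bold>\<Sum>a b. p a b) * (\<^bold>\<Sum>c d. q c d)"
    by (simp only: sum_distrib_left[symmetric] sum_distrib_right[symmetric])
  have "(\<^bold>\<Sum>a b c d. p a d * q c b) =
     (\<^bold>\<Sum>a b. (\<^bold>\<Sum>d. p a d) * (\<^bold>\<Sum>c. q c b))"
  proof (intro sum.cong refl)
    fix a b
    show "(\<^bold>\<Sum>c d. p a d * q c b) = (\<^bold>\<Sum>d. p a d) * (\<^bold>\<Sum>c. q c b)"
      by (simp only: sum_distrib_left[symmetric] sum_distrib_right[symmetric])
  qed
  also have "\<dots> = (\<^bold>\<Sum>a b. p a b) * (\<^bold>\<Sum>b c. q c b)"
    by (simp only: sum_distrib_left[symmetric] sum_distrib_right[symmetric])
  also have "(\<^bold>\<Sum>b c. q c b) = (\<^bold>\<Sum>c d. q c d)" by (rule sum.swap)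
  finally show "(\<^bold>\<Sum>a b c d. p a d * q c b) =
      (\<^bold>\<Sum>a b. p a b) * (\<^bold>\<Sum>c d. q c d)" .
qed

lemma sum_swap_outer_inner:
  fixes F :: "'n::finite \<Rightarrow> 'n \<Rightarrow> 'n \<Rightarrow> 'n \<Rightarrow> 'n \<Rightarrow> complex"
  shows "(\<^bold>\<Sum>k p q a c. F k p q a c) =
     (\<^bold>\<Sum>c p q a k. F k p q a c)"
  by (simp only: sum.cartesian_product UNIV_Times_UNIV)
     (rule sum.reindex_bij_witness[where i="\<lambda>(c,p,q,a,k). (k,p,q,a,c)" and j="\<lambda>(c,p,q,a,k). (k,p,q,a,c)"], auto)

lemma sum_rotate:
  fixes F :: "'n::finite \<Rightarrow> 'n \<Rightarrow> 'n \<Rightarrow> 'n \<Rightarrow> 'n \<Rightarrow> 'n \<Rightarrow> complex"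
  shows "(\<^bold>\<Sum>j k p q a b. F j k p q a b) =
     (\<^bold>\<Sum>k p q a b j. F j k p q a b)"
  by (simp only: sum.cartesian_product UNIV_Times_UNIV)
     (rule sum.reindex_bij_witness[where i="\<lambda>(k,p,q,a,b,j). (j,k,p,q,a,b)" and j="\<lambda>(j,k,p,q,a,b). (k,p,q,a,b,j)"], auto)

text \<open>A tensor of the shape that the curvature of a radial metric has at every point.\<close>

definition radial_tensor :: "('n \<Rightarrow> 'n \<Rightarrow> complex) \<Rightarrow> ('n \<Rightarrow> complex) \<Rightarrow> real \<Rightarrow> real \<Rightarrow> real \<Rightarrow>
    'n \<Rightarrow> 'n \<Rightarrow> 'n \<Rightarrow> 'n \<Rightarrow> complex" where
  "radial_tensor g \<theta> A B C i j k l =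
     of_real A * (g i j * g k l + g i l * g k j)
   + of_real B * (g i j * (\<theta> k * cnj (\<theta> l)) + (\<theta> i * cnj (\<theta> j)) * g k l
       + g i l * (\<theta> k * cnj (\<theta> j)) + (\<theta> i * cnj (\<theta> l)) * g k j)
   + of_real C * ((\<theta> i * cnj (\<theta> j)) * (\<theta> k * cnj (\<theta> l)))"

lemma radial_tensor_sym:
  "radial_tensor g \<theta> A B C i l k j = radial_tensor g \<theta> A B C i j k l"
  "radial_tensor g \<theta> A B C k l i j = radial_tensor g \<theta> A B C i j k l"
  unfolding radial_tensor_def by (simp_all add: algebra_simps)

text \<open>Linear algebra at a single point: \<open>g\<close> is the metric and \<open>gi\<close>
  its inverse in the index order of \<open>ginv\<close>, so that first indices are contracted with
  first ones and second with second.\<close>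

locale hermitian_metric =
  fixes g gi :: "'n::finite \<Rightarrow> 'n \<Rightarrow> complex"
  assumes inv1: "(\<^bold>\<Sum>m. gi l m * g i m) = (if l = i then 1 else 0)"
    and inv2: "(\<^bold>\<Sum>l. gi l m * g l j) = (if m = j then 1 else 0)"
    and herm: "cnj (g i j) = g j i"
begin

lemma delta1: "(\<^bold>\<Sum>l. (if l = i then 1 else 0) * f l) = (f (i::'n) :: complex)"
  and delta2: "(\<^bold>\<Sum>l. (if i = l then 1 else 0) * f l) = f i"
proof -
  have "(\<^bold>\<Sum>l. (if l = i then 1 else 0) * f l) = (\<^bold>\<Sum>l. if l = i then f l else 0)"
    by (rule sum.cong) auto
  thus "(\<^bold>\<Sum>l. (if l = i then 1 else 0) * f l) = f i" by simp
  have "(\<^bold>\<Sum>l. (if i = l then 1 else 0) * f l) = (\<^bold>\<Sum>l. if i = l then f l else 0)"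
    by (rule sum.cong) auto
  thus "(\<^bold>\<Sum>l. (if i = l then 1 else 0) * f l) = f i" by simp
qed

lemma contract1: "(\<^bold>\<Sum>l m. gi l m * (g i m * f l)) = f i"
proof -
  have "(\<^bold>\<Sum>l m. gi l m * (g i m * f l)) = (\<^bold>\<Sum>l. (\<^bold>\<Sum>m. gi l m * g i m) * f l)"
    by (simp add: sum_distrib_left sum_distrib_right mult_ac)
  thus ?thesis by (simp add: inv1 delta1)
qed

lemma contract2: "(\<^bold>\<Sum>l m. gi l m * (g l j * f m)) = f j"
proof -
  have "(\<^bold>\<Sum>l m. gi l m * (g l j * f m)) = (\<^bold>\<Sum>m. (\<^bold>\<Sum>l. gi l m * g l j) * f m)"
    by (subst sum.swap) (simp add: sum_distrib_left sum_distrib_right mult_ac)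
  thus ?thesis by (simp add: inv2 delta1)
qed

lemma trace: "(\<^bold>\<Sum>l m. gi l m * g l m) = of_nat CARD('n)"
  by (simp add: inv1)

definition sq :: "('n \<Rightarrow> complex) \<Rightarrow> complex" where
  "sq \<theta> = (\<^bold>\<Sum>l m. gi l m * (\<theta> l * cnj (\<theta> m)))"

lemma ricci_radial_tensor:
  "(\<^bold>\<Sum>l m. gi l m * radial_tensor g \<theta> A B C i j l m) =
     (of_real A * of_nat (CARD('n) + 1) + of_real B * sq \<theta>) * g i j
     + (of_real B * of_nat (CARD('n) + 2) + of_real C * sq \<theta>) * (\<theta> i * cnj (\<theta> j))"
proof -
  have "(\<^bold>\<Sum>l m. gi l m * radial_tensor g \<theta> A B C i j l m) =
    (\<^bold>\<Sum>l m. of_real A * g i j * (gi l m * g l m) + of_real A * (gi l m * (g i m * g l j))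
      + of_real B * g i j * (gi l m * (\<theta> l * cnj (\<theta> m)))
      + of_real B * (\<theta> i * cnj (\<theta> j)) * (gi l m * g l m)
      + of_real B * cnj (\<theta> j) * (gi l m * (g i m * \<theta> l))
      + of_real B * \<theta> i * (gi l m * (g l j * cnj (\<theta> m)))
      + of_real C * (\<theta> i * cnj (\<theta> j)) * (gi l m * (\<theta> l * cnj (\<theta> m))))"
    by (simp only: radial_tensor_def) (simp only: algebra_simps)
  also have "\<dots> = of_real A * g i j * of_nat CARD('n) + of_real A * g i j
      + of_real B * g i j * sq \<theta> + of_real B * (\<theta> i * cnj (\<theta> j)) * of_nat CARD('n)
      + of_real B * cnj (\<theta> j) * \<theta> i + of_real B * \<theta> i * cnj (\<theta> j)
      + of_real C * (\<theta> i * cnj (\<theta> j)) * sq \<theta>"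
    by (simp only: sum.distrib sum_distrib_left[symmetric] contract1 contract2 trace sq_def)
  finally show ?thesis by (simp add: algebra_simps)
qed

text \<open>Raises the indices of a conjugated form: the first index of \<open>X\<close> is barred,
  the second is not. Thus the conjugate of \<open>g\<close>, which is \<open>g\<close> with its
  indices exchanged, becomes \<open>gi\<close>.\<close>

definition up :: "('n \<Rightarrow> 'n \<Rightarrow> complex) \<Rightarrow> 'n \<Rightarrow> 'n \<Rightarrow> complex" where
  "up X i j = (\<^bold>\<Sum>a b. gi i a * gi b j * X a b)"

lemma up_g: "up (\<lambda>a b. g b a) i j = gi i j"
proof -
  have "up (\<lambda>a b. g b a) i j = (\<^bold>\<Sum>b. (\<^bold>\<Sum>a. gi i a * g b a) * gi b j)"
    unfolding up_def by (subst sum.swap) (simp add: sum_distrib_left sum_distrib_right mult_ac)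
  thus ?thesis by (simp add: inv1 delta2)
qed

lemma up4:
  "(\<^bold>\<Sum>a b c d. gi i a * gi b j * gi k c * gi d l * (X a b * Y c d)) = up X i j * up Y k l"
  "(\<^bold>\<Sum>a b c d. gi i a * gi b j * gi k c * gi d l * (X a d * Y c b)) = up X i l * up Y k j"
proof -
  show "(\<^bold>\<Sum>a b c d. gi i a * gi b j * gi k c * gi d l * (X a b * Y c d)) = up X i j * up Y k l"
    unfolding up_def
    by (subst sum4_prod(1)[of "\<lambda>a b. gi i a * gi b j * X a b" "\<lambda>c d. gi k c * gi d l * Y c d", symmetric])
       (simp only: mult_ac)
  show "(\<^bold>\<Sum>a b c d. gi i a * gi b j * gi k c * gi d l * (X a d * Y c b)) = up X i l * up Y k j"
    unfolding up_def
    by (subst sum4_prod(2)[of "\<lambda>a d. gi i a * gi d l * X a d" "\<lambda>c b. gi k c * gi b j * Y c b", symmetric])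
       (simp only: mult_ac)
qed

text \<open>Conjugating and raising indices replaces \<open>g\<close> by \<open>gi\<close> and the
  square of \<theta> by the rank-one form \<open>N\<close>, and keeps the shape of the tensor. The
  square norm is thereby reduced to pairings of the tensor with \<open>gi\<close> and
  \<open>N\<close>.\<close>

lemma up_radial_tensor:
  fixes \<theta> :: "'n \<Rightarrow> complex" and A B C :: real
  defines "N \<equiv> up (\<lambda>a b. cnj (\<theta> a) * \<theta> b)"
  shows "(\<^bold>\<Sum>a b c d. gi i a * gi b j * gi k c * gi d l * cnj (radial_tensor g \<theta> A B C a b c d)) =
     of_real A * (gi i j * gi k l + gi i l * gi k j)
   + of_real B * (gi i j * N k l + N i j * gi k l + gi i l * N k j + N i l * gi k j)
   + of_real C * (N i j * N k l)"
proof -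
  have "gi i a * gi b j * gi k c * gi d l * cnj (radial_tensor g \<theta> A B C a b c d) =
     of_real A * (gi i a * gi b j * gi k c * gi d l * (g b a * g d c))
   + of_real A * (gi i a * gi b j * gi k c * gi d l * (g d a * g b c))
   + of_real B * (gi i a * gi b j * gi k c * gi d l * (g b a * (cnj (\<theta> c) * \<theta> d)))
   + of_real B * (gi i a * gi b j * gi k c * gi d l * ((cnj (\<theta> a) * \<theta> b) * g d c))
   + of_real B * (gi i a * gi b j * gi k c * gi d l * (g d a * (cnj (\<theta> c) * \<theta> b)))
   + of_real B * (gi i a * gi b j * gi k c * gi d l * ((cnj (\<theta> a) * \<theta> d) * g b c))
   + of_real C * (gi i a * gi b j * gi k c * gi d l * ((cnj (\<theta> a) * \<theta> b) * (cnj (\<theta> c) * \<theta> d)))" for a b c d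
    unfolding radial_tensor_def complex_cnj_add complex_cnj_mult complex_cnj_cnj complex_cnj_complex_of_real herm
    by (simp only: distrib_left mult_ac add_ac)
  hence "(\<^bold>\<Sum>a b c d. gi i a * gi b j * gi k c * gi d l * cnj (radial_tensor g \<theta> A B C a b c d)) =
     of_real A * (gi i j * gi k l) + of_real A * (gi i l * gi k j)
   + of_real B * (gi i j * N k l) + of_real B * (N i j * gi k l)
   + of_real B * (gi i l * N k j) + of_real B * (N i l * gi k j) + of_real C * (N i j * N k l)"
    unfolding N_def
    by (simp only: sum.distrib sum_distrib_left[symmetric] up4(1)[of i j k l "\<lambda>a b. g b a" "\<lambda>a b. g b a"]
       up4(2)[of i j k l "\<lambda>a b. g b a" "\<lambda>a b. g b a"]
       up4(1)[of i j k l "\<lambda>a b. g b a" "\<lambda>a b. cnj (\<theta> a) * \<theta> b"]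
       up4(1)[of i j k l "\<lambda>a b. cnj (\<theta> a) * \<theta> b" "\<lambda>a b. g b a"]
       up4(2)[of i j k l "\<lambda>a b. g b a" "\<lambda>a b. cnj (\<theta> a) * \<theta> b"]
       up4(2)[of i j k l "\<lambda>a b. cnj (\<theta> a) * \<theta> b" "\<lambda>a b. g b a"]
       up4(1)[of i j k l "\<lambda>a b. cnj (\<theta> a) * \<theta> b" "\<lambda>a b. cnj (\<theta> a) * \<theta> b"] up_g)
  thus ?thesis by (simp add: algebra_simps)
qed

lemma up_theta: "up (\<lambda>a b. cnj (\<theta> a) * \<theta> b) i j = (\<^bold>\<Sum>a. gi i a * cnj (\<theta> a)) * (\<^bold>\<Sum>b. gi b j * \<theta> b)"
  unfolding up_def by (simp add: sum_distrib_left sum_distrib_right mult_ac)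

definition pair :: "('n \<Rightarrow> 'n \<Rightarrow> 'n \<Rightarrow> 'n \<Rightarrow> complex) \<Rightarrow> ('n \<Rightarrow> 'n \<Rightarrow> complex) \<Rightarrow> ('n \<Rightarrow> 'n \<Rightarrow> complex) \<Rightarrow> complex" where
  "pair R X Y = (\<^bold>\<Sum>i j k l. R i j k l * (X i j * Y k l))"

lemma pair_swap:
  assumes "\<And>i j k l. R i l k j = R i j k l"
  shows "(\<^bold>\<Sum>i j k l. R i j k l * (X i l * Y k j)) = pair R X Y"
proof -
  have "pair R X Y = (\<^bold>\<Sum>i l k j. R i j k l * (X i l * Y k j))"
    unfolding pair_def by (simp add: assms)
  also have "\<dots> = (\<^bold>\<Sum>i j k l. R i j k l * (X i l * Y k j))"
    by (simp only: sum.cartesian_product UNIV_Times_UNIV)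
       (rule sum.reindex_bij_witness[where i="\<lambda>(i,j,k,l). (i,l,k,j)" and j="\<lambda>(i,j,k,l). (i,l,k,j)"], auto)
  finally show ?thesis by simp
qed

lemma pair_commute:
  assumes "\<And>i j k l. R k l i j = R i j k l"
  shows "pair R X Y = pair R Y X"
proof -
  have "pair R X Y = (\<^bold>\<Sum>k l i j. R i j k l * (Y i j * X k l))"
    unfolding pair_def by (simp add: assms mult_ac)
  also have "\<dots> = (\<^bold>\<Sum>i j k l. R i j k l * (Y i j * X k l))"
    by (simp only: sum.cartesian_product UNIV_Times_UNIV)
       (rule sum.reindex_bij_witness[where i="\<lambda>(i,j,k,l). (k,l,i,j)" and j="\<lambda>(i,j,k,l). (k,l,i,j)"], auto)
  finally show ?thesis unfolding pair_def .
qed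

text \<open>A pairing with \<open>gi\<close> contains the Ricci contraction, which an Einstein
  condition evaluates.\<close>

lemma pair_gi:
  "pair R X gi = (\<^bold>\<Sum>i j. X i j * (\<^bold>\<Sum>k l. gi k l * R i j k l))"
  unfolding pair_def by (simp add: sum_distrib_left mult_ac)

text \<open>\<open>N\<close> is a product of a vector \<open>t\<close> and a vector
  \<open>s\<close>, the raised forms of \<theta> and its conjugate, and contracting \<open>s\<close>
  with \<open>g\<close> returns \<theta>. Hence every sum splits into sums over one pair of
  indices.\<close>

lemma up_theta_contract:
  fixes \<theta> :: "'n \<Rightarrow> complex"
  defines "N \<equiv> up (\<lambda>a b. cnj (\<theta> a) * \<theta> b)"
  shows "(\<^bold>\<Sum>i j. N i j * g i j) = sq \<theta>"
    and "(\<^bold>\<Sum>i j. N i j * (\<theta> i * cnj (\<theta> j))) = sq \<theta> ^ 2"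
    and "(\<^bold>\<Sum>i j k l. N i j * N k l * (g i l * g k j)) = sq \<theta> ^ 2"
    and "(\<^bold>\<Sum>i j k l. N i j * N k l * (g i l * (\<theta> k * cnj (\<theta> j)))) = sq \<theta> ^ 3"
    and "(\<^bold>\<Sum>i j k l. N i j * N k l * ((\<theta> i * cnj (\<theta> l)) * g k j)) = sq \<theta> ^ 3"
proof -
  define t where "t = (\<lambda>i. \<^bold>\<Sum>a. gi i a * cnj (\<theta> a))"
  define s where "s = (\<lambda>j. \<^bold>\<Sum>b. gi b j * \<theta> b)"
  have N: "N i j = t i * s j" for i j unfolding N_def up_theta t_def s_def ..
  have sg: "(\<^bold>\<Sum>j. s j * g i j) = \<theta> i" for i
    unfolding s_def sum_distrib_right using contract1[of i \<theta>] by (subst sum.swap) (simp add: mult_ac)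
  have t\<theta>: "(\<^bold>\<Sum>i. t i * \<theta> i) = sq \<theta>"
    unfolding t_def sq_def by (simp add: sum_distrib_left sum_distrib_right mult_ac)
  have s\<theta>: "(\<^bold>\<Sum>j. s j * cnj (\<theta> j)) = sq \<theta>"
    unfolding s_def sq_def by (subst sum.swap) (simp add: sum_distrib_left sum_distrib_right mult_ac)
  have tsg: "(\<^bold>\<Sum>i j. t i * s j * g i j) = sq \<theta>"
    using t\<theta> by (simp add: sum_distrib_left[symmetric] sg mult.assoc)
  have ts\<theta>: "(\<^bold>\<Sum>i j. t i * s j * (\<theta> i * cnj (\<theta> j))) = sq \<theta> ^ 2"
  proof -
    have "(\<^bold>\<Sum>i j. t i * s j * (\<theta> i * cnj (\<theta> j))) = (\<^bold>\<Sum>i. t i * \<theta> i) * (\<^bold>\<Sum>j. s j * cnj (\<theta> j))"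
      by (simp add: sum_product mult_ac)
    thus ?thesis by (simp add: t\<theta> s\<theta> power2_eq_square)
  qed
  show "(\<^bold>\<Sum>i j. N i j * g i j) = sq \<theta>" unfolding N by (rule tsg)
  show "(\<^bold>\<Sum>i j. N i j * (\<theta> i * cnj (\<theta> j))) = sq \<theta> ^ 2" unfolding N by (rule ts\<theta>)
  have "(\<^bold>\<Sum>i j k l. N i j * N k l * (g i l * g k j)) =
    (\<^bold>\<Sum>i j k l. (t i * s l * g i l) * (t k * s j * g k j))"
    unfolding N by (simp add: mult_ac)
  also have "\<dots> = sq \<theta> ^ 2"
    using sum4_prod(2)[of "\<lambda>i l. t i * s l * g i l" "\<lambda>i l. t i * s l * g i l"]
    unfolding tsg power2_eq_square .
  finally show "(\<^bold>\<Sum>i j k l. N i j * N k l * (g i l * g k j)) = sq \<theta> ^ 2" .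
  have "(\<^bold>\<Sum>i j k l. N i j * N k l * (g i l * (\<theta> k * cnj (\<theta> j)))) =
    (\<^bold>\<Sum>i j k l. (t i * s l * g i l) * (t k * s j * (\<theta> k * cnj (\<theta> j))))"
    unfolding N by (simp add: mult_ac)
  also have "\<dots> = sq \<theta> * sq \<theta> ^ 2"
    using sum4_prod(2)[of "\<lambda>i l. t i * s l * g i l" "\<lambda>i l. t i * s l * (\<theta> i * cnj (\<theta> l))"]
    unfolding tsg ts\<theta> .
  finally show "(\<^bold>\<Sum>i j k l. N i j * N k l * (g i l * (\<theta> k * cnj (\<theta> j)))) = sq \<theta> ^ 3"
    by (simp add: power3_eq_cube power2_eq_square)
  have "(\<^bold>\<Sum>i j k l. N i j * N k l * ((\<theta> i * cnj (\<theta> l)) * g k j)) =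
    (\<^bold>\<Sum>i j k l. (t i * s l * (\<theta> i * cnj (\<theta> l))) * (t k * s j * g k j))"
    unfolding N by (simp add: mult_ac)
  also have "\<dots> = sq \<theta> ^ 2 * sq \<theta>"
    using sum4_prod(2)[of "\<lambda>i l. t i * s l * (\<theta> i * cnj (\<theta> l))" "\<lambda>i l. t i * s l * g i l"]
    unfolding tsg ts\<theta> .
  finally show "(\<^bold>\<Sum>i j k l. N i j * N k l * ((\<theta> i * cnj (\<theta> l)) * g k j)) = sq \<theta> ^ 3"
    by (simp add: power3_eq_cube power2_eq_square)
qed

text \<open>Of the pairings that occur, those with at least one factor \<open>gi\<close> are Ricci
  contractions and come from the Einstein condition; only the pairing with \<open>N\<close> twice is
  computed from the coefficients.\<close>

lemma norm2_radial_tensor: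
  fixes \<theta> :: "'n \<Rightarrow> complex" and A B C :: real
  defines "R \<equiv> radial_tensor g \<theta> A B C"
  assumes einstein: "\<And>i j. (\<^bold>\<Sum>k l. gi k l * R i j k l) = \<kappa> * g i j"
  shows "(\<^bold>\<Sum>i j k l a b c d. gi i a * gi b j * gi k c * gi d l * R i j k l * cnj (R a b c d)) =
     2 * of_real A * \<kappa> * of_nat CARD('n) + 4 * of_real B * \<kappa> * sq \<theta>
     + of_real C * sq \<theta> ^ 2 * (2 * of_real A + 4 * of_real B * sq \<theta> + of_real C * sq \<theta> ^ 2)"
proof -
  define N where "N = up (\<lambda>a b. cnj (\<theta> a) * \<theta> b)"
  have sym: "R i l k j = R i j k l" "R k l i j = R i j k l" for i j k l
    unfolding R_def by (rule radial_tensor_sym)+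
  have gg: "pair R gi gi = \<kappa> * of_nat CARD('n)"
    unfolding pair_gi einstein using trace by (simp add: mult_ac sum_distrib_left[symmetric])
  have Ng: "pair R N gi = \<kappa> * sq \<theta>"
    unfolding pair_gi einstein using up_theta_contract(1)[of \<theta>, folded N_def]
    by (simp add: mult_ac sum_distrib_left[symmetric])
  have NN1: "(\<^bold>\<Sum>i j k l. N i j * N k l * (X i j * Y k l)) =
     (\<^bold>\<Sum>i j. N i j * X i j) * (\<^bold>\<Sum>i j. N i j * Y i j)" for X Y
    using sum4_prod(1)[of "\<lambda>i j. N i j * X i j" "\<lambda>i j. N i j * Y i j"] by (simp add: mult_ac)
  have "R i j k l * (N i j * N k l) =
     of_real A * (N i j * N k l * (g i j * g k l)) + of_real A * (N i j * N k l * (g i l * g k j))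
   + of_real B * (N i j * N k l * (g i j * (\<theta> k * cnj (\<theta> l))))
   + of_real B * (N i j * N k l * ((\<theta> i * cnj (\<theta> j)) * g k l))
   + of_real B * (N i j * N k l * (g i l * (\<theta> k * cnj (\<theta> j))))
   + of_real B * (N i j * N k l * ((\<theta> i * cnj (\<theta> l)) * g k j))
   + of_real C * (N i j * N k l * ((\<theta> i * cnj (\<theta> j)) * (\<theta> k * cnj (\<theta> l))))" for i j k l
    unfolding R_def radial_tensor_def by (simp only: distrib_left mult_ac add_ac)
  hence "pair R N N = of_real A * (sq \<theta> * sq \<theta>) + of_real A * sq \<theta> ^ 2
     + of_real B * (sq \<theta> * sq \<theta> ^ 2) + of_real B * (sq \<theta> ^ 2 * sq \<theta>)
     + of_real B * sq \<theta> ^ 3 + of_real B * sq \<theta> ^ 3 + of_real C * (sq \<theta> ^ 2 * sq \<theta> ^ 2)"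
    unfolding pair_def
    by (simp only: sum.distrib sum_distrib_left[symmetric] NN1 up_theta_contract[of \<theta>, folded N_def]
       NN1[of g g] NN1[of g "\<lambda>i j. \<theta> i * cnj (\<theta> j)"] NN1[of "\<lambda>i j. \<theta> i * cnj (\<theta> j)" g]
       NN1[of "\<lambda>i j. \<theta> i * cnj (\<theta> j)" "\<lambda>i j. \<theta> i * cnj (\<theta> j)"])
  hence NN: "pair R N N = sq \<theta> ^ 2 * (2 * of_real A + 4 * of_real B * sq \<theta> + of_real C * sq \<theta> ^ 2)"
    by (simp add: power2_eq_square power3_eq_cube algebra_simps)
  have "(\<^bold>\<Sum>a b c d. gi i a * gi b j * gi k c * gi d l * R i j k l * cnj (R a b c d)) =
     of_real A * (R i j k l * (gi i j * gi k l)) + of_real A * (R i j k l * (gi i l * gi k j))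
   + of_real B * (R i j k l * (gi i j * N k l)) + of_real B * (R i j k l * (N i j * gi k l))
   + of_real B * (R i j k l * (gi i l * N k j)) + of_real B * (R i j k l * (N i l * gi k j))
   + of_real C * (R i j k l * (N i j * N k l))" for i j k l
  proof -
    have "(\<^bold>\<Sum>a b c d. gi i a * gi b j * gi k c * gi d l * R i j k l * cnj (R a b c d)) =
      R i j k l * (\<^bold>\<Sum>a b c d. gi i a * gi b j * gi k c * gi d l * cnj (R a b c d))"
      by (simp add: sum_distrib_left mult_ac)
    thus ?thesis unfolding R_def up_radial_tensor[of i j k l \<theta> A B C, folded N_def]
      by (simp add: algebra_simps)
  qed
  hence "(\<^bold>\<Sum>i j k l a b c d. gi i a * gi b j * gi k c * gi d l * R i j k l * cnj (R a b c d)) =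
    of_real A * pair R gi gi + of_real A * pair R gi gi + of_real B * pair R gi N + of_real B * pair R N gi
    + of_real B * pair R gi N + of_real B * pair R N gi + of_real C * pair R N N"
    by (simp only: sum.distrib sum_distrib_left[symmetric] pair_swap[of R, OF sym(1)] pair_def[symmetric])
  thus ?thesis
    unfolding pair_commute[of R gi N, OF sym(2)] gg Ng NN by (simp add: algebra_simps)
qed

text \<open>The Ricci contraction combines \<open>g\<close> and \<open>\<theta> \<theta>\<^sup>*\<close>, which are independent in dimension at least two.\<close>

lemma einstein_radial_tensor:
  assumes "\<And>i j. (\<^bold>\<Sum>k l. gi k l * radial_tensor g \<theta> A B C i j k l) = \<kappa> * g i j"
    and "CARD('n) \<ge> 2" "sq \<theta> \<noteq> 0"
  shows "of_real A * of_nat (CARD('n) + 1) + of_real B * sq \<theta> = \<kappa>"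
    and "of_real B * of_nat (CARD('n) + 2) + of_real C * sq \<theta> = 0"
proof -
  let ?c = "of_real A * of_nat (CARD('n) + 1) + of_real B * sq \<theta>"
  let ?d = "of_real B * of_nat (CARD('n) + 2) + of_real C * sq \<theta>"
  \<comment> \<open>This tensor equation is contracted with \<open>gi\<close> and with
    \<open>N\<close>, giving (\<kappa> - c) n = d |\<theta>|^2 and \<kappa> - c = d |\<theta>|^2, so
    that (\<kappa> - c)(n - 1) = 0.\<close>
  have eq: "(\<kappa> - ?c) * g i j = ?d * (\<theta> i * cnj (\<theta> j))" for i j
  proof -
    have e: "?c * g i j + ?d * (\<theta> i * cnj (\<theta> j)) = \<kappa> * g i j"
      using assms(1)[of i j] unfolding ricci_radial_tensor .
    thus ?thesis by (simp only: left_diff_distrib add_diff_cancel_left' flip: e)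
  qed
  have "(\<^bold>\<Sum>i j. gi i j * ((\<kappa> - ?c) * g i j)) = (\<kappa> - ?c) * (\<^bold>\<Sum>i j. gi i j * g i j)"
    unfolding sum_distrib_left by (simp only: mult_ac)
  hence "(\<kappa> - ?c) * of_nat CARD('n) = (\<^bold>\<Sum>i j. gi i j * (?d * (\<theta> i * cnj (\<theta> j))))"
    unfolding trace eq by (rule sym)
  also have "\<dots> = ?d * sq \<theta>"
    unfolding sq_def sum_distrib_left by (simp only: mult_ac)
  finally have 1: "(\<kappa> - ?c) * of_nat CARD('n) = ?d * sq \<theta>" .
  define N where "N = up (\<lambda>a b. cnj (\<theta> a) * \<theta> b)"
  have "(\<kappa> - ?c) * (\<^bold>\<Sum>i j. N i j * g i j) = (\<^bold>\<Sum>i j. N i j * ((\<kappa> - ?c) * g i j))"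
    unfolding sum_distrib_left by (simp only: mult_ac)
  also have "\<dots> = ?d * (\<^bold>\<Sum>i j. N i j * (\<theta> i * cnj (\<theta> j)))"
    unfolding eq sum_distrib_left by (simp only: mult_ac)
  finally have "(\<kappa> - ?c) * sq \<theta> = ?d * sq \<theta> ^ 2"
    unfolding up_theta_contract[of \<theta>, folded N_def] .
  hence 2: "\<kappa> - ?c = ?d * sq \<theta>" using assms(3) by (simp add: power2_eq_square)
  hence "(\<kappa> - ?c) * (of_nat CARD('n) - 1) = 0" using 1 by (simp add: right_diff_distrib)
  moreover have "of_nat CARD('n) \<noteq> (1::complex)" using assms(2) by auto
  ultimately have 3: "\<kappa> - ?c = 0" by simp
  thus "?c = \<kappa>" by simp
  show "?d = 0" using 2 3 assms(3) by simp
qed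

end

lemma hermitian_metricI:
  assumes "invertible (G z)" "\<And>i j. G z $ i $ j = cnj (G z $ j $ i)"
  shows "hermitian_metric (\<lambda>i j. G z $ i $ j) (\<lambda>i j. ginv G i j z)"
proof
  fix l i m j
  have "(\<^bold>\<Sum>m. ginv G l m z * G z $ i $ m) = (G z ** matrix_inv (G z)) $ i $ l"
    unfolding matrix_matrix_mult_def ginv_def by (simp add: mult.commute)
  thus "(\<^bold>\<Sum>m. ginv G l m z * G z $ i $ m) = (if l = i then 1 else 0)"
    using matrix_inv_right[OF assms(1)] by (simp add: mat_def)
  have "(\<^bold>\<Sum>l. ginv G l m z * G z $ l $ j) = (matrix_inv (G z) ** G z) $ m $ j"
    unfolding matrix_matrix_mult_def ginv_def by simp
  thus "(\<^bold>\<Sum>l. ginv G l m z * G z $ l $ j) = (if m = j then 1 else 0)"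
    using matrix_inv_left[OF assms(1)] by (simp add: mat_def)
  show "cnj (G z $ i $ j) = G z $ j $ i" using assms(2)[of j i] by simp
qed

section \<open>The coefficient \<open>a3\<close> of an Einstein metric\<close>

lemma pd_const_on:
  assumes "open S" "z \<in> S" "\<And>w. w \<in> S \<Longrightarrow> f w = c"
  shows "pd f k z = 0" "pdbar f k z = 0"
  using pd_cong_open[OF assms] has_wd_pd[OF has_wd_const[of c z]] by simp_all

lemma pd_add_const:
  "pd (\<lambda>w. f w + c) k z = pd f k z" "pdbar (\<lambda>w. f w + c) k z = pdbar f k z"
proof -
  have "((\<lambda>w. f w + c) has_derivative D) (at z) \<longleftrightarrow> (f has_derivative D) (at z)" for D
    using has_derivative_add[of "\<lambda>w. f w + c" D "at z" "\<lambda>_. - c" "\<lambda>_. 0"]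
      has_derivative_add[of f D "at z" "\<lambda>_. c" "\<lambda>_. 0"] by auto
  hence "frechet_derivative (\<lambda>w. f w + c) (at z) = frechet_derivative f (at z)"
    unfolding frechet_derivative_def by simp
  thus "pd (\<lambda>w. f w + c) k z = pd f k z" "pdbar (\<lambda>w. f w + c) k z = pdbar f k z"
    unfolding pd_def pdbar_def by simp_all
qed

lemma lap_cong_open:
  assumes "open S" "z \<in> S" "\<And>w. w \<in> S \<Longrightarrow> f w = g w"
  shows "lap G f z = lap G g z"
proof -
  have "pdbar f j w = pdbar g j w" if "w \<in> S" for j w
    using pd_cong_open(2)[OF assms(1) that assms(3)] .
  hence "pd (pdbar f j) i z = pd (pdbar g j) i z" for i j
    using pd_cong_open(1)[OF assms(1,2), of "pdbar f j" "pdbar g j"] by blast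
  thus ?thesis unfolding lap_def by simp
qed

lemma pd_cmult_diff:
  assumes "f differentiable (at z)"
  shows "pd (\<lambda>w. c * f w) k z = c * pd f k z" "pdbar (\<lambda>w. c * f w) k z = c * pdbar f k z"
  using has_wd_pd[OF has_wd_cmult[OF differentiable_imp_has_wd[OF assms]]] by simp_all

text \<open>For an Einstein metric all terms of \<open>a\<^sub>3\<close> with derivatives of the Ricci tensor vanish, and the
  remaining contractions of the Ricci tensor are powers of the Einstein constant.\<close>

lemma a3_einstein:
  fixes G :: "'n::finite mfun" and \<kappa> :: real
  assumes S: "open S" "z \<in> S"
    and inv: "\<And>w. w \<in> S \<Longrightarrow> invertible (G w)"
    and herm: "\<And>w i j. w \<in> S \<Longrightarrow> G w $ i $ j = cnj (G w $ j $ i)"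
    and diff: "\<And>w. w \<in> S \<Longrightarrow> mdiff G w"
    and ke: "\<And>w i j. w \<in> S \<Longrightarrow> ric G i j w = of_real \<kappa> * G w $ i $ j"
    and curv_herm: "\<And>i j k l. cnj (curv G i j k l z) = curv G j i l k z"
  shows "a3 G z = (1/48) * (lap G (norm2_R G) z
     + (2 - of_nat CARD('n)) * of_real \<kappa> * norm2_R G z - of_nat CARD('n) * (of_nat CARD('n) - 2)\<^sup>2 * of_real \<kappa> ^ 3)"
proof -
  have H: "hermitian_metric (\<lambda>i j. G w $ i $ j) (\<lambda>i j. ginv G i j w)" if "w \<in> S" for w
    using hermitian_metricI[of G w, OF inv[OF that] herm[OF that]] .
  interpret hermitian_metric "\<lambda>i j. G z $ i $ j" "\<lambda>i j. ginv G i j z" by (rule H[OF S(2)])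
  let ?n = "of_nat CARD('n) :: complex" and ?k = "of_real \<kappa> :: complex"
  let ?g = "\<lambda>i j. G z $ i $ j" and ?gi = "\<lambda>i j. ginv G i j z" and ?R = "\<lambda>i j k l. curv G i j k l z"
  have scal: "scal G w = ?n * ?k" if "w \<in> S" for w
  proof -
    interpret w: hermitian_metric "\<lambda>i j. G w $ i $ j" "\<lambda>i j. ginv G i j w" by (rule H[OF that])
    have "scal G w = (\<^bold>\<Sum>i j. ?k * (ginv G i j w * G w $ i $ j))"
      unfolding scal_def ke[OF that] by (simp add: mult_ac)
    thus ?thesis using w.trace by (simp add: sum_distrib_left[symmetric] del: sum.delta)
  qed
  have dscal: "pd (scal G) i w = 0" "pdbar (scal G) i w = 0" if "w \<in> S" for i w
    using pd_const_on[OF S(1) that, of "scal G"] scal by blast+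
  have ddscal: "pd (pdbar (scal G) j) i w = 0" if "w \<in> S" for i j w
    using pd_const_on(1)[OF S(1) that, of "pdbar (scal G) j"] dscal(2) by blast
  have lapscal: "lap G (scal G) w = 0" if "w \<in> S" for w
    unfolding lap_def ddscal[OF that] by simp
  have laplap: "lap G (lap G (scal G)) z = 0"
    unfolding lap_def[of G "lap G (scal G)"]
  proof -
    have "pdbar (lap G (scal G)) j w = 0" if "w \<in> S" for j w
      using pd_const_on(2)[OF S(1) that, of "lap G (scal G)"] lapscal by blast
    hence "pd (pdbar (lap G (scal G)) j) i z = 0" for i j
      using pd_const_on(1)[OF S, of "pdbar (lap G (scal G)) j"] by blast
    thus "(\<^bold>\<Sum>i j. ginv G i j z * pd (pdbar (lap G (scal G)) j) i z) = 0" by simp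
  qed
  have rhs0: "ric_hess_scal G z = 0" unfolding ric_hess_scal_def ddscal[OF S(2)] by simp
  have divdiv0: "divdiv_scal_Ric G z = 0"
    unfolding divdiv_scal_Ric_def norm2_Dscal_def rhs0 lapscal[OF S(2)] dscal[OF S(2)] by simp
  have ric1: "ric1 G i j k w = 0" if "w \<in> S" for i j k w
  proof -
    interpret w: hermitian_metric "\<lambda>i j. G w $ i $ j" "\<lambda>i j. ginv G i j w" by (rule H[OF that])
    have d: "(\<lambda>w. G w $ i $ j) differentiable (at w)" using diff[OF that] unfolding mdiff_def by blast
    have "pd (ric G i j) k w = pd (\<lambda>w. ?k * G w $ i $ j) k w"
      by (rule pd_cong_open[OF S(1) that ke])
    hence 1: "pd (ric G i j) k w = ?k * pd (\<lambda>w. G w $ i $ j) k w"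
      unfolding pd_cmult_diff(1)[OF d] .
    have "(\<^bold>\<Sum>p q. ginv G p q w * pd (\<lambda>w. G w $ i $ q) k w * ric G p j w) =
       ?k * (\<^bold>\<Sum>p q. ginv G p q w * (G w $ p $ j * pd (\<lambda>w. G w $ i $ q) k w))"
      unfolding ke[OF that] sum_distrib_left by (simp only: mult_ac)
    thus ?thesis unfolding ric1_def 1 w.contract2 by simp
  qed
  have ric2: "ric2 G i j k l z = 0" for i j k l
    unfolding ric2_def ric1[OF S(2)] using pd_const_on(2)[OF S, of "ric1 G i j k"] ric1 by auto
  have DRic: "norm2_DRic G z = 0" unfolding norm2_DRic_def ric1[OF S(2)] by simp
  have nRic: "norm2_Ric G w = ?n * ?k ^ 2" if "w \<in> S" for w
  proof -
    interpret w: hermitian_metric "\<lambda>i j. G w $ i $ j" "\<lambda>i j. ginv G i j w" by (rule H[OF that])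
    have "norm2_Ric G w = ?k ^ 2 * (\<^bold>\<Sum>i j. G w $ i $ j * w.up (\<lambda>a b. G w $ b $ a) i j)"
      unfolding norm2_Ric_def ke[OF that] w.up_def sum_distrib_left
      by (simp add: w.herm power2_eq_square mult_ac)
    also have "(\<^bold>\<Sum>i j. G w $ i $ j * w.up (\<lambda>a b. G w $ b $ a) i j) = ?n"
      unfolding w.up_g using w.trace by (simp only: mult.commute)
    finally show ?thesis by simp
  qed
  have RRR: "R_Ric_Ric G z = ?k ^ 3 * ?n"
  proof -
    have "R_Ric_Ric G z = ?k\<^sup>2 * (\<^bold>\<Sum>i j k l. ?R i j k l *
        (\<^bold>\<Sum>a b c d. ?gi i a * ?gi b j * ?gi k c * ?gi d l * (?g b a * ?g d c)))"
      unfolding R_Ric_Ric_def ke[OF S(2)] sum_distrib_left by (simp only: power2_eq_square mult_ac)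
    also have "\<dots> = ?k\<^sup>2 * (\<^bold>\<Sum>i j. ?gi i j * ric G i j z)"
      unfolding up4(1)[of _ _ _ _ "\<lambda>a b. ?g b a" "\<lambda>a b. ?g b a"] up_g ric_def sum_distrib_left
      by (simp only: mult_ac)
    also have "\<dots> = ?k\<^sup>2 * (?n * ?k)" using scal[OF S(2)] unfolding scal_def by simp
    finally show ?thesis by (simp add: power2_eq_square power3_eq_cube)
  qed
  have s3: "sigma3_Ric G z = ?k ^ 3 * ?n"
  proof -
    have inner: "(\<^bold>\<Sum>\<beta> \<gamma>. ?gi \<gamma> \<beta> * ?g \<alpha> \<beta> * (\<^bold>\<Sum>\<delta>. ?gi i \<delta> * ?g \<gamma> \<delta>)) =
       (if i = \<alpha> then 1 else 0)" for i \<alpha>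
    proof -
      have "(\<^bold>\<Sum>\<gamma>. ?gi \<gamma> \<beta> * ?g \<alpha> \<beta> * (\<^bold>\<Sum>\<delta>. ?gi i \<delta> * ?g \<gamma> \<delta>)) =
          (\<^bold>\<Sum>\<gamma>. (if i = \<gamma> then 1 else 0) * (?gi \<gamma> \<beta> * ?g \<alpha> \<beta>))" for \<beta>
        unfolding inv1 by (simp only: mult_ac)
      thus ?thesis unfolding delta2 using inv1 by simp
    qed
    have outer: "(\<^bold>\<Sum>\<alpha>. ?gi \<alpha> j * ?g i j * (if i = \<alpha> then 1 else 0)) = ?gi i j * ?g i j" for i j
      by (rule trans[OF sum.cong[OF refl mult.commute] delta2])
    have "sigma3_Ric G z = ?k ^ 3 * (\<^bold>\<Sum>i j \<alpha>. ?gi \<alpha> j * ?g i j *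
      (\<^bold>\<Sum>\<beta> \<gamma>. ?gi \<gamma> \<beta> * ?g \<alpha> \<beta> * (\<^bold>\<Sum>\<delta>. ?gi i \<delta> * ?g \<gamma> \<delta>)))"
      unfolding sigma3_Ric_def ke[OF S(2)] sum_distrib_left by (simp only: power3_eq_cube mult_ac)
    also have "\<dots> = ?k ^ 3 * (\<^bold>\<Sum>i j \<alpha>. ?gi \<alpha> j * ?g i j * (if i = \<alpha> then 1 else 0))"
      unfolding inner ..
    also have "\<dots> = ?k ^ 3 * (\<^bold>\<Sum>i j. ?gi i j * ?g i j)"
      unfolding outer ..
    finally show ?thesis unfolding trace .
  qed
  \<comment> \<open>Since Ric = \<kappa> g, one inverse metric cancels and identifies \<beta> with
    i. After exchanging the names k and \<gamma>, Hermitian symmetry turns the second curvature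
    factor into a conjugate, and the sum is the square norm.\<close>
  have RicRR: "Ric_R_R G z = ?k * norm2_R G z"
  proof -
    have "Ric_R_R G z = ?k * (\<^bold>\<Sum>i j k p q \<alpha> \<beta>. (?gi \<beta> j * ?g i j) * (\<^bold>\<Sum>\<gamma> \<delta> \<epsilon>. ?gi i \<alpha> * ?gi k \<gamma> * ?gi p \<delta> * ?gi \<epsilon> q * ?R \<beta> \<gamma> p q * ?R k \<alpha> \<epsilon> \<delta>))"
      unfolding Ric_R_R_def ke[OF S(2)] sum_distrib_left by (simp only: mult_ac)
    also have "\<dots> = ?k * (\<^bold>\<Sum>i k p q \<alpha> \<beta>. (\<^bold>\<Sum>j. ?gi \<beta> j * ?g i j) * (\<^bold>\<Sum>\<gamma> \<delta> \<epsilon>. ?gi i \<alpha> * ?gi k \<gamma> * ?gi p \<delta> * ?gi \<epsilon> q * ?R \<beta> \<gamma> p q * ?R k \<alpha> \<epsilon> \<delta>))"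
      unfolding sum_distrib_right
      by (rule arg_cong[of _ _ "(*) ?k"], rule sum.cong[OF refl], rule sum_rotate)
    also have "\<dots> = ?k * (\<^bold>\<Sum>i k p q \<alpha> \<gamma>. (\<^bold>\<Sum>\<delta> \<epsilon>. ?gi i \<alpha> * ?gi k \<gamma> * ?gi p \<delta> * ?gi \<epsilon> q * ?R i \<gamma> p q * ?R k \<alpha> \<epsilon> \<delta>))"
      unfolding inv1 delta1 ..
    also have "\<dots> = ?k * (\<^bold>\<Sum>i \<gamma> p q \<alpha> k. (\<^bold>\<Sum>\<delta> \<epsilon>. ?gi i \<alpha> * ?gi k \<gamma> * ?gi p \<delta> * ?gi \<epsilon> q * ?R i \<gamma> p q * ?R k \<alpha> \<epsilon> \<delta>))"
      by (rule arg_cong[of _ _ "(*) ?k"], rule sum.cong[OF refl], rule sum_swap_outer_inner)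
    also have "\<dots> = ?k * norm2_R G z"
      unfolding norm2_R_def curv_herm ..
    finally show ?thesis .
  qed
  \<comment> \<open>The two cubic contractions both equal n \<kappa>^3 and enter with opposite
    signs.\<close>
  have divR: "divdiv_R_Ric G z = 0"
    unfolding divdiv_R_Ric_def rhs0 DRic ric2 RRR s3 by simp
  have lapn: "lap G (\<lambda>w. norm2_R G w - 4 * norm2_Ric G w + 8 * (scal G w)\<^sup>2) z = lap G (norm2_R G) z"
  proof -
    have "lap G (\<lambda>w. norm2_R G w - 4 * norm2_Ric G w + 8 * (scal G w)\<^sup>2) z =
        lap G (\<lambda>w. norm2_R G w + (8 * (?n * ?k)\<^sup>2 - 4 * (?n * ?k ^ 2))) z"
      by (rule lap_cong_open[OF S]) (simp add: nRic scal)
    thus ?thesis unfolding lap_def pd_add_const by simp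
  qed
  \<comment> \<open>The cubic terms collect to n^3 - 4 n^2 + 4 n = n (n - 2)^2.\<close>
  show ?thesis
    unfolding a3_def laplap divR divdiv0 lapn scal[OF S(2)] nRic[OF S(2)] s3 RRR RicRR
    by (simp add: field_simps power2_eq_square power3_eq_cube)
qed

section \<open>The curvature of radial metrics\<close>

text \<open>With f1 = f' and f2 = f'' this is the complex Hessian of f(|z|^2). The two functions are
  separate parameters so that the same matrix describes the metric and the Hessian of any other
  radial function.\<close>

definition radial_matrix :: "(real \<Rightarrow> real) \<Rightarrow> (real \<Rightarrow> real) \<Rightarrow> complex^'n::finite \<Rightarrow> complex^'n^'n" where
  "radial_matrix f1 f2 z = (\<chi> i j. of_real (f1 ((norm z)\<^sup>2)) * (if i = j then 1 else 0)
     + of_real (f2 ((norm z)\<^sup>2)) * (cnj (z $ i) * z $ j))"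

lemma has_wd_cnj_coord: "has_wd (\<lambda>w. cnj (w $ i)) (\<lambda>_. 0) (\<lambda>k. if k = i then 1 else 0) z"
  using has_wd_cnj[OF has_wd_coord[of i z]] by (rule has_wd_cong) auto

lemma levi_radial:
  assumes "open S" "z \<in> S"
    and "\<And>w. w \<in> S \<Longrightarrow> (f has_real_derivative f1 ((norm w)\<^sup>2)) (at ((norm w)\<^sup>2))"
    and "(f1 has_real_derivative f2 ((norm z)\<^sup>2)) (at ((norm z)\<^sup>2))"
  shows "levi (\<lambda>w. f ((norm w)\<^sup>2)) z = radial_matrix f1 f2 z"
proof -
  have b: "pdbar (\<lambda>w. of_real (f ((norm w)\<^sup>2))) j w = of_real (f1 ((norm w)\<^sup>2)) * w $ j" if "w \<in> S" for w j
    by (rule has_wd_pd(2)[OF has_wd_radial[OF assms(3)[OF that]]])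
  have "pd (pdbar (\<lambda>w. of_real (f ((norm w)\<^sup>2))) j) i z = pd (\<lambda>w. of_real (f1 ((norm w)\<^sup>2)) * w $ j) i z" for i j
    by (rule pd_cong_open(1)[OF assms(1,2) b])
  also have "pd (\<lambda>w. of_real (f1 ((norm w)\<^sup>2)) * w $ j) i z =
      of_real (f2 ((norm z)\<^sup>2)) * cnj (z $ i) * z $ j + of_real (f1 ((norm z)\<^sup>2)) * (if i = j then 1 else 0)" for i j
    by (rule has_wd_pd(1)[OF has_wd_mult[OF has_wd_radial[OF assms(4)] has_wd_coord]])
  finally show ?thesis unfolding levi_def radial_matrix_def vec_eq_iff by simp
qed

section \<open>Inverse and traces of the radial matrix\<close>

definition kron :: "'n \<Rightarrow> 'n \<Rightarrow> complex" where
  "kron i j = (if i = j then 1 else 0)"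

lemma kron_sym: "kron i j = kron j i" unfolding kron_def by simp

lemma sum_kron:
  fixes f :: "'n::finite \<Rightarrow> complex"
  shows "(\<^bold>\<Sum>s. kron i s * f s) = f i" "(\<^bold>\<Sum>s. kron s i * f s) = f i"
    "(\<^bold>\<Sum>s. f s * kron i s) = f i" "(\<^bold>\<Sum>s. f s * kron s i) = f i"
proof -
  have "(\<^bold>\<Sum>s. kron i s * f s) = (\<^bold>\<Sum>s. if s = i then f s else 0)"
    by (rule sum.cong) (auto simp: kron_def)
  thus *: "(\<^bold>\<Sum>s. kron i s * f s) = f i" by simp
  thus "(\<^bold>\<Sum>s. kron s i * f s) = f i" "(\<^bold>\<Sum>s. f s * kron i s) = f i" "(\<^bold>\<Sum>s. f s * kron s i) = f i"
    by (simp_all only: kron_sym[of _ i] mult.commute[of "f _"])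
qed

lemma has_wd_kron:
  "has_wd (\<lambda>w. w $ i) (\<lambda>k. kron k i) (\<lambda>_. 0) z"
  "has_wd (\<lambda>w. cnj (w $ i)) (\<lambda>_. 0) (\<lambda>k. kron k i) z"
  using has_wd_coord has_wd_cnj_coord unfolding kron_def by blast+

lemma norm2_sum: "(\<^bold>\<Sum>i. z $ i * cnj (z $ i)) = of_real ((norm z)\<^sup>2)" "(\<^bold>\<Sum>i. cnj (z $ i) * z $ i) = of_real ((norm z)\<^sup>2)"
  for z :: "complex^'n::finite"
  unfolding norm2_eq_sum by (simp_all add: mult.commute)

lemma radial_matrix_nth:
  "radial_matrix f1 f2 z $ i $ j = of_real (f1 ((norm z)\<^sup>2)) * kron i j + of_real (f2 ((norm z)\<^sup>2)) * (cnj (z $ i) * z $ j)"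
  unfolding radial_matrix_def kron_def by simp

lemma radial_matrix_herm: "radial_matrix f1 f2 z $ i $ j = cnj (radial_matrix f1 f2 z $ j $ i)"
  unfolding radial_matrix_nth kron_def by (simp add: mult.commute)

text \<open>The matrix is f1 times the identity plus a rank-one matrix, with eigenvalue f1 + x f2
  along the radial direction and f1 on its orthogonal complement. The formula is the inverse of a
  rank-one update.\<close>

lemma radial_matrix_inverse:
  fixes z :: "complex^'n::finite"
  defines "x \<equiv> (norm z)\<^sup>2"
  assumes nz: "f1 x \<noteq> 0" "f1 x + x * f2 x \<noteq> 0"
  shows "invertible (radial_matrix f1 f2 z)"
    and "matrix_inv (radial_matrix f1 f2 z) =
      (\<chi> i j. of_real (1 / f1 x) * kron i j - of_real (f2 x / (f1 x * (f1 x + x * f2 x))) * (cnj (z $ i) * z $ j))"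
proof -
  let ?G = "radial_matrix f1 f2 z"
  let ?N = "\<chi> i j. of_real (1 / f1 x) * kron i j - of_real (f2 x / (f1 x * (f1 x + x * f2 x))) * (cnj (z $ i) * z $ j)"
  let ?a = "complex_of_real (f1 x)" and ?b = "complex_of_real (f2 x)"
  let ?c = "complex_of_real (f2 x / (f1 x * (f1 x + x * f2 x)))"
  have real: "- f1 x * (f2 x / (f1 x * (f1 x + x * f2 x))) + f2 x * (1 / f1 x) - f2 x * (f2 x / (f1 x * (f1 x + x * f2 x))) * x = 0"
    using nz by (simp add: divide_simps) (simp add: algebra_simps)
  have "(?G ** ?N) $ i $ j = kron i j" for i j
  proof -
    have "(?G ** ?N) $ i $ j = (\<^bold>\<Sum>s. kron i s * (?a * of_real (1 / f1 x) * kron s j)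
        + kron i s * (- ?a * ?c * (cnj (z $ s) * z $ j))
        + (?b * of_real (1 / f1 x) * (cnj (z $ i) * z $ s)) * kron s j
        + (- ?b * ?c * cnj (z $ i) * z $ j) * (z $ s * cnj (z $ s)))"
      unfolding matrix_matrix_mult_def vec_lambda_beta radial_matrix_nth x_def[symmetric]
      by (rule sum.cong[OF refl]) algebra
    also have "\<dots> = ?a * of_real (1 / f1 x) * kron i j + (- ?a * ?c * (cnj (z $ i) * z $ j))
        + (?b * of_real (1 / f1 x) * (cnj (z $ i) * z $ j)) + (- ?b * ?c * cnj (z $ i) * z $ j) * of_real x"
      by (simp only: sum.distrib sum_kron sum_distrib_left[symmetric] norm2_sum x_def)
    also have "\<dots> = ?a * of_real (1 / f1 x) * kron i j +
       of_real (- f1 x * (f2 x / (f1 x * (f1 x + x * f2 x))) + f2 x * (1 / f1 x) - f2 x * (f2 x / (f1 x * (f1 x + x * f2 x))) * x)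
         * (cnj (z $ i) * z $ j)"
      unfolding of_real_add of_real_diff of_real_mult of_real_minus by algebra
    also have "\<dots> = kron i j" unfolding real using nz(1) by simp
    finally show ?thesis .
  qed
  hence GN: "?G ** ?N = mat 1" unfolding vec_eq_iff mat_def kron_def by simp
  hence NG: "?N ** ?G = mat 1" by (simp add: matrix_left_right_inverse)
  show inv: "invertible ?G" unfolding invertible_def using GN NG by blast
  have "matrix_inv ?G = matrix_inv ?G ** (?G ** ?N)" unfolding GN by simp
  thus "matrix_inv ?G = ?N" by (simp add: matrix_mul_assoc matrix_inv_left[OF inv])
qed

text \<open>The first value is the squared length of \<partial>|z|^2. With v1 = v' and v2 = v'' the
  second is the Laplacian of the radial function v(|z|^2).\<close>

lemma radial_contract:
  fixes z :: "complex^'n::finite"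
  defines "x \<equiv> (norm z)\<^sup>2"
  assumes nz: "f1 x \<noteq> 0" "f1 x + x * f2 x \<noteq> 0" and G: "G z = radial_matrix f1 f2 z"
  shows "(\<^bold>\<Sum>i j. ginv G i j z * (cnj (z $ i) * z $ j)) = of_real (x / (f1 x + x * f2 x))"
    and "(\<^bold>\<Sum>i j. ginv G i j z * radial_matrix v1 v2 z $ i $ j) =
      of_real (v1 x / f1 x * (CARD('n) - f2 x * x / (f1 x + x * f2 x)) + v2 x * x / (f1 x + x * f2 x))"
proof -
  let ?c = "complex_of_real (f2 x / (f1 x * (f1 x + x * f2 x)))"
  have gi: "ginv G i j z = of_real (1 / f1 x) * kron j i - ?c * (cnj (z $ j) * z $ i)" for i j
    unfolding ginv_def G radial_matrix_inverse(2)[of f1 z f2, folded x_def, OF nz] by simp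
  have "(\<^bold>\<Sum>i j. ginv G i j z * (cnj (z $ i) * z $ j)) =
    (\<^bold>\<Sum>i j. kron j i * (of_real (1 / f1 x) * (cnj (z $ i) * z $ j)) - ?c * (z $ i * cnj (z $ i) * (z $ j * cnj (z $ j))))"
    unfolding gi by (simp add: algebra_simps)
  also have "\<dots> = of_real (1 / f1 x) * of_real x - ?c * (of_real x * of_real x)"
    by (simp only: sum_subtractf sum_kron sum_distrib_left[symmetric] sum_distrib_right[symmetric] norm2_sum x_def)
  also have "\<dots> = of_real (1 / f1 x * x - f2 x / (f1 x * (f1 x + x * f2 x)) * (x * x))" by simp
  also have "1 / f1 x * x - f2 x / (f1 x * (f1 x + x * f2 x)) * (x * x) = x / (f1 x + x * f2 x)"
    using nz by (simp add: divide_simps) (simp add: algebra_simps)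
  finally show 1: "(\<^bold>\<Sum>i j. ginv G i j z * (cnj (z $ i) * z $ j)) = of_real (x / (f1 x + x * f2 x))" .
  have "(\<^bold>\<Sum>i j. ginv G i j z * kron i j) =
     (\<^bold>\<Sum>i. of_real (1 / f1 x) - ?c * (z $ i * cnj (z $ i)))"
    unfolding gi sum_kron by (simp add: kron_def mult_ac)
  also have "\<dots> = of_nat CARD('n) * of_real (1 / f1 x) - ?c * of_real x"
    by (simp only: sum_subtractf sum_constant sum_distrib_left[symmetric] norm2_sum x_def)
  finally have 2: "(\<^bold>\<Sum>i j. ginv G i j z * kron i j) =
    of_real (CARD('n) * (1 / f1 x) - f2 x / (f1 x * (f1 x + x * f2 x)) * x)" by simp
  have "(\<^bold>\<Sum>i j. ginv G i j z * radial_matrix v1 v2 z $ i $ j) =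
    (\<^bold>\<Sum>i j. of_real (v1 x) * (ginv G i j z * kron i j) + of_real (v2 x) * (ginv G i j z * (cnj (z $ i) * z $ j)))"
    unfolding radial_matrix_nth x_def[symmetric] by (simp add: algebra_simps)
  also have "\<dots> = of_real (v1 x) * of_real (CARD('n) * (1 / f1 x) - f2 x / (f1 x * (f1 x + x * f2 x)) * x)
      + of_real (v2 x) * of_real (x / (f1 x + x * f2 x))"
    by (simp only: sum.distrib sum_distrib_left[symmetric] 1 2)
  also have "\<dots> = of_real (v1 x * (CARD('n) * (1 / f1 x) - f2 x / (f1 x * (f1 x + x * f2 x)) * x) + v2 x * (x / (f1 x + x * f2 x)))"
    by (simp only: of_real_add of_real_mult)
  also have "v1 x * (CARD('n) * (1 / f1 x) - f2 x / (f1 x * (f1 x + x * f2 x)) * x) + v2 x * (x / (f1 x + x * f2 x))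
     = v1 x / f1 x * (CARD('n) - f2 x * x / (f1 x + x * f2 x)) + v2 x * x / (f1 x + x * f2 x)"
  proof -
    have "p * (q * (1 / a) - b / (a * y) * x) + r * (x / y) = p / a * (q - b * x / y) + r * x / y"
      if "a \<noteq> 0" "y \<noteq> 0" for p q r a b y :: real
      using that by (simp add: field_simps)
    from this[OF nz] show ?thesis .
  qed
  finally show "(\<^bold>\<Sum>i j. ginv G i j z * radial_matrix v1 v2 z $ i $ j) =
      of_real (v1 x / f1 x * (CARD('n) - f2 x * x / (f1 x + x * f2 x)) + v2 x * x / (f1 x + x * f2 x))" .
qed

text \<open>The comparison of coefficients behind \<open>curv_radial\<close>, with the coordinates
  of z, their conjugates and the Kronecker symbols as independent variables. Expressing f'' and f'''
  through \<open>A\<close> and \<open>B\<close> removes all denominators, so the claim is a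
  polynomial identity.\<close>

lemma radial_curvature_identity:
  fixes F1 A B F4 c X :: complex
  defines "F2 \<equiv> A * F1\<^sup>2" and "F3 \<equiv> F1 * B + 2 * A\<^sup>2 * F1 ^ 3"
  defines "C \<equiv> F4 - 2 * A * F1 * F3 - c * (2 * F2 + X * F3) - 2 * A * F2\<^sup>2 - 4 * B * F2"
  shows "(F3 * Vk * Wl + F2 * dkl) * dij + F4 * Vk * (Wl * (Vi * Wj)) + F3 * (dkl * (Vi * Wj) + Wl * (Vi * dkj)) + dil * (F3 * Vk * Wj + F2 * dkj)
      - (A * F1 * Vk * (F2 * Wl * dij + F3 * Wl * (Vi * Wj) + F2 * (dil * Wj))
       + A * F1 * Vi * (F2 * Wl * dkj + F3 * Wl * (Vk * Wj) + F2 * (dkl * Wj))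
       + c * (Vi * Vk) * (F2 * (Wl * Wj) + F3 * (Wl * Wj) * X + F2 * (Wl * Wj)))
    = A * ((F1 * dij + F2 * (Vi * Wj)) * (F1 * dkl + F2 * (Vk * Wl)) + (F1 * dil + F2 * (Vi * Wl)) * (F1 * dkj + F2 * (Vk * Wj)))
     + B * ((F1 * dij + F2 * (Vi * Wj)) * (Vk * Wl) + (Vi * Wj) * (F1 * dkl + F2 * (Vk * Wl))
       + (F1 * dil + F2 * (Vi * Wl)) * (Vk * Wj) + (Vi * Wl) * (F1 * dkj + F2 * (Vk * Wj)))
     + C * ((Vi * Wj) * (Vk * Wl))"
  unfolding C_def F2_def F3_def by algebra

text \<open>The coefficients of the curvature in the shape \<open>radial_tensor\<close>, as
  functions of the values of f', f'' and so on. \<open>radial_B\<close> is f' times the derivative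
  of \<open>radial_A\<close>; \<open>radial_C\<close> collects what is left of the term of degree
  four in \<partial>|z|^2.\<close>

definition radial_A :: "real \<Rightarrow> real \<Rightarrow> real" where "radial_A f1 f2 = f2 / f1\<^sup>2"
definition radial_B :: "real \<Rightarrow> real \<Rightarrow> real \<Rightarrow> real" where "radial_B f1 f2 f3 = f3 / f1 - 2 * f2\<^sup>2 / f1\<^sup>2"
definition radial_C :: "real \<Rightarrow> real \<Rightarrow> real \<Rightarrow> real \<Rightarrow> real \<Rightarrow> real" where
  "radial_C x f1 f2 f3 f4 = f4 - 2 * f2 * f3 / f1 - f1 * radial_B f1 f2 f3 * (2 * f2 + x * f3) / (f1 + x * f2)
     - 2 * f2 ^ 3 / f1\<^sup>2 - 4 * radial_B f1 f2 f3 * f2"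

text \<open>The chain of derivatives starts at f' and is required only at the values |w|^2 attained
  on \<open>T\<close>, so a punctured chart qualifies, as does a model whose metric is given without
  a potential. The two inequalities say that the eigenvalues of the metric are positive.\<close>

definition radial_on :: "'n::finite mfun \<Rightarrow> (real \<Rightarrow> real) \<Rightarrow> (real \<Rightarrow> real) \<Rightarrow> (real \<Rightarrow> real) \<Rightarrow> (real \<Rightarrow> real) \<Rightarrow>
    (complex^'n) set \<Rightarrow> bool" where
  "radial_on G f1 f2 f3 f4 T \<longleftrightarrow> open T \<and> (\<forall>w\<in>T. G w = radial_matrix f1 f2 w \<and>
     (f1 has_real_derivative f2 ((norm w)\<^sup>2)) (at ((norm w)\<^sup>2)) \<and>
     (f2 has_real_derivative f3 ((norm w)\<^sup>2)) (at ((norm w)\<^sup>2)) \<and>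
     (f3 has_real_derivative f4 ((norm w)\<^sup>2)) (at ((norm w)\<^sup>2)) \<and>
     f1 ((norm w)\<^sup>2) > 0 \<and> f1 ((norm w)\<^sup>2) + (norm w)\<^sup>2 * f2 ((norm w)\<^sup>2) > 0)"

lemma radial_on_mwd:
  assumes "radial_on G f1 f2 f3 f4 T" "w \<in> T"
  shows "mwd G (\<lambda>k. \<chi> i j. of_real (f2 ((norm w)\<^sup>2)) * (cnj (w $ k) * kron i j)
        + of_real (f3 ((norm w)\<^sup>2)) * (cnj (w $ k) * (cnj (w $ i) * w $ j)) + of_real (f2 ((norm w)\<^sup>2)) * (cnj (w $ i) * kron k j))
     (\<lambda>l. \<chi> i j. of_real (f2 ((norm w)\<^sup>2)) * (w $ l * kron i j)
        + of_real (f3 ((norm w)\<^sup>2)) * (w $ l * (cnj (w $ i) * w $ j)) + of_real (f2 ((norm w)\<^sup>2)) * (kron l i * w $ j)) w"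
    (is "mwd G ?a ?b w")
proof (rule mwd_transform[of "radial_matrix f1 f2"])
  show "open T" "w \<in> T" "\<And>w. w \<in> T \<Longrightarrow> radial_matrix f1 f2 w = G w" using assms unfolding radial_on_def by auto
  have d: "(f1 has_real_derivative f2 ((norm w)\<^sup>2)) (at ((norm w)\<^sup>2))"
     "(f2 has_real_derivative f3 ((norm w)\<^sup>2)) (at ((norm w)\<^sup>2))"
    using assms unfolding radial_on_def by auto
  show "mwd (radial_matrix f1 f2) ?a ?b w"
    unfolding mwd_def radial_matrix_nth
  proof (intro allI)
    fix i j
    show "has_wd (\<lambda>w. of_real (f1 ((norm w)\<^sup>2)) * kron i j + of_real (f2 ((norm w)\<^sup>2)) * (cnj (w $ i) * w $ j))
       (\<lambda>k. ?a k $ i $ j) (\<lambda>l. ?b l $ i $ j) w"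
      by (rule has_wd_cong[OF has_wd_add[OF has_wd_mult[OF has_wd_radial[OF d(1)] has_wd_const]
            has_wd_mult[OF has_wd_radial[OF d(2)] has_wd_mult[OF has_wd_kron(2) has_wd_kron(1)]]]])
         (simp_all add: mult_ac)
  qed
qed

text \<open>Of the second derivatives the curvature contains only the mixed ones, which are given
  explicitly. The conjugate ones stay existential; together they give differentiability.\<close>

lemma radial_on_mwd2:
  assumes "radial_on G f1 f2 f3 f4 T" "w \<in> T"
  shows "\<exists>b. mwd (mpdbar G l) (\<lambda>k. \<chi> i j.
      (of_real (f3 ((norm w)\<^sup>2)) * cnj (w $ k) * w $ l + of_real (f2 ((norm w)\<^sup>2)) * kron k l) * kron i j
      + of_real (f4 ((norm w)\<^sup>2)) * cnj (w $ k) * (w $ l * (cnj (w $ i) * w $ j))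
      + of_real (f3 ((norm w)\<^sup>2)) * (kron k l * (cnj (w $ i) * w $ j) + w $ l * (cnj (w $ i) * kron k j))
      + kron i l * (of_real (f3 ((norm w)\<^sup>2)) * cnj (w $ k) * w $ j + of_real (f2 ((norm w)\<^sup>2)) * kron k j)) b w"
    (is "\<exists>b. mwd (mpdbar G l) ?a b w")
proof -
  have T: "open T" using assms unfolding radial_on_def by auto
  have d: "(f2 has_real_derivative f3 ((norm w)\<^sup>2)) (at ((norm w)\<^sup>2))"
     "(f3 has_real_derivative f4 ((norm w)\<^sup>2)) (at ((norm w)\<^sup>2))"
    using assms unfolding radial_on_def by auto
  let ?g = "\<lambda>i j w. of_real (f2 ((norm w)\<^sup>2)) * (w $ l * kron i j)
        + of_real (f3 ((norm w)\<^sup>2)) * (w $ l * (cnj (w $ i) * w $ j)) + of_real (f2 ((norm w)\<^sup>2)) * (kron l i * w $ j)"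
  define b :: "'a \<Rightarrow> complex^'a^'a" where "b = (\<lambda>k. \<chi> i j. pdbar (?g i j) k w)"
  have "mwd (mpdbar G l) ?a b w"
    unfolding mwd_def
  proof (intro allI)
    fix i j
    note wd = has_wd_add[OF has_wd_add[OF
        has_wd_mult[OF has_wd_radial[OF d(1)] has_wd_mult[OF has_wd_kron(1)[of l w] has_wd_const[of "kron i j"]]]
        has_wd_mult[OF has_wd_radial[OF d(2)] has_wd_mult[OF has_wd_kron(1)[of l w] has_wd_mult[OF has_wd_kron(2)[of i w] has_wd_kron(1)[of j w]]]]]
        has_wd_mult[OF has_wd_radial[OF d(1)] has_wd_mult[OF has_wd_const[of "kron l i"] has_wd_kron(1)[of j w]]]]
    have "has_wd (?g i j) (\<lambda>k. ?a k $ i $ j) (\<lambda>k. b k $ i $ j) w"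
      by (rule has_wd_cong[OF wd])
         (simp_all only: b_def vec_lambda_beta has_wd_pd(2)[OF wd], simp add: kron_sym[of l i] algebra_simps)
    thus "has_wd (\<lambda>w. mpdbar G l w $ i $ j) (\<lambda>k. ?a k $ i $ j) (\<lambda>k. b k $ i $ j) w"
      by (rule has_wd_transform[OF _ T assms(2)]) (simp add: mwd_mpd(2)[OF radial_on_mwd[OF assms(1)]])
  qed
  thus ?thesis by blast
qed

text \<open>Since \<open>\<partial>\<^sub>k G = M\<^sub>k G\<close> with an explicit matrix \<open>M\<^sub>k\<close>, the quadratic term of the curvature is
  \<open>M\<^sub>k \<partial>\<^sub>l\<^sup>* G\<close>, and no inverse of \<open>G\<close> is needed.\<close>

lemma curv_radial:
  assumes R: "radial_on G f1 f2 f3 f4 T" and z: "z \<in> T"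
  defines "x \<equiv> (norm z)\<^sup>2"
  shows "curv G i j k l z = radial_tensor (\<lambda>i j. G z $ i $ j) (\<lambda>i. cnj (z $ i))
     (radial_A (f1 x) (f2 x)) (radial_B (f1 x) (f2 x) (f3 x)) (radial_C x (f1 x) (f2 x) (f3 x) (f4 x)) i j k l"
proof -
  have G: "G z = radial_matrix f1 f2 z" and pos: "f1 x > 0" "f1 x + x * f2 x > 0"
    using R z unfolding radial_on_def x_def by auto
  let ?W = "\<lambda>i. z $ i" and ?V = "\<lambda>i. cnj (z $ i)"
  let ?X = "complex_of_real x"
  define F1 F2 F3 F4 where F: "F1 = complex_of_real (f1 x)" "F2 = complex_of_real (f2 x)" "F3 = complex_of_real (f3 x)" "F4 = complex_of_real (f4 x)"
  define A where "A = complex_of_real (radial_A (f1 x) (f2 x))"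
  define B where "B = complex_of_real (radial_B (f1 x) (f2 x) (f3 x))"
  \<comment> \<open>Chosen so that c (f1 + x f2) = f1 B. The factor f1 + x f2 appears because z is a
    left eigenvector of the metric matrix with this eigenvalue (\<open>Wg\<close>).\<close>
  define c where "c = complex_of_real (f1 x * radial_B (f1 x) (f2 x) (f3 x) / (f1 x + x * f2 x))"
  have F2: "F2 = A * F1\<^sup>2" unfolding A_def F radial_A_def using pos by simp
  have F3: "F3 = F1 * B + 2 * A\<^sup>2 * F1 ^ 3"
  proof -
    have "f3 x = f1 x * radial_B (f1 x) (f2 x) (f3 x) + 2 * (radial_A (f1 x) (f2 x))\<^sup>2 * f1 x ^ 3"
      unfolding radial_B_def radial_A_def using pos(1) by (simp add: field_simps power2_eq_square power3_eq_cube)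
    from arg_cong[of _ _ complex_of_real, OF this] show ?thesis
      unfolding A_def B_def F by (simp only: of_real_add of_real_mult of_real_numeral of_real_power)
  qed
  have C: "complex_of_real (radial_C x (f1 x) (f2 x) (f3 x) (f4 x)) =
     F4 - 2 * A * F1 * F3 - c * (2 * F2 + ?X * F3) - 2 * A * F2\<^sup>2 - 4 * B * F2"
  proof -
    have "radial_C x (f1 x) (f2 x) (f3 x) (f4 x) = f4 x - 2 * radial_A (f1 x) (f2 x) * f1 x * f3 x
       - f1 x * radial_B (f1 x) (f2 x) (f3 x) / (f1 x + x * f2 x) * (2 * f2 x + x * f3 x) - 2 * radial_A (f1 x) (f2 x) * (f2 x)\<^sup>2
       - 4 * radial_B (f1 x) (f2 x) (f3 x) * f2 x"
      unfolding radial_C_def radial_A_def using pos(1) by (simp add: power2_eq_square power3_eq_cube)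
    thus ?thesis unfolding A_def B_def c_def F by simp
  qed
  have cY: "c * (F1 + ?X * F2) = F1 * B"
  proof -
    have "f1 x * radial_B (f1 x) (f2 x) (f3 x) / (f1 x + x * f2 x) * (f1 x + x * f2 x) = f1 x * radial_B (f1 x) (f2 x) (f3 x)"
      using pos(2) by simp
    from arg_cong[of _ _ complex_of_real, OF this] show ?thesis
      unfolding c_def B_def F by (simp only: of_real_add of_real_mult)
  qed
  have g: "G z $ i $ j = F1 * kron i j + F2 * (?V i * ?W j)" for i j
    unfolding G radial_matrix_nth F x_def ..
  \<comment> \<open>Solves \<partial>_k G = M G. The two terms with A F1 reproduce the Kronecker
    parts of \<partial>_k G; what is missing is a multiple of the conjugates of z_i and z_k times z,
    and \<open>c\<close> supplies it.\<close>
  define M where "M = (\<chi> i s. A * F1 * ?V k * kron i s + A * F1 * ?V i * kron k s + c * (?V i * ?V k) * ?W s)"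
  have MH: "(\<^bold>\<Sum>s. M $ i $ s * H s) = A * F1 * ?V k * H i + A * F1 * ?V i * H k + c * (?V i * ?V k) * (\<^bold>\<Sum>s. ?W s * H s)" for i H
  proof -
    have "(\<^bold>\<Sum>s. M $ i $ s * H s) = (\<^bold>\<Sum>s. A * F1 * ?V k * (kron i s * H s) + A * F1 * ?V i * (kron k s * H s) + c * (?V i * ?V k) * (?W s * H s))"
      unfolding M_def by (simp add: algebra_simps)
    thus ?thesis by (simp only: sum.distrib sum_distrib_left[symmetric] sum_kron)
  qed
  have Wg: "(\<^bold>\<Sum>s. ?W s * G z $ s $ q) = (F1 + ?X * F2) * ?W q" for q
  proof -
    have "(\<^bold>\<Sum>s. ?W s * G z $ s $ q) = (\<^bold>\<Sum>s. F1 * (?W s * kron s q) + F2 * ?W q * (?W s * ?V s))"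
      unfolding g by (simp add: algebra_simps)
    also have "\<dots> = F1 * ?W q + F2 * ?W q * ?X"
      by (simp only: sum.distrib sum_distrib_left[symmetric] sum_kron norm2_sum x_def)
    finally show ?thesis by (simp add: algebra_simps)
  qed
  have "mpd G k z $ i $ q = (M ** G z) $ i $ q" for i q
  proof -
    have "(M ** G z) $ i $ q = A * F1 * ?V k * (F1 * kron i q + F2 * (?V i * ?W q)) + A * F1 * ?V i * (F1 * kron k q + F2 * (?V k * ?W q))
        + c * (F1 + ?X * F2) * (?V i * ?V k * ?W q)"
      unfolding matrix_matrix_mult_def using MH[of i "\<lambda>s. G z $ s $ q"] Wg[of q] g by simp
    also have "\<dots> = F2 * (?V k * kron i q) + F3 * (?V k * (?V i * ?W q)) + F2 * (?V i * kron k q)"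
      unfolding cY unfolding F2 F3 by algebra
    finally show ?thesis using mwd_mpd(1)[OF radial_on_mwd[OF R z], of k] by (simp add: F x_def)
  qed
  hence MG: "mpd G k z = M ** G z" unfolding vec_eq_iff by blast
  have inv: "invertible (G z)" unfolding G using radial_matrix_inverse(1)[of f1 z f2] pos unfolding x_def by simp
  have Bl: "mpdbar G l z $ i $ j = F2 * ?W l * kron i j + F3 * ?W l * (?V i * ?W j) + F2 * (kron i l * ?W j)" for i j
    using mwd_mpd(2)[OF radial_on_mwd[OF R z], of l] by (simp add: F x_def kron_sym[of l i])
  have WB: "(\<^bold>\<Sum>s. ?W s * mpdbar G l z $ s $ j) = F2 * (?W l * ?W j) + F3 * (?W l * ?W j) * ?X + F2 * (?W l * ?W j)"
  proof -
    have "(\<^bold>\<Sum>s. ?W s * mpdbar G l z $ s $ j) = (\<^bold>\<Sum>s. F2 * ?W l * (?W s * kron s j)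
        + F3 * (?W l * ?W j) * (?W s * ?V s) + F2 * ?W j * (?W s * kron s l))"
      unfolding Bl by (simp add: algebra_simps)
    also have "\<dots> = F2 * ?W l * ?W j + F3 * (?W l * ?W j) * ?X + F2 * ?W j * ?W l"
      by (simp only: sum.distrib sum_distrib_left[symmetric] sum_kron norm2_sum x_def)
    finally show ?thesis by (simp add: mult_ac)
  qed
  have "mpd G k z ** matrix_inv (G z) ** mpdbar G l z = M ** mpdbar G l z"
    unfolding MG by (simp add: matrix_mul_assoc[symmetric] matrix_inv_right[OF inv])
  hence quad: "(mpd G k z ** matrix_inv (G z) ** mpdbar G l z) $ i $ j =
      A * F1 * ?V k * mpdbar G l z $ i $ j + A * F1 * ?V i * mpdbar G l z $ k $ j
      + c * (?V i * ?V k) * (F2 * (?W l * ?W j) + F3 * (?W l * ?W j) * ?X + F2 * (?W l * ?W j))"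
    unfolding matrix_matrix_mult_def using MH[of i "\<lambda>s. mpdbar G l z $ s $ j"] WB by simp
  obtain b where b: "mwd (mpdbar G l) (\<lambda>k. \<chi> i j.
      (F3 * ?V k * ?W l + F2 * kron k l) * kron i j + F4 * ?V k * (?W l * (?V i * ?W j))
      + F3 * (kron k l * (?V i * ?W j) + ?W l * (?V i * kron k j))
      + kron i l * (F3 * ?V k * ?W j + F2 * kron k j)) b z"
    using radial_on_mwd2[OF R z, of l] unfolding F x_def by blast
  have "curv G i j k l z = (F3 * ?V k * ?W l + F2 * kron k l) * kron i j + F4 * ?V k * (?W l * (?V i * ?W j))
      + F3 * (kron k l * (?V i * ?W j) + ?W l * (?V i * kron k j))
      + kron i l * (F3 * ?V k * ?W j + F2 * kron k j)
      - (A * F1 * ?V k * (F2 * ?W l * kron i j + F3 * ?W l * (?V i * ?W j) + F2 * (kron i l * ?W j))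
       + A * F1 * ?V i * (F2 * ?W l * kron k j + F3 * ?W l * (?V k * ?W j) + F2 * (kron k l * ?W j))
       + c * (?V i * ?V k) * (F2 * (?W l * ?W j) + F3 * (?W l * ?W j) * ?X + F2 * (?W l * ?W j)))"
    unfolding curv_matrix mwd_mpd(1)[OF b] vector_minus_component quad Bl by simp
  thus ?thesis
    unfolding radial_tensor_def g C A_def[symmetric] B_def[symmetric] complex_cnj_cnj
    unfolding F3 F2 using radial_curvature_identity[of F1 B A "?V k" "?W l" "kron k l" "kron i j" F4 "?V i" "?W j" "kron k j" "kron i l" c ?X]
    by simp
qed

lemma radial_on_diff:
  assumes "radial_on G f1 f2 f3 f4 T" "w \<in> T"
  shows "mdiff G w" "mdiff (mpdbar G l) w" "invertible (G w)" "G w $ i $ j = cnj (G w $ j $ i)"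
proof -
  show "mdiff G w" by (rule mwd_mdiff[OF radial_on_mwd[OF assms]])
  show "mdiff (mpdbar G l) w" using radial_on_mwd2[OF assms] mwd_mdiff by blast
  have G: "G w = radial_matrix f1 f2 w" and pos: "f1 ((norm w)\<^sup>2) > 0" "f1 ((norm w)\<^sup>2) + (norm w)\<^sup>2 * f2 ((norm w)\<^sup>2) > 0"
    using assms unfolding radial_on_def by auto
  show "invertible (G w)" unfolding G using radial_matrix_inverse(1)[of f1 w f2] pos by simp
  show "G w $ i $ j = cnj (G w $ j $ i)" unfolding G by (rule radial_matrix_herm)
qed

section \<open>Transport of radial curvature along a holomorphic map\<close>

lemma radial_tensor_pullback:
  fixes P :: "complex^'m::finite^'n::finite"
  shows "(\<^bold>\<Sum>a b c d. P $ i $ a * cnj (P $ j $ b) * (P $ k $ c * cnj (P $ l $ d)) * radial_tensor g \<theta> A B C a b c d) =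
    radial_tensor (\<lambda>i j. \<^bold>\<Sum>a b. P $ i $ a * cnj (P $ j $ b) * g a b) (\<lambda>i. \<^bold>\<Sum>a. P $ i $ a * \<theta> a) A B C i j k l"
proof -
  let ?p = "\<lambda>X i j. \<^bold>\<Sum>a b. P $ i $ a * cnj (P $ j $ b) * X a b"
  let ?N = "\<lambda>a b. \<theta> a * cnj (\<theta> b)"
  have p1: "(\<^bold>\<Sum>a b c d. P $ i $ a * cnj (P $ j $ b) * (P $ k $ c * cnj (P $ l $ d)) * (X a b * Y c d)) =
     ?p X i j * ?p Y k l" for X Y
    by (subst sum4_prod(1)[symmetric]) (simp only: mult_ac)
  have p2: "(\<^bold>\<Sum>a b c d. P $ i $ a * cnj (P $ j $ b) * (P $ k $ c * cnj (P $ l $ d)) * (X a d * Y c b)) =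
     ?p X i l * ?p Y k j" for X Y
    by (subst sum4_prod(2)[symmetric]) (simp only: mult_ac)
  have N: "?p ?N i j = (\<^bold>\<Sum>a. P $ i $ a * \<theta> a) * cnj (\<^bold>\<Sum>a. P $ j $ a * \<theta> a)" for i j
    by (simp add: sum_product mult_ac)
  have "P $ i $ a * cnj (P $ j $ b) * (P $ k $ c * cnj (P $ l $ d)) * radial_tensor g \<theta> A B C a b c d =
     of_real A * (P $ i $ a * cnj (P $ j $ b) * (P $ k $ c * cnj (P $ l $ d)) * (g a b * g c d))
   + of_real A * (P $ i $ a * cnj (P $ j $ b) * (P $ k $ c * cnj (P $ l $ d)) * (g a d * g c b))
   + of_real B * (P $ i $ a * cnj (P $ j $ b) * (P $ k $ c * cnj (P $ l $ d)) * (g a b * ?N c d))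
   + of_real B * (P $ i $ a * cnj (P $ j $ b) * (P $ k $ c * cnj (P $ l $ d)) * (?N a b * g c d))
   + of_real B * (P $ i $ a * cnj (P $ j $ b) * (P $ k $ c * cnj (P $ l $ d)) * (g a d * ?N c b))
   + of_real B * (P $ i $ a * cnj (P $ j $ b) * (P $ k $ c * cnj (P $ l $ d)) * (?N a d * g c b))
   + of_real C * (P $ i $ a * cnj (P $ j $ b) * (P $ k $ c * cnj (P $ l $ d)) * (?N a b * ?N c d))" for a b c d
    unfolding radial_tensor_def by (simp only: distrib_left mult_ac add_ac)
  hence "(\<^bold>\<Sum>a b c d. P $ i $ a * cnj (P $ j $ b) * (P $ k $ c * cnj (P $ l $ d)) * radial_tensor g \<theta> A B C a b c d) =
     of_real A * (?p g i j * ?p g k l) + of_real A * (?p g i l * ?p g k j)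
   + of_real B * (?p g i j * ?p ?N k l) + of_real B * (?p ?N i j * ?p g k l)
   + of_real B * (?p g i l * ?p ?N k j) + of_real B * (?p ?N i l * ?p g k j)
   + of_real C * (?p ?N i j * ?p ?N k l)"
    by (simp only: sum.distrib sum_distrib_left[symmetric] p1[of g g] p2[of g g] p1[of g ?N] p1[of ?N g] p2[of g ?N] p2[of ?N g] p1[of ?N ?N])
  thus ?thesis unfolding N radial_tensor_def by (simp add: algebra_simps)
qed

text \<open>The hypothesis is the relation between the inverse matrices of a metric and of its
  pullback (\<open>matrix_inv_pullback\<close>), so traces may be computed in the radial
  coordinates.\<close>

lemma contract_pullback:
  fixes P :: "complex^'m::finite^'n::finite"
  assumes "adj P ** N' ** P = N"
  shows "(\<^bold>\<Sum>i j. N' $ j $ i * (\<^bold>\<Sum>a b. P $ i $ a * cnj (P $ j $ b) * X a b)) =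
    (\<^bold>\<Sum>a b. N $ b $ a * X a b)"
proof -
  have N: "N $ b $ a = (\<^bold>\<Sum>i j. cnj (P $ j $ b) * N' $ j $ i * P $ i $ a)" for a b
    unfolding assms[symmetric] matrix_matrix_mult_def adj_def by (simp add: sum_distrib_right)
  have "(\<^bold>\<Sum>i j. N' $ j $ i * (\<^bold>\<Sum>a b. P $ i $ a * cnj (P $ j $ b) * X a b)) =
    (\<^bold>\<Sum>i j a b. cnj (P $ j $ b) * N' $ j $ i * P $ i $ a * X a b)"
    by (simp add: sum_distrib_left mult_ac)
  also have "\<dots> = (\<^bold>\<Sum>a b i j. cnj (P $ j $ b) * N' $ j $ i * P $ i $ a * X a b)"
    by (simp only: sum.cartesian_product UNIV_Times_UNIV)
       (rule sum.reindex_bij_witness[where i="\<lambda>(a,b,i,j). (i,j,a,b)" and j="\<lambda>(i,j,a,b). (a,b,i,j)"], auto)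
  finally show ?thesis unfolding N by (simp add: sum_distrib_right)
qed

lemma radial_tensor_herm:
  assumes "\<And>i j. cnj (g i j) = g j i"
  shows "cnj (radial_tensor g \<theta> A B C i j k l) = radial_tensor g \<theta> A B C j i l k"
  unfolding radial_tensor_def by (simp add: assms algebra_simps)

text \<open>Used in two situations: \<open>h\<close> is the transition from an atlas chart to a
  radial chart of the same manifold, or it is a local isometry into a standard manifold read in
  charts. The dimensions of source and target are therefore separate types, and \<open>Q\<close>
  supplies the left inverse of the Jacobian.\<close>

locale radial_pullback =
  fixes S :: "(complex^'n::finite) set" and T :: "(complex^'m::finite) set"
    and h :: "complex^'n \<Rightarrow> complex^'m" and G' :: "'n mfun" and G :: "'m mfun"
    and f1 f2 f3 f4 :: "real \<Rightarrow> real" and Q :: "complex^'n \<Rightarrow> complex^'n^'m"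
  assumes S: "open S" and h: "holo_on h S" and hT: "h ` S \<subseteq> T"
    and rad: "radial_on G f1 f2 f3 f4 T"
    and G'_eq: "\<And>w. w \<in> S \<Longrightarrow> G' w = pullback h G w"
    and Q: "\<And>w. w \<in> S \<Longrightarrow> Q w ** jac h w = mat 1"
    and inv: "\<And>w. w \<in> S \<Longrightarrow> invertible (G' w)"
    and herm: "\<And>w i j. w \<in> S \<Longrightarrow> G' w $ i $ j = cnj (G' w $ j $ i)"
    and diff: "\<And>w. w \<in> S \<Longrightarrow> mdiff G' w"
begin

abbreviation xx :: "complex^'n \<Rightarrow> real" where "xx w \<equiv> (norm (h w))\<^sup>2"

text \<open>The form \<partial>|h|^2, which is the pullback of \<partial>|z|^2; its squared length
  is \<open>tau\<close>.\<close>

definition theta :: "complex^'n \<Rightarrow> 'n \<Rightarrow> complex" where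
  "theta w i = (\<^bold>\<Sum>a. jac h w $ i $ a * cnj (h w $ a))"

abbreviation AA where "AA t \<equiv> radial_A (f1 t) (f2 t)"
abbreviation BB where "BB t \<equiv> radial_B (f1 t) (f2 t) (f3 t)"
abbreviation CC where "CC t \<equiv> radial_C t (f1 t) (f2 t) (f3 t) (f4 t)"

abbreviation tau where "tau t \<equiv> t / (f1 t + t * f2 t)"

lemma in_T: "w \<in> S \<Longrightarrow> h w \<in> T" using hT by blast

lemma G'_nth:
  assumes "w \<in> S"
  shows "G' w $ i $ j = (\<^bold>\<Sum>a b. jac h w $ i $ a * cnj (jac h w $ j $ b) * G (h w) $ a $ b)"
  unfolding G'_eq[OF assms] pullback_def jac_def by simp

lemma curv':
  assumes "w \<in> S"
  shows "curv G' i j k l w = radial_tensor (\<lambda>i j. G' w $ i $ j) (theta w) (AA (xx w)) (BB (xx w)) (CC (xx w)) i j k l"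
proof -
  have "curv G' i j k l w = (\<^bold>\<Sum>a b c d. jac h w $ i $ a * cnj (jac h w $ j $ b) * (jac h w $ k $ c * cnj (jac h w $ l $ d)) * curv G a b c d (h w))"
    by (rule curv_pullback[OF S h assms hT G'_eq radial_on_diff(1,2)[OF rad] Q[OF assms]
          radial_on_diff(3)[OF rad in_T[OF assms]] inv[OF assms]])
  thus ?thesis unfolding curv_radial[OF rad in_T[OF assms]] radial_tensor_pullback
    by (simp only: G'_nth[OF assms] theta_def[abs_def])
qed

lemma inv_pullback:
  assumes "w \<in> S"
  shows "adj (jac h w) ** matrix_inv (G' w) ** jac h w = matrix_inv (G (h w))"
  using matrix_inv_pullback[OF Q[OF assms] radial_on_diff(3)[OF rad in_T[OF assms]]] inv[OF assms]
  unfolding G'_eq[OF assms] pullback_matrix by blast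

lemma hermitian: "w \<in> S \<Longrightarrow> hermitian_metric (\<lambda>i j. G' w $ i $ j) (\<lambda>i j. ginv G' i j w)"
  using hermitian_metricI[of G' w, OF inv herm] .

lemma contract':
  assumes "w \<in> S"
  shows "(\<^bold>\<Sum>i j. ginv G' i j w * (\<^bold>\<Sum>a b. jac h w $ i $ a * cnj (jac h w $ j $ b) * X a b)) =
    (\<^bold>\<Sum>a b. ginv G a b (h w) * X a b)"
  unfolding ginv_def by (rule contract_pullback[OF inv_pullback[OF assms]])

lemma pos:
  assumes "w \<in> S"
  shows "G (h w) = radial_matrix f1 f2 (h w)" "f1 (xx w) > 0" "f1 (xx w) + xx w * f2 (xx w) > 0"
  using rad in_T[OF assms] unfolding radial_on_def by auto

lemma sq_theta:
  assumes "w \<in> S"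
  shows "hermitian_metric.sq (\<lambda>i j. ginv G' i j w) (theta w) = of_real (tau (xx w))"
proof -
  interpret hermitian_metric "\<lambda>i j. G' w $ i $ j" "\<lambda>i j. ginv G' i j w" by (rule hermitian[OF assms])
  have "theta w i * cnj (theta w j) = (\<^bold>\<Sum>a b. jac h w $ i $ a * cnj (jac h w $ j $ b) * (cnj (h w $ a) * h w $ b))" for i j
    unfolding theta_def cnj_sum sum_product by (simp add: mult_ac)
  hence "sq (theta w) = (\<^bold>\<Sum>a b. ginv G a b (h w) * (cnj (h w $ a) * h w $ b))"
    unfolding sq_def using contract'[OF assms] by simp
  also have "\<dots> = of_real (tau (xx w))"
    using radial_contract(1)[of f1 "h w" f2 G] pos[OF assms] by simp
  finally show ?thesis .
qed

lemma lap':
  assumes w: "w \<in> S"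
    and v: "\<And>u. u \<in> T \<Longrightarrow> (v has_real_derivative v1 ((norm u)\<^sup>2)) (at ((norm u)\<^sup>2))"
    and v1: "\<And>u. u \<in> T \<Longrightarrow> (v1 has_real_derivative v2 ((norm u)\<^sup>2)) (at ((norm u)\<^sup>2))"
  shows "lap G' (\<lambda>w. of_real (v (xx w))) w =
     of_real (v1 (xx w) / f1 (xx w) * (CARD('m) - f2 (xx w) * xx w / (f1 (xx w) + xx w * f2 (xx w)))
        + v2 (xx w) * xx w / (f1 (xx w) + xx w * f2 (xx w)))"
proof -
  have T: "open T" using rad unfolding radial_on_def by blast
  have "levi (\<lambda>w. v ((norm (h w))\<^sup>2)) w = pullback h (levi (\<lambda>u. v ((norm u)\<^sup>2))) w"
  proof (rule levi_comp[OF S h T hT w])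
    fix u assume u: "u \<in> T"
    show "(\<lambda>w. complex_of_real (v ((norm w)\<^sup>2))) differentiable (at u)"
      by (rule has_wd_imp_differentiable[OF has_wd_radial[OF v[OF u]]])
    fix j
    have "has_wd (\<lambda>u. of_real (v1 ((norm u)\<^sup>2)) * u $ j)
        (\<lambda>k. of_real (v2 ((norm u)\<^sup>2)) * cnj (u $ k) * u $ j + of_real (v1 ((norm u)\<^sup>2)) * kron k j)
        (\<lambda>k. of_real (v2 ((norm u)\<^sup>2)) * u $ k * u $ j + of_real (v1 ((norm u)\<^sup>2)) * 0) u"
      by (rule has_wd_mult[OF has_wd_radial[OF v1[OF u]] has_wd_kron(1)])
    from has_wd_transform[OF this T u, of "pdbar (\<lambda>w. complex_of_real (v ((norm w)\<^sup>2))) j"]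
    show "pdbar (\<lambda>w. complex_of_real (v ((norm w)\<^sup>2))) j differentiable (at u)"
      by (intro has_wd_imp_differentiable) (simp add: has_wd_pd(2)[OF has_wd_radial[OF v]])
  qed
  moreover have "levi (\<lambda>u. v ((norm u)\<^sup>2)) (h w) = radial_matrix v1 v2 (h w)"
    by (rule levi_radial[OF T in_T[OF w]]) (use v v1 in_T[OF w] in auto)
  ultimately have "levi (\<lambda>w. v ((norm (h w))\<^sup>2)) w $ i $ j =
    (\<^bold>\<Sum>a b. jac h w $ i $ a * cnj (jac h w $ j $ b) * radial_matrix v1 v2 (h w) $ a $ b)" for i j
    unfolding pullback_def jac_def by simp
  hence "pd (pdbar (\<lambda>w. of_real (v (xx w))) j) i w =
    (\<^bold>\<Sum>a b. jac h w $ i $ a * cnj (jac h w $ j $ b) * radial_matrix v1 v2 (h w) $ a $ b)" for i j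
    unfolding levi_def by (simp add: vec_eq_iff)
  hence "lap G' (\<lambda>w. of_real (v (xx w))) w = (\<^bold>\<Sum>a b. ginv G a b (h w) * radial_matrix v1 v2 (h w) $ a $ b)"
    unfolding lap_def using contract'[OF w] by simp
  thus ?thesis using radial_contract(2)[of f1 "h w" f2 G v1 v2] pos[OF w] by simp
qed

context
  fixes \<kappa> :: real
  assumes ke: "\<And>w i j. w \<in> S \<Longrightarrow> ric G' i j w = of_real \<kappa> * G' w $ i $ j"
begin

lemma einstein_tensor:
  assumes "w \<in> S"
  shows "(\<^bold>\<Sum>k l. ginv G' k l w * radial_tensor (\<lambda>i j. G' w $ i $ j) (theta w) (AA (xx w)) (BB (xx w)) (CC (xx w)) i j k l)
    = of_real \<kappa> * G' w $ i $ j"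
  using ke[OF assms, of i j] unfolding ric_def curv'[OF assms] .

lemma norm2_R':
  fixes w defines "\<tau> \<equiv> tau (xx w)"
  assumes "w \<in> S"
  shows "norm2_R G' w = of_real (2 * AA (xx w) * \<kappa> * CARD('n) + 4 * BB (xx w) * \<kappa> * \<tau>
     + CC (xx w) * \<tau>\<^sup>2 * (2 * AA (xx w) + 4 * BB (xx w) * \<tau> + CC (xx w) * \<tau>\<^sup>2))"
proof -
  interpret hermitian_metric "\<lambda>i j. G' w $ i $ j" "\<lambda>i j. ginv G' i j w" by (rule hermitian[OF assms(2)])
  show ?thesis
    unfolding norm2_R_def curv'[OF assms(2)] norm2_radial_tensor[OF einstein_tensor[OF assms(2)]] sq_theta[OF assms(2)] \<tau>_def
    by simp
qed

text \<open>Where \<open>h w = 0\<close> the form \<open>theta\<close> vanishes and the Einstein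
  equation determines \<open>radial_A\<close> alone; hence the exclusion of that point.\<close>

lemma einstein_coefficients:
  assumes "w \<in> S" "CARD('n) \<ge> 2" "h w \<noteq> 0"
  shows "AA (xx w) * (CARD('n) + 1) + BB (xx w) * (tau (xx w)) = \<kappa>"
    and "BB (xx w) * (CARD('n) + 2) + CC (xx w) * (tau (xx w)) = 0"
proof -
  interpret hermitian_metric "\<lambda>i j. G' w $ i $ j" "\<lambda>i j. ginv G' i j w" by (rule hermitian[OF assms(1)])
  let ?t = "tau (xx w)"
  have "sq (theta w) \<noteq> 0" unfolding sq_theta[OF assms(1)] of_real_eq_0_iff
    using pos[OF assms(1)] assms(3) by simp
  note E = einstein_radial_tensor[OF einstein_tensor[OF assms(1)] assms(2) this, unfolded sq_theta[OF assms(1)]]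
  have "complex_of_real (AA (xx w) * (CARD('n) + 1) + BB (xx w) * ?t) = of_real \<kappa>"
    using E(1) by (simp only: of_real_add of_real_mult of_real_of_nat_eq)
  thus "AA (xx w) * (CARD('n) + 1) + BB (xx w) * ?t = \<kappa>" by (simp only: of_real_eq_iff)
  have "complex_of_real (BB (xx w) * (CARD('n) + 2) + CC (xx w) * ?t) = of_real 0"
    using E(2) by simp
  thus "BB (xx w) * (CARD('n) + 2) + CC (xx w) * ?t = 0" by (simp only: of_real_eq_iff)
qed

lemma a3':
  assumes "w \<in> S"
  shows "a3 G' w = (1/48) * (lap G' (norm2_R G') w
     + (2 - of_nat CARD('n)) * of_real \<kappa> * norm2_R G' w - of_nat CARD('n) * (of_nat CARD('n) - 2)\<^sup>2 * of_real \<kappa> ^ 3)"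
proof (rule a3_einstein[OF S assms inv herm diff ke])
  interpret hermitian_metric "\<lambda>i j. G' w $ i $ j" "\<lambda>i j. ginv G' i j w" by (rule hermitian[OF assms])
  show "cnj (curv G' i j k l w) = curv G' j i l k w" for i j k l
    unfolding curv'[OF assms] by (rule radial_tensor_herm) (rule local.herm)
qed

end

end

section \<open>The Einstein equation of a radial potential\<close>

text \<open>The two equations give B \<tau> = -(n + 1) \<delta> and C \<tau>^2 = (n + 1)(n + 2)
  \<delta>. After substitution the terms linear in \<delta> cancel, which leaves a constant and a
  multiple of \<delta>^2.\<close>

lemma norm2_in_defect:
  fixes A B C \<kappa> \<tau> n \<delta> :: real
  assumes "A * (n + 1) + B * \<tau> = \<kappa>" "B * (n + 2) + C * \<tau> = 0" "n + 1 \<noteq> 0" "\<delta> = A - \<kappa> / (n + 1)"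
  shows "2 * A * \<kappa> * n + 4 * B * \<kappa> * \<tau> + C * \<tau>\<^sup>2 * (2 * A + 4 * B * \<tau> + C * \<tau>\<^sup>2) =
    2 * n * \<kappa>\<^sup>2 / (n + 1) + n * (n - 1) * (n + 1) * (n + 2) * \<delta>\<^sup>2"
proof -
  define k where "k = \<kappa> / (n + 1)"
  have kap: "\<kappa> = k * (n + 1)" using assms(3) unfolding k_def by simp
  have A: "A = \<delta> + k" using assms(4) unfolding k_def by simp
  have Bt: "B * \<tau> = - (n + 1) * \<delta>" using assms(1) unfolding A kap by (simp add: algebra_simps)
  have "C * \<tau>\<^sup>2 = - (n + 2) * (B * \<tau>)" using assms(2) unfolding power2_eq_square by (metis add.commute add_eq_0_iff mult.assoc mult.commute mult_minus_left)
  hence Ct: "C * \<tau>\<^sup>2 = (n + 2) * (n + 1) * \<delta>" unfolding Bt by (simp add: algebra_simps)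
  have "2 * n * \<kappa>\<^sup>2 / (n + 1) = 2 * n * k * \<kappa>" unfolding k_def by (simp add: power2_eq_square)
  moreover have "2 * A * \<kappa> * n + 4 * B * \<kappa> * \<tau> + C * \<tau>\<^sup>2 * (2 * A + 4 * B * \<tau> + C * \<tau>\<^sup>2) =
     2 * A * \<kappa> * n + 4 * \<kappa> * (B * \<tau>) + (C * \<tau>\<^sup>2) * (2 * A + 4 * (B * \<tau>) + C * \<tau>\<^sup>2)" by (simp add: algebra_simps)
  ultimately show ?thesis unfolding Ct Bt unfolding A kap by algebra
qed

text \<open>With \<open>y = t f\<^sub>1(t)\<close> the Einstein equation says that \<open>\<delta> y\<^bsup>n+1\<^esup>\<close> is constant, and \<open>a\<^sub>3 = 0\<close> becomes
  a polynomial equation in \<open>1/y\<close> whose coefficient of degree \<open>2n + 3\<close> is a multiple of \<open>\<delta>\<^sup>2\<close>.\<close>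

lemma radial_einstein_a3_zero:
  fixes f1 f2 f3 :: "real \<Rightarrow> real" and n :: nat and \<kappa> :: real
  defines "K \<equiv> real n * (real n - 1) * (real n + 1) * (real n + 2)" and "k \<equiv> \<kappa> / (real n + 1)"
    and "c0 \<equiv> 2 * real n * \<kappa>\<^sup>2 / (real n + 1)"
  assumes I: "open I" "is_interval I" "I \<noteq> {}" "I \<subseteq> {0<..}" and n: "n \<ge> 2"
    and d1: "\<And>t. t \<in> I \<Longrightarrow> (f1 has_real_derivative f2 t) (at t)"
    and d2: "\<And>t. t \<in> I \<Longrightarrow> (f2 has_real_derivative f3 t) (at t)"
    and pos: "\<And>t. t \<in> I \<Longrightarrow> f1 t > 0" "\<And>t. t \<in> I \<Longrightarrow> f1 t + t * f2 t > 0"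
    and E1: "\<And>t. t \<in> I \<Longrightarrow> radial_A (f1 t) (f2 t) * (real n + 1) + radial_B (f1 t) (f2 t) (f3 t) * (t / (f1 t + t * f2 t)) = \<kappa>"
    and E2: "\<And>v1 v2 t. (\<And>t. t \<in> I \<Longrightarrow> ((\<lambda>t. c0 + K * (radial_A (f1 t) (f2 t) - k)\<^sup>2) has_real_derivative v1 t) (at t)) \<Longrightarrow>
       (\<And>t. t \<in> I \<Longrightarrow> (v1 has_real_derivative v2 t) (at t)) \<Longrightarrow> t \<in> I \<Longrightarrow>
       v1 t / f1 t * (real n - f2 t * t / (f1 t + t * f2 t)) + v2 t * t / (f1 t + t * f2 t)
        + (2 - real n) * \<kappa> * (c0 + K * (radial_A (f1 t) (f2 t) - k)\<^sup>2) - real n * (real n - 2)\<^sup>2 * \<kappa> ^ 3 = 0"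
  shows "\<exists>D>0. \<forall>t\<in>I. D - k * t > 0 \<and> f1 t = 1 / (D - k * t)" and "n = 2 \<or> \<kappa> = 0"
proof -
  let ?N = "real n"
  define \<delta> where "\<delta> = (\<lambda>t. radial_A (f1 t) (f2 t) - k)"
  \<comment> \<open>The ratio of the two eigenvalues of the metric: f1 + t f2 = f1 u, and this is
    also y' for y = t f1.\<close>
  define u where "u = (\<lambda>t. 1 + t * f1 t * (\<delta> t + k))"
  \<comment> \<open>\<open>e1\<close> is the derivative of \<delta> that the Einstein equation
    prescribes, namely -(n + 1) \<delta> y'/y, and \<open>e2\<close> is the derivative of
    \<open>e1\<close> after simplification.\<close>
  define e1 where "e1 = (\<lambda>t. - (?N + 1) * \<delta> t * (f1 t + t * f2 t) / (t * f1 t))"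
  define e2 where "e2 = (\<lambda>t. (?N + 1) * \<delta> t * u t * ((?N + 2) * u t / t\<^sup>2 - f1 t * (2 * (\<delta> t + k) - (?N + 1) * \<delta> t) / t))"
  have tpos: "t > 0" if "t \<in> I" for t using that I(4) by auto
  have \<delta>_app: "radial_A (f1 t) (f2 t) - k = \<delta> t" for t unfolding \<delta>_def ..
  have f2: "f2 t = (\<delta> t + k) * (f1 t)\<^sup>2" if "t \<in> I" for t
    unfolding \<delta>_def radial_A_def using pos(1)[OF that] by simp
  have Y: "f1 t + t * f2 t = f1 t * u t" if "t \<in> I" for t
    unfolding f2[OF that] u_def by (simp add: algebra_simps power2_eq_square)
  have upos: "u t > 0" if "t \<in> I" for t
    using pos[OF that] unfolding Y[OF that] by (simp add: zero_less_mult_iff)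
  have e1u: "e1 t = - (?N + 1) * \<delta> t * u t / t" if "t \<in> I" for t
    unfolding e1_def Y[OF that] using pos(1)[OF that] by simp
  have \<kappa>: "\<kappa> = k * (?N + 1)" unfolding k_def by (simp add: field_simps)
  \<comment> \<open>\<open>E1\<close> is solved for B. As B is f1 times the derivative of A, this
    prescribes \<delta>' and eliminates f3.\<close>
  have B: "radial_B (f1 t) (f2 t) (f3 t) = f1 t * e1 t" if "t \<in> I" for t
  proof -
    have "(\<delta> t + k) * (?N + 1) + radial_B (f1 t) (f2 t) (f3 t) * (t / (f1 t * u t)) = k * (?N + 1)"
      using E1[OF that] unfolding Y[OF that] \<kappa>[symmetric] by (simp add: \<delta>_def)
    hence "radial_B (f1 t) (f2 t) (f3 t) * (t / (f1 t * u t)) = - (?N + 1) * \<delta> t" by (simp add: algebra_simps)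
    thus ?thesis unfolding e1u[OF that] using pos(1)[OF that] upos[OF that] tpos[OF that] by (simp add: field_simps)
  qed
  have f3: "f3 t = (f1 t)\<^sup>2 * e1 t + 2 * (\<delta> t + k)\<^sup>2 * (f1 t) ^ 3" if "t \<in> I" for t
  proof -
    have "f3 t = f1 t * radial_B (f1 t) (f2 t) (f3 t) + 2 * (f2 t)\<^sup>2 / f1 t"
      unfolding radial_B_def using pos(1)[OF that] by (simp add: field_simps power2_eq_square)
    thus ?thesis unfolding B[OF that] unfolding f2[OF that] using pos(1)[OF that]
      by (simp add: power2_eq_square power3_eq_cube)
  qed
  have D\<delta>: "(\<delta> has_real_derivative e1 t) (at t)" if "t \<in> I" for t
  proof -
    have "(\<delta> has_real_derivative (f3 t * (f1 t)\<^sup>2 - f2 t * (2 * f1 t * f2 t)) / ((f1 t)\<^sup>2)\<^sup>2) (at t)"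
      unfolding \<delta>_def radial_A_def using d1[OF that] d2[OF that] pos(1)[OF that]
      by (auto intro!: derivative_eq_intros simp: power2_eq_square)
    moreover have "(f3 t * (f1 t)\<^sup>2 - f2 t * (2 * f1 t * f2 t)) / ((f1 t)\<^sup>2)\<^sup>2 = e1 t"
      unfolding f3[OF that] f2[OF that] using pos(1)[OF that]
      by (simp add: field_simps power2_eq_square power3_eq_cube)
    ultimately show ?thesis by simp
  qed
  have De1: "(e1 has_real_derivative e2 t) (at t)" if "t \<in> I" for t
  proof -
    have "(e1 has_real_derivative (- (?N + 1) * (e1 t * (f1 t + t * f2 t) + \<delta> t * (2 * f2 t + t * f3 t)) * (t * f1 t)
        - (- (?N + 1) * \<delta> t * (f1 t + t * f2 t)) * (f1 t + t * f2 t)) / (t * f1 t)\<^sup>2) (at t)"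
      by (subst e1_def)
        (use d1[OF that] d2[OF that] D\<delta>[OF that] pos(1)[OF that] tpos[OF that] in
          \<open>auto intro!: derivative_eq_intros simp: power2_eq_square algebra_simps\<close>)
    moreover have "(- (?N + 1) * (e1 t * (f1 t + t * f2 t) + \<delta> t * (2 * f2 t + t * f3 t)) * (t * f1 t)
        - (- (?N + 1) * \<delta> t * (f1 t + t * f2 t)) * (f1 t + t * f2 t)) / (t * f1 t)\<^sup>2 = e2 t"
    proof -
      have Y': "2 * f2 t + t * f3 t = (f1 t)\<^sup>2 * u t * (2 * (\<delta> t + k) - (?N + 1) * \<delta> t)"
        unfolding f3[OF that] f2[OF that] e1u[OF that] using tpos[OF that]
        by (simp add: u_def) (simp add: field_simps power2_eq_square power3_eq_cube)
      show ?thesis unfolding Y' Y[OF that] e2_def e1u[OF that] using pos(1)[OF that] tpos[OF that]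
        by (simp add: divide_simps) (simp add: algebra_simps power2_eq_square)
    qed
    ultimately show ?thesis by simp
  qed
  \<comment> \<open>The Laplacian of \<delta>^2 leaves only multiples of u/y, \<delta> and k inside
    the bracket. Since u/y = 1/y + \<delta> + k, the outcome is polynomial in \<delta> and
    1/y.\<close>
  have ode: "K * (2 * (?N + 1) * (\<delta> t)\<^sup>2 * ((?N + 3) / (t * f1 t) + (?N + 2) * k + (2 * ?N + 3) * \<delta> t))
      + (2 - ?N) * \<kappa> * (c0 + K * (\<delta> t)\<^sup>2) - ?N * (?N - 2)\<^sup>2 * \<kappa> ^ 3 = 0" if t: "t \<in> I" for t
  proof -
    have "K * (2 * \<delta> t * e1 t) / f1 t * (?N - f2 t * t / (f1 t + t * f2 t))
        + K * (2 * (e1 t * e1 t + \<delta> t * e2 t)) * t / (f1 t + t * f2 t)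
        + (2 - ?N) * \<kappa> * (c0 + K * (\<delta> t)\<^sup>2) - ?N * (?N - 2)\<^sup>2 * \<kappa> ^ 3 = 0"
    proof (rule E2[unfolded \<delta>_app, OF _ _ t])
      fix t assume "t \<in> I"
      show "((\<lambda>t. c0 + K * (\<delta> t)\<^sup>2) has_real_derivative K * (2 * \<delta> t * e1 t)) (at t)"
        using D\<delta>[OF \<open>t \<in> I\<close>] by (auto intro!: derivative_eq_intros)
      show "((\<lambda>t. K * (2 * \<delta> t * e1 t)) has_real_derivative K * (2 * (e1 t * e1 t + \<delta> t * e2 t))) (at t)"
        using D\<delta>[OF \<open>t \<in> I\<close>] De1[OF \<open>t \<in> I\<close>] by (auto intro!: derivative_eq_intros simp: algebra_simps)
    qed
    moreover have "K * (2 * \<delta> t * e1 t) / f1 t * (?N - f2 t * t / (f1 t + t * f2 t))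
        + K * (2 * (e1 t * e1 t + \<delta> t * e2 t)) * t / (f1 t + t * f2 t) =
       K * (2 * (?N + 1) * (\<delta> t)\<^sup>2 * ((?N + 3) / (t * f1 t) + (?N + 2) * k + (2 * ?N + 3) * \<delta> t))"
    proof -
      have a: "f2 t * t / (f1 t + t * f2 t) = (\<delta> t + k) * (t * f1 t) / u t"
        unfolding Y[OF t] unfolding f2[OF t] using pos(1)[OF t] by (simp add: power2_eq_square)
      have b: "K * (2 * \<delta> t * e1 t) / f1 t * (?N - (\<delta> t + k) * (t * f1 t) / u t) =
         - K * 2 * (\<delta> t)\<^sup>2 * (?N + 1) * (?N * u t / (t * f1 t) - (\<delta> t + k))"
        unfolding e1u[OF t] using pos(1)[OF t] tpos[OF t] upos[OF t]
        by (simp add: divide_simps) (simp add: algebra_simps power2_eq_square)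
      have c: "K * (2 * (e1 t * e1 t + \<delta> t * e2 t)) * t / (f1 t * u t) =
         K * 2 * (\<delta> t)\<^sup>2 * (?N + 1) * ((2 * ?N + 3) * u t / (t * f1 t) - (2 * (\<delta> t + k) - (?N + 1) * \<delta> t))"
        unfolding e1u[OF t] e2_def using pos(1)[OF t] tpos[OF t] upos[OF t]
        by (simp add: divide_simps) (simp add: algebra_simps power2_eq_square)
      show ?thesis unfolding a b unfolding Y[OF t] c
        using pos(1)[OF t] tpos[OF t] by (simp add: u_def divide_simps) (simp add: algebra_simps power2_eq_square)
    qed
    ultimately show ?thesis by simp
  qed
  have y: "((\<lambda>t. t * f1 t) has_real_derivative f1 t * u t) (at t)" if "t \<in> I" for t
    using d1[OF that] Y[OF that] by (auto intro!: derivative_eq_intros simp: mult.commute)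
  have ypos: "t * f1 t > 0" if "t \<in> I" for t using pos(1)[OF that] tpos[OF that] by simp
  have conv: "convex I" using I(2) by (simp add: is_interval_convex)
  have seg: "{a..b} \<subseteq> I" if "a \<in> I" "b \<in> I" for a b
    using I(2) that unfolding is_interval_1 by (meson atLeastAtMost_iff subsetI)
  obtain c where c: "\<And>t. t \<in> I \<Longrightarrow> \<delta> t * (t * f1 t) ^ (n + 1) = c"
  proof -
    have "((\<lambda>t. \<delta> t * (t * f1 t) ^ (n + 1)) has_real_derivative 0) (at t within I)" if "t \<in> I" for t
    proof (rule has_field_derivative_at_within)
      have "((\<lambda>t. \<delta> t * (t * f1 t) ^ (n + 1)) has_real_derivative
          e1 t * (t * f1 t) ^ (n + 1) + \<delta> t * (real (n + 1) * (t * f1 t) ^ n * (f1 t * u t))) (at t)"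
        using DERIV_mult[OF D\<delta>[OF that] DERIV_power[OF y[OF that], of "n + 1"]]
        by (simp add: mult_ac del: power_mult_distrib)
      moreover have "e1 t * (t * f1 t) ^ (n + 1) + \<delta> t * (real (n + 1) * (t * f1 t) ^ n * (f1 t * u t)) = 0"
        unfolding e1u[OF that] using tpos[OF that] by (simp add: field_simps)
      ultimately show "((\<lambda>t. \<delta> t * (t * f1 t) ^ (n + 1)) has_real_derivative 0) (at t)" by simp
    qed
    from has_field_derivative_zero_constant[OF conv this] that show ?thesis by blast
  qed
  have c0: "c = 0"
  proof (rule ccontr)
    assume "c \<noteq> 0"
    \<comment> \<open>\<open>ode\<close> with s = 1/y and \<delta> = c s^(n+1): the monomials come
      from \<delta>^2 s, \<delta>^2, \<delta>^3 and the constant. As n > 0, the degrees 2n + 3 and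
      3n + 3 differ, so nothing cancels the first coefficient.\<close>
    define p where "p = monom (K * (2 * (?N + 1) * c\<^sup>2 * (?N + 3))) (2 * n + 3)
       + monom (K * (2 * (?N + 1) * c\<^sup>2 * ((?N + 2) * k)) + (2 - ?N) * \<kappa> * K * c\<^sup>2) (2 * n + 2)
       + monom (K * (2 * (?N + 1) * c\<^sup>2 * ((2 * ?N + 3) * c))) (3 * n + 3)
       + [:(2 - ?N) * \<kappa> * c0 - ?N * (?N - 2)\<^sup>2 * \<kappa> ^ 3:]"
    have "coeff p (2 * n + 3) = K * (2 * (?N + 1) * c\<^sup>2 * (?N + 3))"
      using n unfolding p_def by (simp add: coeff_pCons split: nat.split)
    moreover have "K > 0" unfolding K_def using n by simp
    ultimately have "p \<noteq> 0" using \<open>c \<noteq> 0\<close> by (metis coeff_0 add_nonneg_pos mult_eq_0_iff of_nat_0_le_iff order_less_irrefl power_not_zero zero_less_numeral zero_less_one)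
    hence fin: "finite {s. poly p s = 0}" by (rule poly_roots_finite)
    have root: "poly p (1 / (t * f1 t)) = 0" if "t \<in> I" for t
    proof -
      define s where "s = 1 / (t * f1 t)"
      define q where "q = s ^ (n + 1)"
      have nz: "(t * f1 t) ^ (n + 1) \<noteq> 0" using zero_less_power[OF ypos[OF that], of "n + 1"] by linarith
      have "\<delta> t = c / (t * f1 t) ^ (n + 1)" by (simp only: nonzero_eq_divide_eq[OF nz] c[OF that])
      hence \<delta>: "\<delta> t = c * q" by (simp only: q_def s_def power_one_over times_divide_eq_right mult_1_right)
      have s: "(?N + 3) / (t * f1 t) = (?N + 3) * s" by (simp add: s_def)
      have pw: "s ^ (2 * n + 3) = q\<^sup>2 * s" "s ^ (2 * n + 2) = q\<^sup>2" "s ^ (3 * n + 3) = q ^ 3"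
      proof -
        have "q\<^sup>2 = s ^ ((n + 1) * 2)" "q ^ 3 = s ^ ((n + 1) * 3)" unfolding q_def power_mult by simp_all
        moreover have "(n + 1) * 2 = 2 * n + 2" "(n + 1) * 3 = 3 * n + 3" "2 * n + 3 = Suc (2 * n + 2)" by simp_all
        ultimately show "s ^ (2 * n + 3) = q\<^sup>2 * s" "s ^ (2 * n + 2) = q\<^sup>2" "s ^ (3 * n + 3) = q ^ 3"
          by (simp_all only: power_Suc2)
      qed
      from ode[OF that, unfolded \<delta> s]
      have "poly p s = 0" unfolding p_def poly_add poly_monom pw by simp algebra
      thus "poly p (1 / (t * f1 t)) = 0" unfolding s_def .
    qed
    \<comment> \<open>y' = f1 u is positive, so 1/y is injective on the infinite set
      \<open>I\<close>, while all its values are roots of \<open>p\<close>.\<close>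
    have mono: "a * f1 a < b * f1 b" if "a \<in> I" "b \<in> I" "a < b" for a b
    proof (rule DERIV_pos_imp_increasing[OF that(3), of "\<lambda>t. t * f1 t"])
      fix t assume "a \<le> t" "t \<le> b"
      hence "t \<in> I" using seg[OF that(1,2)] by auto
      thus "\<exists>y. ((\<lambda>t. t * f1 t) has_real_derivative y) (at t) \<and> 0 < y"
        using y pos(1) upos by (meson mult_pos_pos)
    qed
    have "inj_on (\<lambda>t. 1 / (t * f1 t)) I"
    proof (rule inj_onI)
      fix a b assume "a \<in> I" "b \<in> I" "1 / (a * f1 a) = 1 / (b * f1 b)"
      hence "a * f1 a = b * f1 b" by simp
      thus "a = b" using mono \<open>a \<in> I\<close> \<open>b \<in> I\<close> by (metis less_irrefl linorder_neqE_linordered_idom)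
    qed
    moreover have "(\<lambda>t. 1 / (t * f1 t)) ` I \<subseteq> {s. poly p s = 0}" using root by blast
    ultimately have "finite I" using fin by (meson finite_imageD finite_subset)
    thus False using I(1,3) finite_imp_not_open by blast
  qed
  have \<delta>0: "\<delta> t = 0" if "t \<in> I" for t using c[OF that] ypos[OF that] unfolding c0 by auto
  \<comment> \<open>\<delta> = 0 means f2 = k f1^2, that is, 1/f1 has derivative -k.\<close>
  obtain D where D: "\<And>t. t \<in> I \<Longrightarrow> 1 / f1 t + k * t = D"
  proof -
    have "((\<lambda>t. 1 / f1 t + k * t) has_real_derivative 0) (at t within I)" if "t \<in> I" for t
    proof (rule has_field_derivative_at_within)
      show "((\<lambda>t. 1 / f1 t + k * t) has_real_derivative 0) (at t)"
        using d1[OF that] pos(1)[OF that] f2[OF that] \<delta>0[OF that]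
        by (auto intro!: derivative_eq_intros simp: power2_eq_square)
    qed
    from has_field_derivative_zero_constant[OF conv this] that show ?thesis by blast
  qed
  have f1: "f1 t = 1 / (D - k * t)" "D - k * t > 0" if "t \<in> I" for t
  proof -
    have "D - k * t = 1 / f1 t" using D[OF that] by simp
    thus "f1 t = 1 / (D - k * t)" "D - k * t > 0" using pos(1)[OF that] by simp_all
  qed
  obtain t where t: "t \<in> I" using I(3) by blast
  \<comment> \<open>The sign of the integration constant comes from the positivity of
    \<open>u\<close>.\<close>
  have "u t = D * f1 t"
    unfolding u_def \<delta>0[OF t] using f1[OF t] by (simp add: field_simps)
  hence "D > 0" using upos[OF t] pos(1)[OF t] by (simp add: zero_less_mult_iff)
  thus "\<exists>D>0. \<forall>t\<in>I. D - k * t > 0 \<and> f1 t = 1 / (D - k * t)" using f1 by blast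
  show "n = 2 \<or> \<kappa> = 0"
  proof -
    have "(2 - ?N) * \<kappa> * c0 - ?N * (?N - 2)\<^sup>2 * \<kappa> ^ 3 = 0" using ode[OF t] unfolding \<delta>0[OF t] by simp
    \<comment> \<open>With \<delta> = 0 only the constant term of \<open>ode\<close> remains. It is
      split so that the last factor, containing 2/(n + 1) + n - 2, is visibly positive for n \<ge>
      2.\<close>
    hence "(2 - ?N) * \<kappa> ^ 3 * (?N * (2 / (?N + 1) + (?N - 2))) = 0"
    proof -
      define q where "q = 2 / (?N + 1)"
      have "c0 = ?N * \<kappa>\<^sup>2 * q" unfolding c0_def q_def by simp
      with \<open>(2 - ?N) * \<kappa> * c0 - ?N * (?N - 2)\<^sup>2 * \<kappa> ^ 3 = 0\<close> show ?thesis
        unfolding q_def[symmetric] by algebra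
    qed
    moreover have "?N * (2 / (?N + 1) + (?N - 2)) > 0" using n
      by (intro mult_pos_pos add_pos_nonneg) auto
    ultimately show ?thesis using n by auto
  qed
qed

section \<open>Charts and local isometries\<close>

lemma jac_comp:
  assumes "\<And>a. hol (\<lambda>w. h w $ a) z" "\<And>b. hol (\<lambda>w. k w $ b) (h z)"
  shows "jac (k \<circ> h) z = jac h z ** jac k (h z)"
proof -
  have "jac (k \<circ> h) z $ i $ j = (jac h z ** jac k (h z)) $ i $ j" for i j
    using has_wd_pd(1)[OF has_wd_comp[OF assms(2)[of j, unfolded hol_def] assms(1)], of i]
    unfolding jac_def matrix_matrix_mult_def by (simp add: mult.commute)
  thus ?thesis by (simp add: vec_eq_iff)
qed

lemma jac_cong:
  assumes "open S" "z \<in> S" "\<And>w. w \<in> S \<Longrightarrow> f w = g w"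
  shows "jac f z = jac g z"
proof -
  have "pd (\<lambda>w. f w $ a) i z = pd (\<lambda>w. g w $ a) i z" for a i
    by (rule pd_cong_open(1)[OF assms(1,2)]) (simp add: assms(3))
  thus ?thesis unfolding jac_def by simp
qed

lemma jac_id: "jac (\<lambda>z. z) z = mat 1"
  by (auto simp: jac_def mat_def vec_eq_iff has_wd_pd(1)[OF has_wd_coord])

lemma adj_mult: "adj (A ** B) = adj B ** adj A"
  by (simp add: adj_def matrix_matrix_mult_def vec_eq_iff mult.commute)

lemma pullback_cong:
  assumes "open S" "z \<in> S" "\<And>w. w \<in> S \<Longrightarrow> f w = g w"
  shows "pullback f H z = pullback g H z"
  unfolding pullback_matrix using jac_cong[OF assms] assms(2,3) by simp

lemma pullback_comp:
  assumes "\<And>a. hol (\<lambda>w. h w $ a) z" "\<And>b. hol (\<lambda>w. k w $ b) (h z)"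
  shows "pullback (k \<circ> h) H z = pullback h (pullback k H) z"
  unfolding pullback_matrix jac_comp[OF assms] by (simp add: adj_mult matrix_mul_assoc)

lemma pullback_cong_metric: "H (h z) = H' (h z) \<Longrightarrow> pullback h H z = pullback h H' z"
  unfolding pullback_def by simp

lemma pullback_id: "pullback (\<lambda>z. z) H z = H z"
proof -
  have "adj (mat 1 :: complex^'a^'a) = mat 1" by (auto simp: adj_def mat_def vec_eq_iff)
  thus ?thesis unfolding pullback_matrix jac_id by simp
qed

text \<open>P Q and Q P have the same trace. This is how equal dimension of isometric manifolds is
  read off when the two index types differ.\<close>

lemma card_eq_of_inverse:
  fixes P :: "complex^'m::finite^'n::finite"
  assumes "P ** Q = mat 1" "Q ** P = mat 1"
  shows "CARD('n) = CARD('m)"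
proof -
  have "complex_of_nat CARD('n) = (\<^bold>\<Sum>i. (P ** Q) $ i $ i)" unfolding assms by (simp add: mat_def)
  also have "\<dots> = (\<^bold>\<Sum>a. (Q ** P) $ a $ a)"
    unfolding matrix_matrix_mult_def by (simp add: mult.commute) (rule sum.swap)
  also have "\<dots> = of_nat CARD('m)" unfolding assms by (simp add: mat_def)
  finally show ?thesis by (simp only: of_nat_eq_iff)
qed

lemma jac_inverse:
  assumes "open S" "holo_on h S" "open (h ` S)" "holo_on k (h ` S)" "\<And>w. w \<in> S \<Longrightarrow> k (h w) = w" "z \<in> S"
  shows "jac h z ** jac k (h z) = mat 1" "jac k (h z) ** jac h z = mat 1"
proof -
  have h: "hol (\<lambda>w. h w $ a) z" for a using assms(1,2,6) holo_on_iff by blast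
  have k: "hol (\<lambda>w. k w $ a) (h z)" for a using assms(3,4,6) holo_on_iff by blast
  have "jac (k \<circ> h) z = jac (\<lambda>z. z) z" by (rule jac_cong[OF assms(1,6)]) (simp add: assms(5))
  thus "jac h z ** jac k (h z) = mat 1" unfolding jac_comp[OF h k] jac_id .
  have h': "hol (\<lambda>w. h w $ a) (k (h z))" for a using h assms(5,6) by simp
  have "jac (h \<circ> k) (h z) = jac (\<lambda>z. z) (h z)"
    by (rule jac_cong[OF assms(3)]) (use assms(5,6) in auto)
  thus "jac k (h z) ** jac h z = mat 1" unfolding jac_comp[OF k h'] jac_id using assms(5,6) by simp
qed

lemma posdef_invertible:
  fixes G :: "complex^'n::finite^'n"
  assumes "\<And>v. v \<noteq> 0 \<Longrightarrow> 0 < Re (\<^bold>\<Sum>i j. G $ i $ j * v $ i * cnj (v $ j))"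
  shows "invertible G"
  unfolding invertible_left_inverse matrix_left_invertible_ker
proof (intro allI impI)
  fix x assume x: "G *v x = 0"
  show "x = 0"
  proof (rule ccontr)
    assume "x \<noteq> 0"
    \<comment> \<open>The form conjugates its second argument, so the conjugate of a kernel vector
      is the vector on which it vanishes.\<close>
    define v where "v = (\<chi> i. cnj (x $ i))"
    have "v \<noteq> 0" using \<open>x \<noteq> 0\<close> by (simp add: v_def vec_eq_iff)
    moreover have "(\<^bold>\<Sum>i j. G $ i $ j * v $ i * cnj (v $ j)) = (\<^bold>\<Sum>i. v $ i * (G *v x) $ i)"
      unfolding matrix_vector_mult_def v_def by (simp add: sum_distrib_left mult_ac)
    ultimately show False using assms[of v] x by simp
  qed
qed

section \<open>Charts as homeomorphisms onto open sets\<close>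

locale chart =
  fixes T :: "'a topology" and c :: "('a, 'n::finite) chart"
  assumes chart: "is_chart T c"
begin

lemma inj: "inj_on (snd c) (fst c)"
proof -
  have "fst c \<subseteq> topspace T" using chart unfolding is_chart_def by (blast dest: openin_subset)
  thus ?thesis using chart homeomorphic_imp_injective_map unfolding is_chart_def by (metis topspace_subtopology_subset)
qed

lemma cinv_snd: "p \<in> fst c \<Longrightarrow> cinv c (snd c p) = p"
  unfolding cinv_def using inj by simp

lemma snd_cinv: "z \<in> snd c ` fst c \<Longrightarrow> snd c (cinv c z) = z"
  unfolding cinv_def by (rule f_inv_into_f)

lemma cinv_in: "z \<in> snd c ` fst c \<Longrightarrow> cinv c z \<in> fst c"
  unfolding cinv_def by (rule inv_into_into)

lemma open_image:
  assumes "openin T W" "W \<subseteq> fst c"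
  shows "open (snd c ` W)"
proof -
  have "openin (subtopology T (fst c)) W" using assms openin_subtopology_Int2 by (metis inf.absorb_iff2 openin_subtopology)
  hence "openin (top_of_set (snd c ` fst c)) (snd c ` W)"
    using chart homeomorphic_imp_open_map unfolding is_chart_def open_map_def by blast
  thus ?thesis using chart unfolding is_chart_def by (simp add: openin_open_eq)
qed

lemma open_preimage:
  assumes "open O'" "O' \<subseteq> snd c ` fst c"
  shows "openin T (cinv c ` O')"
proof -
  have "continuous_map (subtopology T (fst c)) (top_of_set (snd c ` fst c)) (snd c)"
    using chart homeomorphic_imp_continuous_map unfolding is_chart_def by blast
  moreover have "openin (top_of_set (snd c ` fst c)) O'" using assms chart unfolding is_chart_def by (simp add: openin_open_eq)
  ultimately have "openin (subtopology T (fst c)) {p \<in> topspace (subtopology T (fst c)). snd c p \<in> O'}"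
    by (rule openin_continuous_map_preimage)
  moreover have "{p \<in> topspace (subtopology T (fst c)). snd c p \<in> O'} = cinv c ` O'"
  proof -
    have "fst c \<subseteq> topspace T" using chart unfolding is_chart_def by (blast dest: openin_subset)
    hence top: "topspace (subtopology T (fst c)) = fst c" by (rule topspace_subtopology_subset)
    show ?thesis unfolding top
    proof (intro set_eqI iffI)
      fix p assume "p \<in> {p \<in> fst c. snd c p \<in> O'}"
      thus "p \<in> cinv c ` O'" using cinv_snd[of p] by (metis (mono_tags, lifting) image_eqI mem_Collect_eq)
    next
      fix p assume "p \<in> cinv c ` O'"
      then obtain z where "z \<in> O'" "p = cinv c z" by blast
      thus "p \<in> {p \<in> fst c. snd c p \<in> O'}" using assms(2) snd_cinv[of z] cinv_in[of z] by auto
    qed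
  qed
  ultimately have "openin (subtopology T (fst c)) (cinv c ` O')" by simp
  moreover have "openin T (fst c)" using chart unfolding is_chart_def by blast
  ultimately show ?thesis using openin_trans_full by blast
qed

lemma open_range: "open (snd c ` fst c)" and openin_dom: "openin T (fst c)"
  using chart unfolding is_chart_def by blast+

end

lemma transition_snd:
  assumes "is_chart T c" "p \<in> fst c"
  shows "transition c d (snd c p) = snd d p"
proof -
  interpret chart T c by standard fact
  show ?thesis unfolding transition_def using cinv_snd[OF assms(2)] by simp
qed

lemma holo_transition:
  assumes "compatible c d"
  shows "holo_on (transition c d) (snd c ` (fst c \<inter> fst d))"
  using assms unfolding compatible_def by blast

lemma kaehler_manifoldD:
  assumes "kaehler_manifold X" "c \<in> atlas X"
  shows "is_chart (under X) c"
    and "z \<in> snd c ` fst c \<Longrightarrow> invertible (gmat X c z)"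
    and "z \<in> snd c ` fst c \<Longrightarrow> gmat X c z $ i $ j = cnj (gmat X c z $ j $ i)"
    and "z \<in> snd c ` fst c \<Longrightarrow> mdiff (gmat X c) z"
    and "z \<in> snd c ` fst c \<Longrightarrow> v \<noteq> 0 \<Longrightarrow> 0 < Re (\<^bold>\<Sum>i j. gmat X c z $ i $ j * v $ i * cnj (v $ j))"
proof -
  show "is_chart (under X) c" using assms unfolding kaehler_manifold_def complex_manifold_def by blast
  show p: "0 < Re (\<^bold>\<Sum>i j. gmat X c z $ i $ j * v $ i * cnj (v $ j))" if "z \<in> snd c ` fst c" "v \<noteq> 0" for v z
    using assms that unfolding kaehler_manifold_def by blast
  show "invertible (gmat X c z)" if "z \<in> snd c ` fst c"
    by (rule posdef_invertible[OF p[OF that]])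
  show "gmat X c z $ i $ j = cnj (gmat X c z $ j $ i)" if "z \<in> snd c ` fst c"
    using assms that unfolding kaehler_manifold_def by blast
  show "mdiff (gmat X c) z" if "z \<in> snd c ` fst c"
    unfolding mdiff_def
  proof (intro allI)
    fix i j
    have "smooth_on (\<lambda>z. gmat X c z $ i $ j) (snd c ` fst c)"
      using assms unfolding kaehler_manifold_def by blast
    hence "Ck_on (Suc 0) (\<lambda>z. gmat X c z $ i $ j) (snd c ` fst c)" unfolding smooth_on_def by blast
    thus "(\<lambda>z. gmat X c z $ i $ j) differentiable (at z)" using that by auto
  qed
qed

text \<open>The condition on the profile under which the curvature tensor is \<open>\<mu> (g\<^bsub>ij*\<^esub> g\<^bsub>kl*\<^esub> + g\<^bsub>il*\<^esub> g\<^bsub>kj*\<^esub>)\<close>.\<close>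

definition constant_curvature :: "real \<Rightarrow> (real \<Rightarrow> real) \<Rightarrow> (real \<Rightarrow> real) \<Rightarrow> (real \<Rightarrow> real) \<Rightarrow> (real \<Rightarrow> real) \<Rightarrow> real \<Rightarrow> bool" where
  "constant_curvature \<mu> f1 f2 f3 f4 t \<longleftrightarrow> radial_A (f1 t) (f2 t) = \<mu> \<and> radial_B (f1 t) (f2 t) (f3 t) = 0 \<and>
     radial_C t (f1 t) (f2 t) (f3 t) (f4 t) = 0"

text \<open>The properties of a target manifold from which the vanishing of \<open>a3\<close> is
  deduced: a cover by charts in which the metric is radial with one common curvature constant \<mu>.
  No complex structure or gluing enters, since a single chart is used at each point.\<close>

definition model :: "real \<Rightarrow> ('b, 'm::finite) hmfd \<Rightarrow> bool" where
  "model \<mu> Y \<longleftrightarrow> topspace (under Y) \<subseteq> (\<Union>d\<in>atlas Y. fst d) \<and>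
     (\<forall>d\<in>atlas Y. is_chart (under Y) d \<and> (\<exists>f1 f2 f3 f4. radial_on (gmat Y d) f1 f2 f3 f4 (snd d ` fst d) \<and>
       (\<forall>w\<in>snd d ` fst d. constant_curvature \<mu> f1 f2 f3 f4 ((norm w)\<^sup>2))))"

text \<open>In charts the isometry is a \<open>radial_pullback\<close>, so the square norm of the
  curvature is the constant 2 \<mu> \<kappa> n and its Laplacian vanishes. The remaining terms of
  \<open>a3\<close> vanish for n = 2 because of the factors 2 - n, and for \<mu> = 0 because then
  \<kappa> = 0.\<close>

lemma a3_vanishes_of_model:
  fixes X :: "('a, 'n::finite) hmfd" and Y :: "('b, 'm::finite) hmfd"
  assumes X: "kaehler_manifold X" "kaehler_einstein X"
    and Y: "model \<mu> Y" "\<mu> = 0 \<or> CARD('m) = 2"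
    and iso: "locally_biholomorphically_isometric X Y"
  shows "a3_vanishes X"
  unfolding a3_vanishes_def
proof (intro ballI)
  fix c z assume c: "c \<in> atlas X" and z: "z \<in> snd c ` fst c"
  obtain \<kappa> where \<kappa>: "\<And>c z i j. c \<in> atlas X \<Longrightarrow> z \<in> snd c ` fst c \<Longrightarrow> ric (gmat X c) i j z = complex_of_real \<kappa> * gmat X c z $ i $ j"
    using X(2) unfolding kaehler_einstein_def by blast
  interpret c: chart "under X" c by standard (rule kaehler_manifoldD(1)[OF X(1) c])
  define p where "p = cinv c z"
  have p: "p \<in> fst c" "snd c p = z" unfolding p_def using z c.cinv_in c.snd_cinv by auto
  have "p \<in> topspace (under X)" using p(1) c.openin_dom by (blast dest: openin_subset)
  then obtain V W F where pV: "p \<in> V" and F: "biholomorphic_isometry X Y V W F"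
    using iso unfolding locally_biholomorphically_isometric_def by blast
  have VW: "openin (under X) V" "openin (under Y) W"
    and hom: "homeomorphic_map (subtopology (under X) V) (subtopology (under Y) W) F"
    using F unfolding biholomorphic_isometry_def by blast+
  have tops: "topspace (subtopology (under X) V) = V" "topspace (subtopology (under Y) W) = W"
    using VW by (auto simp: topspace_subtopology dest: openin_subset)
  have FV: "F ` V = W" using homeomorphic_imp_surjective_map[OF hom] unfolding tops .
  have injF: "inj_on F V" using homeomorphic_imp_injective_map[OF hom] unfolding tops .
  have "F p \<in> topspace (under Y)" using pV FV VW(2) by (blast dest: openin_subset)
  then obtain d where d: "d \<in> atlas Y" "F p \<in> fst d" using Y(1) unfolding model_def by blast
  interpret d: chart "under Y" d by standard (use Y(1) d in \<open>simp add: model_def\<close>)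
  define S where "S = {p \<in> V \<inter> fst c. F p \<in> fst d}"
  define f where "f = snd d \<circ> F \<circ> cinv c"
  define k where "k = snd c \<circ> inv_into V F \<circ> cinv d"
  have fh: "holo_on f (snd c ` S)" and kh: "holo_on k (snd d ` F ` S)"
    and G: "\<And>z. z \<in> snd c ` S \<Longrightarrow> gmat X c z = pullback f (gmat Y d) z"
    using F c d(1) unfolding biholomorphic_isometry_def Let_def S_def f_def k_def by blast+
  have SV: "openin (under X) S"
  proof -
    have "continuous_map (subtopology (under X) V) (subtopology (under Y) W) F"
      by (rule homeomorphic_imp_continuous_map[OF hom])
    moreover have "openin (subtopology (under Y) W) (W \<inter> fst d)" using d.openin_dom by (simp add: openin_subtopology_Int2)
    ultimately have "openin (subtopology (under X) V) {x \<in> topspace (subtopology (under X) V). F x \<in> W \<inter> fst d}"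
      by (rule openin_continuous_map_preimage)
    hence "openin (under X) {x \<in> V. F x \<in> W \<inter> fst d}" unfolding tops using VW(1) openin_trans_full by blast
    hence "openin (under X) ({x \<in> V. F x \<in> W \<inter> fst d} \<inter> fst c)" using c.openin_dom by blast
    moreover have "{x \<in> V. F x \<in> W \<inter> fst d} \<inter> fst c = S" using FV unfolding S_def by blast
    ultimately show ?thesis by simp
  qed
  have FS: "openin (under Y) (F ` S)"
  proof -
    have "openin (subtopology (under X) V) S" using SV unfolding S_def by (simp add: openin_subset_topspace_eq openin_open_subtopology VW(1) subset_eq)
    hence "openin (subtopology (under Y) W) (F ` S)" using homeomorphic_imp_open_map[OF hom] unfolding open_map_def by blast
    thus ?thesis using VW(2) openin_trans_full by blast
  qed
  have Sc: "S \<subseteq> fst c" "F ` S \<subseteq> fst d" unfolding S_def by auto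
  have f: "f (snd c q) = snd d (F q)" if "q \<in> S" for q
    unfolding f_def using that c.cinv_snd Sc by auto
  have im: "f ` snd c ` S = snd d ` F ` S" by (force simp: f image_image)
  have kf: "k (f w) = w" if "w \<in> snd c ` S" for w
  proof -
    from that obtain q where q: "q \<in> S" "w = snd c q" by blast
    have "k (f w) = snd c (inv_into V F (F q))" unfolding q f[OF q(1)] k_def using q(1) Sc(2) by (simp add: d.cinv_snd image_subset_iff)
    thus ?thesis using q injF unfolding S_def by simp
  qed
  have oS: "open (snd c ` S)" by (rule c.open_image[OF SV Sc(1)])
  have oFS: "open (f ` snd c ` S)" unfolding im by (rule d.open_image[OF FS Sc(2)])
  have kh': "holo_on k (f ` snd c ` S)" unfolding im by (rule kh)
  have fT: "f ` snd c ` S \<subseteq> snd d ` fst d" unfolding im using Sc(2) by blast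
  obtain f1 f2 f3 f4 where rad: "radial_on (gmat Y d) f1 f2 f3 f4 (snd d ` fst d)"
    and \<mu>: "\<And>w. w \<in> snd d ` fst d \<Longrightarrow> constant_curvature \<mu> f1 f2 f3 f4 ((norm w)\<^sup>2)"
    using Y(1) d(1) unfolding model_def by metis
  have zS: "z \<in> snd c ` S" using p pV d(2) unfolding S_def by blast
  have sub: "w \<in> snd c ` fst c" if "w \<in> snd c ` S" for w using that Sc(1) by blast
  note ji = jac_inverse[OF oS fh oFS kh' kf]
  interpret R: radial_pullback "snd c ` S" "snd d ` fst d" f "gmat X c" "gmat Y d" f1 f2 f3 f4 "\<lambda>w. jac k (f w)"
  proof
    fix w assume w: "w \<in> snd c ` S"
    show "gmat X c w = pullback f (gmat Y d) w" by (rule G[OF w])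
    show "jac k (f w) ** jac f w = mat 1" using ji(2)[OF _ w] by blast
    show "invertible (gmat X c w)" by (rule kaehler_manifoldD(2)[OF X(1) c sub[OF w]])
    show "mdiff (gmat X c) w" by (rule kaehler_manifoldD(4)[OF X(1) c sub[OF w]])
    show "gmat X c w $ i $ j = cnj (gmat X c w $ j $ i)" for i j
      by (rule kaehler_manifoldD(3)[OF X(1) c sub[OF w]])
  qed (rule oS fh fT rad)+
  have card: "CARD('n) = CARD('m)" using card_eq_of_inverse[OF ji[OF _ zS]] by blast
  have ke: "ric (gmat X c) i j w = of_real \<kappa> * gmat X c w $ i $ j" if "w \<in> snd c ` S" for w i j
    by (rule \<kappa>[OF c sub[OF that]])
  have \<mu>': "radial_A (f1 (R.xx w)) (f2 (R.xx w)) = \<mu>" "radial_B (f1 (R.xx w)) (f2 (R.xx w)) (f3 (R.xx w)) = 0"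
     "radial_C (R.xx w) (f1 (R.xx w)) (f2 (R.xx w)) (f3 (R.xx w)) (f4 (R.xx w)) = 0" if "w \<in> snd c ` S" for w
    using \<mu>[of "f w"] fT that unfolding constant_curvature_def by blast+
  have nR: "norm2_R (gmat X c) w = of_real (2 * \<mu> * \<kappa> * CARD('n))" if "w \<in> snd c ` S" for w
    by (subst R.norm2_R'[OF ke that]) (simp_all add: \<mu>'[OF that])
  have "pdbar (norm2_R (gmat X c)) j w = 0" if "w \<in> snd c ` S" for j w
    using pd_const_on(2)[OF oS that, of "norm2_R (gmat X c)"] nR by blast
  hence "pd (pdbar (norm2_R (gmat X c)) j) i z = 0" for i j
    using pd_const_on(1)[OF oS zS, of "pdbar (norm2_R (gmat X c)) j"] by blast
  hence lap: "lap (gmat X c) (norm2_R (gmat X c)) z = 0" unfolding lap_def by simp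
  have a3: "a3 (gmat X c) z = (1/48) * ((2 - of_nat CARD('n)) * of_real \<kappa> * of_real (2 * \<mu> * \<kappa> * CARD('n))
     - of_nat CARD('n) * (of_nat CARD('n) - 2)\<^sup>2 * of_real \<kappa> ^ 3)"
    by (subst R.a3'[OF ke zS]) (simp_all add: lap nR[OF zS])
  show "a3 (gmat X c) z = 0"
  proof (cases "CARD('m) = 2")
    case True
    thus ?thesis unfolding a3 card by simp
  next
    case False
    \<comment> \<open>All three coefficients of the curvature are now zero, so the Ricci contraction
      vanishes while the metric does not, which forces \<kappa> = 0.\<close>
    hence "\<mu> = 0" using Y(2) by blast
    interpret H: hermitian_metric "\<lambda>i j. gmat X c z $ i $ j" "\<lambda>i j. ginv (gmat X c) i j z" by (rule R.hermitian[OF zS])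
    have "of_real \<kappa> * gmat X c z $ i $ j = 0" for i j
    proof -
      have "(\<^bold>\<Sum>k l. ginv (gmat X c) k l z * radial_tensor (\<lambda>i j. gmat X c z $ i $ j) (R.theta z) 0 0 0 i j k l)
          = of_real \<kappa> * gmat X c z $ i $ j"
        using R.einstein_tensor[OF ke zS, of i j] \<mu>'[OF zS] \<open>\<mu> = 0\<close> by simp
      thus ?thesis unfolding H.ricci_radial_tensor by simp
    qed
    moreover have "\<exists>i j. gmat X c z $ i $ j \<noteq> 0"
      using H.inv1[of undefined undefined] by (metis (no_types, lifting) mult_zero_right sum.neutral zero_neq_one)
    ultimately have "\<kappa> = 0" by auto
    thus ?thesis unfolding a3 by simp
  qed
qed

text \<open>The chart \<open>c\<close> need not belong to the atlas, so no coefficient matrix is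
  attached to it; \<open>H\<close> takes that role, and \<open>m1\<close> says that it represents
  the metric near \<open>p\<close>. The isometry is \<open>A\<close> read through \<open>c\<close>
  and \<open>e\<close>, and in any other pair of charts it differs from \<open>A\<close> by
  transition maps, which are holomorphic and respect the metrics.\<close>

lemma biholomorphic_isometry_from_chart:
  fixes X :: "('a, 'n::finite) hmfd" and Y :: "('b, 'm::finite) hmfd" and A :: "complex^'n \<Rightarrow> complex^'m"
  assumes X: "\<And>c'. c' \<in> atlas X \<Longrightarrow> is_chart (under X) c'"
    and c: "holomorphic_chart X c" and p: "p \<in> fst c" "snd c p \<in> B"
    and B: "open B" "B \<subseteq> snd c ` fst c"
    and Y: "\<And>d. d \<in> atlas Y \<Longrightarrow> is_chart (under Y) d"
      "\<And>d d'. d \<in> atlas Y \<Longrightarrow> d' \<in> atlas Y \<Longrightarrow> compatible d d'"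
      "\<And>d d' z. d \<in> atlas Y \<Longrightarrow> d' \<in> atlas Y \<Longrightarrow> z \<in> snd d ` (fst d \<inter> fst d') \<Longrightarrow>
          gmat Y d z = pullback (transition d d') (gmat Y d') z"
    and e: "e \<in> atlas Y"
    and A: "holo_on A UNIV" "holo_on A' UNIV" "\<And>w. A' (A w) = w" "\<And>u. A (A' u) = u" "A ` B \<subseteq> snd e ` fst e"
    and m1: "\<And>c' z. c' \<in> atlas X \<Longrightarrow> z \<in> snd c' ` (fst c' \<inter> fst c) \<Longrightarrow> transition c' c z \<in> B \<Longrightarrow>
        gmat X c' z = pullback (transition c' c) H z"
    and m2: "\<And>w. w \<in> B \<Longrightarrow> H w = pullback A (gmat Y e) w"
  shows "\<exists>V W F. p \<in> V \<and> biholomorphic_isometry X Y V W F"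
proof -
  have cc: "is_chart (under X) c" and ccomp: "\<And>c'. c' \<in> atlas X \<Longrightarrow> compatible c c'"
    using c unfolding holomorphic_chart_def by blast+
  have ccomp': "compatible c' c" if "c' \<in> atlas X" for c' using ccomp[OF that] unfolding compatible_def
    by (simp add: Int_commute)
  interpret c: chart "under X" c by standard (rule cc)
  interpret e: chart "under Y" e by standard (rule Y(1)[OF e])
  define V where "V = cinv c ` B"
  define F where "F = cinv e \<circ> A \<circ> snd c"
  define W where "W = cinv e ` A ` B"
  \<comment> \<open>Images under \<open>A\<close> are preimages under its inverse, so openness of
    \<open>A\<close> is continuity of \<open>A'\<close>, and conversely.\<close>
  have AB: "A ` U = A' -` U" for U by (auto simp: A(3)) (metis A(4) image_eqI)
  have contA': "continuous_on UNIV A'" by (rule holo_on_imp_continuous_on[OF A(2)])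
  have contA: "continuous_on UNIV A" by (rule holo_on_imp_continuous_on[OF A(1)])
  have openA: "open (A ` U)" if "open U" for U
    unfolding AB using that contA' by (simp add: continuous_on_open_vimage)
  have A'B: "A' ` U = A -` U" for U by (auto simp: A(4)) (metis A(3) image_eqI)
  have openA': "open (A' ` U)" if "open U" for U
    unfolding A'B using that contA by (simp add: continuous_on_open_vimage)
  have Vc: "V \<subseteq> fst c" unfolding V_def using B(2) c.cinv_in by blast
  have sV: "snd c q \<in> B" if "q \<in> V" for q using that B(2) c.snd_cinv unfolding V_def by auto
  have Vopen: "openin (under X) V" unfolding V_def by (rule c.open_preimage[OF B])
  have Wopen: "openin (under Y) W" unfolding W_def by (rule e.open_preimage[OF openA[OF B(1)] A(5)])
  have Fe: "F q \<in> fst e" "snd e (F q) = A (snd c q)" if "q \<in> V" for q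
    using sV[OF that] A(5) e.cinv_in e.snd_cinv unfolding F_def by auto
  have FV: "F ` V = W"
  proof -
    have "snd c ` V = B" unfolding V_def using B(2) c.snd_cinv by (force simp: image_image)
    thus ?thesis unfolding F_def W_def by (metis image_comp)
  qed
  have injF: "inj_on F V"
  proof (rule inj_onI)
    fix q r assume q: "q \<in> V" "r \<in> V" "F q = F r"
    hence "A (snd c q) = A (snd c r)" using Fe(2) by metis
    hence "snd c q = snd c r" using A(3) by metis
    thus "q = r" using c.inj q Vc by (meson inj_onD subsetD)
  qed
  have Fopen: "openin (under Y) (F ` U)" if "openin (under X) U" "U \<subseteq> V" for U
  proof -
    have "F ` U = cinv e ` (A ` (snd c ` U))" unfolding F_def by (simp add: image_comp)
    moreover have "A ` (snd c ` U) \<subseteq> snd e ` fst e" using that(2) sV A(5) by blast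
    ultimately show ?thesis using e.open_preimage[OF openA[OF c.open_image[OF that(1)]]] that(2) Vc by auto
  qed
  have Fcont: "openin (under X) {q \<in> V. F q \<in> U}" if "openin (under Y) U" for U
  proof -
    have "{q \<in> V. F q \<in> U} = cinv c ` (B \<inter> A' ` (snd e ` (U \<inter> fst e)))"
    proof (intro set_eqI iffI)
      fix q assume "q \<in> {q \<in> V. F q \<in> U}"
      hence q: "q \<in> V" "F q \<in> U" by auto
      have "snd c q = A' (snd e (F q))" using Fe(2)[OF q(1)] A(3) by simp
      moreover have "q = cinv c (snd c q)" using q Vc c.cinv_snd by auto
      ultimately show "q \<in> cinv c ` (B \<inter> A' ` (snd e ` (U \<inter> fst e)))"
        using q Fe(1)[OF q(1)] sV[OF q(1)] by blast
    next
      fix q assume "q \<in> cinv c ` (B \<inter> A' ` (snd e ` (U \<inter> fst e)))"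
      then obtain w u where w: "q = cinv c w" "w \<in> B" "w = A' (snd e u)" "u \<in> U" "u \<in> fst e" by blast
      have "q \<in> V" using w unfolding V_def by blast
      moreover have "F q = u"
      proof -
        have "snd c q = w" using w(1,2) B(2) c.snd_cinv by blast
        thus ?thesis unfolding F_def using w(3,5) A(4) e.cinv_snd by simp
      qed
      ultimately show "q \<in> {q \<in> V. F q \<in> U}" using w by blast
    qed
    moreover have "B \<inter> A' ` (snd e ` (U \<inter> fst e)) \<subseteq> snd c ` fst c" using B(2) by blast
    moreover have "openin (under Y) (U \<inter> fst e)" using that e.openin_dom by blast
    hence "open (B \<inter> A' ` (snd e ` (U \<inter> fst e)))"
      using B(1) openA'[OF e.open_image] by blast
    ultimately show ?thesis using c.open_preimage[of "B \<inter> A' ` (snd e ` (U \<inter> fst e))"] by (simp only:)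
  qed
  have tops: "topspace (subtopology (under X) V) = V" "topspace (subtopology (under Y) W) = W"
    using Vopen Wopen by (auto simp: topspace_subtopology dest: openin_subset)
  have hom: "homeomorphic_map (subtopology (under X) V) (subtopology (under Y) W) F"
  proof (rule bijective_open_imp_homeomorphic_map)
    show "continuous_map (subtopology (under X) V) (subtopology (under Y) W) F"
      unfolding continuous_map_alt tops
    proof (intro conjI allI impI)
      show "F \<in> V \<rightarrow> W" using FV by blast
      fix U assume "openin (subtopology (under Y) W) U"
      hence "openin (under Y) U" using Wopen openin_trans_full by blast
      from Fcont[OF this] have "openin (subtopology (under X) V) {q \<in> V. F q \<in> U}"
        by (simp add: openin_open_subtopology Vopen)
      moreover have "{q \<in> V. F q \<in> U} = F -` U \<inter> V" by blast
      ultimately show "openin (subtopology (under X) V) (F -` U \<inter> V)" by simp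
    qed
    show "open_map (subtopology (under X) V) (subtopology (under Y) W) F"
      unfolding open_map_def
    proof (intro allI impI)
      fix U assume U: "openin (subtopology (under X) V) U"
      hence "openin (under X) U" "U \<subseteq> V" using Vopen openin_trans_full openin_subset tops(1) by blast+
      from Fopen[OF this] FV \<open>U \<subseteq> V\<close> show "openin (subtopology (under Y) W) (F ` U)"
        by (auto simp: openin_open_subtopology Wopen)
    qed
    show "F ` topspace (subtopology (under X) V) = topspace (subtopology (under Y) W)" unfolding tops by (rule FV)
    show "inj_on F (topspace (subtopology (under X) V))" unfolding tops by (rule injF)
  qed
  have hA: "hol (\<lambda>w. A w $ a) z" for a z using A(1) holo_on_iff[OF open_UNIV] by blast
  have local: "holo_on (snd d \<circ> F \<circ> cinv c') (snd c' ` {q \<in> V \<inter> fst c'. F q \<in> fst d}) \<and>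
     holo_on (snd c' \<circ> inv_into V F \<circ> cinv d) (snd d ` F ` {q \<in> V \<inter> fst c'. F q \<in> fst d}) \<and>
     (\<forall>z\<in>snd c' ` {q \<in> V \<inter> fst c'. F q \<in> fst d}. gmat X c' z = pullback (snd d \<circ> F \<circ> cinv c') (gmat Y d) z)"
    if c': "c' \<in> atlas X" and d: "d \<in> atlas Y" for c' d
  proof -
    interpret c': chart "under X" c' by standard (rule X[OF c'])
    interpret d: chart "under Y" d by standard (rule Y(1)[OF d])
    define S where "S = {q \<in> V \<inter> fst c'. F q \<in> fst d}"
    define f where "f = snd d \<circ> F \<circ> cinv c'"
    have "S = {q \<in> V. F q \<in> fst d} \<inter> fst c'" unfolding S_def by blast
    hence So: "openin (under X) S" using Fcont[OF d.openin_dom] c'.openin_dom by auto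
    have SV: "S \<subseteq> V" "S \<subseteq> fst c'" "F ` S \<subseteq> fst d" unfolding S_def by auto
    have oS: "open (snd c' ` S)" by (rule c'.open_image[OF So SV(2)])
    have oFS: "open (snd d ` F ` S)" by (rule d.open_image[OF Fopen[OF So SV(1)] SV(3)])
    have fq: "f (snd c' q) = snd d (F q)" if "q \<in> S" for q
      unfolding f_def using that SV c'.cinv_snd by auto
    have t1: "transition c' c (snd c' q) = snd c q" if "q \<in> S" for q
      by (rule transition_snd[OF X[OF c']]) (use that SV in blast)
    have t2: "transition e d (A (snd c q)) = snd d (F q)" if "q \<in> S" for q
    proof -
      have "q \<in> V" using that SV by blast
      from transition_snd[OF Y(1)[OF e] Fe(1)[OF this]] show ?thesis unfolding Fe(2)[OF \<open>q \<in> V\<close>] .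
    qed
    \<comment> \<open>Transition, then \<open>A\<close>, then transition: holomorphy and the metric
      identity below are read off from this factorisation.\<close>
    have feq: "f w = (transition e d \<circ> (A \<circ> transition c' c)) w" if "w \<in> snd c' ` S" for w
      using that fq t1 t2 by auto
    have h1: "holo_on (transition c' c) (snd c' ` S)"
      by (rule holo_on_subset[OF holo_transition[OF ccomp'[OF c']]]) (use SV Vc in blast)
    have h2: "holo_on (transition e d) (A ` snd c ` S)"
    proof (rule holo_on_subset[OF holo_transition[OF Y(2)[OF e d]]])
      show "A ` snd c ` S \<subseteq> snd e ` (fst e \<inter> fst d)"
      proof
        fix u assume "u \<in> A ` snd c ` S"
        then obtain q where q: "q \<in> S" "u = A (snd c q)" by blast
        hence "q \<in> V" using SV by blast
        from Fe[OF this] q SV(3) show "u \<in> snd e ` (fst e \<inter> fst d)" by (metis IntI image_eqI image_subset_iff)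
      qed
    qed
    have h12: "holo_on (A \<circ> transition c' c) (snd c' ` S)"
      by (rule holo_on_compose[OF h1 A(1)]) simp
    have im: "(A \<circ> transition c' c) ` snd c' ` S = A ` snd c ` S" using t1 by (force simp: image_image)
    have "holo_on (transition e d \<circ> (A \<circ> transition c' c)) (snd c' ` S)"
      by (rule holo_on_compose[OF h12 h2]) (simp only: im order_refl)
    hence H1: "holo_on f (snd c' ` S)" using holo_on_cong[OF oS, of f "transition e d \<circ> (A \<circ> transition c' c)"] feq by blast
    define k where "k = snd c' \<circ> inv_into V F \<circ> cinv d"
    have kq: "k (snd d (F q)) = snd c' q" if "q \<in> S" for q
    proof -
      have "cinv d (snd d (F q)) = F q" using that SV(3) by (intro d.cinv_snd) blast
      thus ?thesis unfolding k_def using that SV(1) injF by (simp add: subset_iff)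
    qed
    have t3: "transition d e (snd d (F q)) = A (snd c q)" if "q \<in> S" for q
    proof -
      have "F q \<in> fst d" "q \<in> V" using that SV by blast+
      thus ?thesis using transition_snd[OF Y(1)[OF d], of "F q" e] Fe(2)[of q] by simp
    qed
    have t4: "transition c c' (snd c q) = snd c' q" if "q \<in> S" for q
      by (rule transition_snd[OF cc]) (use that SV Vc in blast)
    have keq: "k u = (transition c c' \<circ> (A' \<circ> transition d e)) u" if "u \<in> snd d ` F ` S" for u
      using that kq t3 t4 A(3) by auto
    have k1: "holo_on (transition d e) (snd d ` F ` S)"
      by (rule holo_on_subset[OF holo_transition[OF Y(2)[OF d e]]]) (use SV Fe(1) in blast)
    have k12: "holo_on (A' \<circ> transition d e) (snd d ` F ` S)"
      by (rule holo_on_compose[OF k1 A(2)]) simp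
    have k2: "holo_on (transition c c') (snd c ` S)"
      by (rule holo_on_subset[OF holo_transition[OF ccomp[OF c']]]) (use SV Vc in blast)
    have "(A' \<circ> transition d e) ` snd d ` F ` S \<subseteq> snd c ` S" using t3 A(3) by auto
    from holo_on_compose[OF k12 k2 this] have H2: "holo_on k (snd d ` F ` S)"
      using holo_on_cong[OF oFS, of k "transition c c' \<circ> (A' \<circ> transition d e)"] keq by blast
    have H3: "gmat X c' z = pullback f (gmat Y d) z" if z: "z \<in> snd c' ` S" for z
    proof -
      obtain q where q: "q \<in> S" "z = snd c' q" using z by blast
      have qV: "q \<in> V" and qc: "q \<in> fst c' \<inter> fst c" using q SV Vc by auto
      have hol1: "hol (\<lambda>w. transition c' c w $ a) z" for a
        using h1 z holo_on_iff[OF oS] by blast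
      have oB: "open (A ` snd c ` S)" by (rule openA[OF c.open_image[OF So]]) (use SV Vc in blast)
      have hol2: "hol (\<lambda>w. transition e d w $ b) ((A \<circ> transition c' c) z)" for b
        using h2 t1[OF q(1)] q holo_on_iff[OF oB] by auto
      have hol12: "hol (\<lambda>w. (A \<circ> transition c' c) w $ a) z" for a
        using h12 z holo_on_iff[OF oS] by blast
      have tz: "transition c' c z = snd c q" using t1[OF q(1)] q(2) by simp
      have "gmat X c' z = pullback (transition c' c) H z"
        by (rule m1[OF c']) (use q qc sV[OF qV] t1[OF q(1)] in auto)
      also have "\<dots> = pullback (transition c' c) (pullback A (gmat Y e)) z"
        by (rule pullback_cong_metric) (use m2[OF sV[OF qV]] tz in simp)
      also have "\<dots> = pullback (A \<circ> transition c' c) (gmat Y e) z"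
        by (rule pullback_comp[symmetric, OF hol1 hA])
      also have "\<dots> = pullback (A \<circ> transition c' c) (pullback (transition e d) (gmat Y d)) z"
      proof (rule pullback_cong_metric, rule Y(3)[OF e d])
        show "(A \<circ> transition c' c) z \<in> snd e ` (fst e \<inter> fst d)"
          using Fe[OF qV] q SV(3) tz by (metis IntI comp_apply image_eqI image_subset_iff)
      qed
      also have "\<dots> = pullback (transition e d \<circ> (A \<circ> transition c' c)) (gmat Y d) z"
        by (rule pullback_comp[symmetric, OF hol12 hol2])
      also have "\<dots> = pullback f (gmat Y d) z"
        using pullback_cong[OF oS z, of f "transition e d \<circ> (A \<circ> transition c' c)"] feq by metis
      finally show ?thesis .
    qed
    show ?thesis using H1 H2 H3 unfolding S_def f_def k_def by blast
  qed
  have "p \<in> V" unfolding V_def using p c.cinv_snd by (metis image_eqI)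
  moreover have "biholomorphic_isometry X Y V W F"
    unfolding biholomorphic_isometry_def Let_def using Vopen Wopen hom local by blast
  ultimately show ?thesis by blast
qed

section \<open>The standard metrics\<close>

text \<open>The space forms of curvature parameter \<open>\<epsilon>\<close>: potential \<open>ln (1 + \<epsilon> |z|\<^sup>2) / \<epsilon>\<close>, or \<open>|z|\<^sup>2\<close> if \<open>\<epsilon> = 0\<close>.\<close>

definition space_form :: "real \<Rightarrow> complex^'n::finite \<Rightarrow> complex^'n^'n" where
  "space_form \<epsilon> = radial_matrix (\<lambda>t. 1 / (1 + \<epsilon> * t)) (\<lambda>t. - \<epsilon> / (1 + \<epsilon> * t)\<^sup>2)"

lemma space_form_radial:
  assumes T: "open T" "\<And>w. w \<in> T \<Longrightarrow> 1 + \<epsilon> * (norm w)\<^sup>2 > 0" and r: "r > 0"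
    and G: "\<And>w. w \<in> T \<Longrightarrow> G w = r *\<^sub>R space_form \<epsilon> w"
  shows "\<exists>f1 f2 f3 f4. radial_on G f1 f2 f3 f4 T \<and>
       (\<forall>w\<in>T. constant_curvature (- \<epsilon> / r) f1 f2 f3 f4 ((norm w)\<^sup>2))"
proof -
  \<comment> \<open>Since q' = -\<epsilon> q^2, all derivatives of the profile are multiples of
    powers of \<open>q\<close>, and f1 + t f2 = r q^2.\<close>
  define q where "q = (\<lambda>t. 1 / (1 + \<epsilon> * t))"
  define f1 f2 f3 f4 where "f1 = (\<lambda>t. r * q t)" and "f2 = (\<lambda>t. r * (- \<epsilon> * (q t)\<^sup>2))"
    and "f3 = (\<lambda>t. r * (2 * \<epsilon>\<^sup>2 * q t ^ 3))" and "f4 = (\<lambda>t. r * (- 6 * \<epsilon> ^ 3 * q t ^ 4))"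
  note f_defs = this
  have q2: "- \<epsilon> / (1 + \<epsilon> * t)\<^sup>2 = - \<epsilon> * (q t)\<^sup>2" for t unfolding q_def by (simp add: power_one_over power_divide)
  have "G w = radial_matrix f1 f2 w" if "w \<in> T" for w
    unfolding G[OF that] space_form_def vec_eq_iff q2
    by (simp add: radial_matrix_nth f_defs q_def[symmetric]) (simp add: scaleR_conv_of_real algebra_simps)
  moreover have "(f1 has_real_derivative f2 t) (at t)" "(f2 has_real_derivative f3 t) (at t)"
     "(f3 has_real_derivative f4 t) (at t)" if "1 + \<epsilon> * t > 0" for t
  proof -
    have q: "(q has_real_derivative - \<epsilon> * (q t)\<^sup>2) (at t)"
      unfolding q_def using that by (auto intro!: derivative_eq_intros simp: power2_eq_square)
    show "(f1 has_real_derivative f2 t) (at t)" "(f2 has_real_derivative f3 t) (at t)"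
     "(f3 has_real_derivative f4 t) (at t)"
      unfolding f_defs using q
      by (auto intro!: derivative_eq_intros simp: power2_eq_square power3_eq_cube power4_eq_xxxx)
  qed
  moreover have "f1 t > 0" "f1 t + t * f2 t > 0" if "1 + \<epsilon> * t > 0" for t
  proof -
    show "f1 t > 0" unfolding f_defs q_def using that r by simp
    have q: "q t > 0" "q t * (1 + \<epsilon> * t) = 1" unfolding q_def using that by simp_all
    have "f1 t + t * f2 t = r * q t * (q t * (1 + \<epsilon> * t)) - \<epsilon> * r * t * (q t)\<^sup>2"
      unfolding q(2) unfolding f_defs by simp
    also have "\<dots> = r * (q t)\<^sup>2" by (simp add: algebra_simps power2_eq_square)
    finally have "f1 t + t * f2 t = r * (q t)\<^sup>2" .
    thus "f1 t + t * f2 t > 0" using q(1) r by simp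
  qed
  ultimately have "radial_on G f1 f2 f3 f4 T" unfolding radial_on_def using T by blast
  moreover have "radial_A (f1 t) (f2 t) = - \<epsilon> / r" "radial_B (f1 t) (f2 t) (f3 t) = 0"
     "radial_C t (f1 t) (f2 t) (f3 t) (f4 t) = 0" if "1 + \<epsilon> * t > 0" for t
  proof -
    have nz: "1 + \<epsilon> * t \<noteq> 0" using that by simp
    have q: "q t \<noteq> 0" unfolding q_def using nz by simp
    have f: "f1 t = r * q t" "f2 t = - r * \<epsilon> * (q t)\<^sup>2" "f3 t = 2 * r * \<epsilon>\<^sup>2 * q t ^ 3" "f4 t = - 6 * r * \<epsilon> ^ 3 * q t ^ 4"
      unfolding f_defs by simp_all
    show "radial_A (f1 t) (f2 t) = - \<epsilon> / r" unfolding radial_A_def f using r q by (simp add: power2_eq_square)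
    show B: "radial_B (f1 t) (f2 t) (f3 t) = 0" unfolding radial_B_def f using r q
      by (simp add: field_simps power2_eq_square power3_eq_cube)
    show "radial_C t (f1 t) (f2 t) (f3 t) (f4 t) = 0" unfolding radial_C_def B unfolding f using r q
      by (simp add: field_simps power2_eq_square power3_eq_cube power4_eq_xxxx)
  qed
  ultimately show ?thesis unfolding constant_curvature_def using T(2) by blast
qed

lemma open_pos_set: "open {w :: complex^'n::finite. 1 + \<epsilon> * (norm w)\<^sup>2 > 0}"
  by (intro open_Collect_less continuous_intros)

lemma levi_space_form:
  assumes "\<epsilon> \<noteq> 0" "1 + \<epsilon> * (norm z)\<^sup>2 > 0"
  shows "levi (\<lambda>w. ln (1 + \<epsilon> * (norm w)\<^sup>2) / \<epsilon>) z = space_form \<epsilon> z"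
  unfolding space_form_def
proof (rule levi_radial[OF open_pos_set[of \<epsilon>], of _ "\<lambda>t. ln (1 + \<epsilon> * t) / \<epsilon>"])
  show "((\<lambda>t. ln (1 + \<epsilon> * t) / \<epsilon>) has_real_derivative 1 / (1 + \<epsilon> * (norm w)\<^sup>2)) (at ((norm w)\<^sup>2))"
    if "w \<in> {w. 1 + \<epsilon> * (norm w)\<^sup>2 > 0}" for w :: "complex^'a"
  proof -
    have "((\<lambda>t. ln (1 + \<epsilon> * t) / \<epsilon>) has_real_derivative 1 / (1 + \<epsilon> * (norm w)\<^sup>2) * \<epsilon> / \<epsilon>) (at ((norm w)\<^sup>2))"
      using that by (auto intro!: derivative_eq_intros)
    thus ?thesis using assms(1) by simp
  qed
  show "((\<lambda>t. 1 / (1 + \<epsilon> * t)) has_real_derivative - \<epsilon> / (1 + \<epsilon> * (norm z)\<^sup>2)\<^sup>2) (at ((norm z)\<^sup>2))"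
    using assms by (auto intro!: derivative_eq_intros simp: power2_eq_square)
qed (use assms in simp)

text \<open>The common description of the three target spaces. Every chart carries the same matrix
  function, which holds for the affine charts of the projective plane by their symmetry.\<close>

definition standard_manifold :: "real \<Rightarrow> ('b, 'm::finite) hmfd \<Rightarrow> bool" where
  "standard_manifold \<epsilon> Y \<longleftrightarrow> topspace (under Y) \<subseteq> (\<Union>d\<in>atlas Y. fst d) \<and>
     (\<forall>d\<in>atlas Y. is_chart (under Y) d \<and> (\<forall>z\<in>snd d ` fst d. 1 + \<epsilon> * (norm z)\<^sup>2 > 0 \<and> gmat Y d z = space_form \<epsilon> z)) \<and>
     (\<forall>d\<in>atlas Y. \<forall>d'\<in>atlas Y. compatible d d' \<and>
        (\<forall>z\<in>snd d ` (fst d \<inter> fst d'). gmat Y d z = pullback (transition d d') (gmat Y d') z))"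

lemma rescale_simps [simp]: "under (rescale r Y) = under Y" "atlas (rescale r Y) = atlas Y"
  "gmat (rescale r Y) d z = r *\<^sub>R gmat Y d z"
  unfolding rescale_def by simp_all

lemma model_of_standard:
  assumes "standard_manifold \<epsilon> Y" "r > 0"
  shows "model (- \<epsilon> / r) (rescale r Y)"
proof -
  have "is_chart (under Y) d \<and> (\<exists>f1 f2 f3 f4. radial_on (gmat (rescale r Y) d) f1 f2 f3 f4 (snd d ` fst d) \<and>
       (\<forall>w\<in>snd d ` fst d. constant_curvature (- \<epsilon> / r) f1 f2 f3 f4 ((norm w)\<^sup>2)))"
    if d: "d \<in> atlas Y" for d
  proof
    show c: "is_chart (under Y) d" using assms(1) d unfolding standard_manifold_def by blast
    show "\<exists>f1 f2 f3 f4. radial_on (gmat (rescale r Y) d) f1 f2 f3 f4 (snd d ` fst d) \<and>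
       (\<forall>w\<in>snd d ` fst d. constant_curvature (- \<epsilon> / r) f1 f2 f3 f4 ((norm w)\<^sup>2))"
    proof (rule space_form_radial[OF _ _ assms(2)])
      show "open (snd d ` fst d)" using c unfolding is_chart_def by blast
      fix z assume z: "z \<in> snd d ` fst d"
      have "0 < 1 + \<epsilon> * (norm z)\<^sup>2 \<and> gmat Y d z = space_form \<epsilon> z"
        using assms(1) d z unfolding standard_manifold_def by blast
      thus "0 < 1 + \<epsilon> * (norm z)\<^sup>2" "gmat (rescale r Y) d z = r *\<^sub>R space_form \<epsilon> z"
        by (simp_all only: rescale_simps)
    qed
  qed
  moreover have "topspace (under Y) \<subseteq> (\<Union>d\<in>atlas Y. fst d)" using assms(1) unfolding standard_manifold_def by blast
  ultimately show ?thesis unfolding model_def rescale_simps(1,2) by blast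
qed

lemma pullback_scaleR: "pullback h (\<lambda>z. r *\<^sub>R G z) z = r *\<^sub>R pullback h G z"
  unfolding pullback_def by (simp add: vec_eq_iff scaleR_sum_right)

lemma standard_rescale:
  assumes "standard_manifold \<epsilon> Y" "d \<in> atlas Y" "d' \<in> atlas Y" "z \<in> snd d ` (fst d \<inter> fst d')"
  shows "gmat (rescale r Y) d z = pullback (transition d d') (gmat (rescale r Y) d') z"
proof -
  have "(\<lambda>z. r *\<^sub>R gmat Y d' z) = gmat (rescale r Y) d'" by (simp add: fun_eq_iff)
  moreover have "gmat Y d z = pullback (transition d d') (gmat Y d') z"
    using assms unfolding standard_manifold_def by blast
  ultimately show ?thesis using pullback_scaleR[of "transition d d'" r "gmat Y d'" z] by simp
qed

lemma identity_chart:
  fixes U :: "(complex^'n::finite) set"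
  assumes "open U"
  shows "is_chart (top_of_set U) (U, \<lambda>z. z)" "z \<in> U \<Longrightarrow> transition (U, \<lambda>z. z) (U, \<lambda>z. z) z = z"
    "compatible (U, \<lambda>z. z) (U, \<lambda>z. z)"
proof -
  show "is_chart (top_of_set U) (U, \<lambda>z. z)"
    unfolding is_chart_def using assms homeomorphic_map_id[of "top_of_set U" "top_of_set U"]
    by (simp add: subtopology_subtopology id_def)
  show t: "transition (U, \<lambda>z. z) (U, \<lambda>z. z) z = z" if "z \<in> U" for z
    unfolding transition_def cinv_def using that f_inv_into_f[of z "\<lambda>z. z" U] by simp
  have "holo_on (\<lambda>z. z) U" unfolding holo_on_iff[OF assms] by (blast intro: hol_coord)
  hence "holo_on (transition (U, \<lambda>z. z) (U, \<lambda>z. z)) U"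
    using holo_on_cong[OF assms, of "transition (U, \<lambda>z. z) (U, \<lambda>z. z)" "\<lambda>z. z"] t by blast
  thus "compatible (U, \<lambda>z. z) (U, \<lambda>z. z)" unfolding compatible_def by simp
qed

lemma standard_single_chart:
  fixes U :: "(complex^'n::finite) set" and Y :: "(complex^'n, 'n) hmfd"
  assumes "open U" "under Y = top_of_set U" "atlas Y = {(U, \<lambda>z. z)}"
    and "\<And>z. z \<in> U \<Longrightarrow> 1 + \<epsilon> * (norm z)\<^sup>2 > 0" "\<And>d z. z \<in> U \<Longrightarrow> gmat Y d z = space_form \<epsilon> z"
  shows "standard_manifold \<epsilon> Y"
proof -
  have "pullback (transition (U, \<lambda>z. z) (U, \<lambda>z. z)) (gmat Y (U, \<lambda>z. z)) z = gmat Y (U, \<lambda>z. z) z" if "z \<in> U" for z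
    using pullback_cong[OF assms(1) that, of "transition (U, \<lambda>z. z) (U, \<lambda>z. z)" "\<lambda>z. z"]
      identity_chart(2)[OF assms(1)] pullback_id by metis
  thus ?thesis unfolding standard_manifold_def assms(2,3)
    using identity_chart[OF assms(1)] assms(4,5) by simp
qed

lemma standard_flat: "standard_manifold 0 (flat_space :: (complex^'n::finite, 'n) hmfd)"
proof (rule standard_single_chart[of UNIV])
  show "gmat (flat_space :: (complex^'n, 'n) hmfd) d z = space_form 0 z" for d z
    by (simp add: flat_space_def space_form_def radial_matrix_nth kron_def mat_def vec_eq_iff)
qed (simp_all add: flat_space_def)

lemma standard_hyperbolic: "standard_manifold (-1) hyperbolic_plane"
proof (rule standard_single_chart[of "ball 0 1"])
  have n: "1 + (-1) * (norm z)\<^sup>2 > 0" if "z \<in> ball 0 1" for z :: "complex^2"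
    using that by (simp add: abs_square_less_1)
  show "1 + (-1) * (norm z)\<^sup>2 > 0" if "z \<in> ball 0 1" for z :: "complex^2" by (rule n[OF that])
  show "gmat hyperbolic_plane d z = space_form (-1) z" if "z \<in> ball 0 1" for d z
    using levi_space_form[OF _ n[OF that]] by (simp add: hyperbolic_plane_def)
qed (simp_all add: hyperbolic_plane_def)

section \<open>The affine charts of the complex projective plane\<close>

lemma line_eq_iff:
  assumes "v \<noteq> 0" "u \<in> line v" "u \<noteq> 0"
  shows "line u = line v"
proof -
  obtain c where c: "u = c *s v" using assms(2) unfolding line_def by blast
  hence "c \<noteq> 0" using assms(3) by auto
  have "x \<in> line u" if "x \<in> line v" for x
  proof -
    obtain b where "x = b *s v" using \<open>x \<in> line v\<close> unfolding line_def by blast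
    hence "x = (b / c) *s u" using c \<open>c \<noteq> 0\<close> by (simp add: vec_eq_iff)
    thus ?thesis unfolding line_def by blast
  qed
  moreover have "x \<in> line v" if "x \<in> line u" for x
    using that c unfolding line_def by auto
  ultimately show ?thesis by blast
qed

lemma in_line: "v \<in> line v"
proof -
  have "v = 1 *s v" by simp
  thus ?thesis unfolding line_def by blast
qed

locale affine =
  fixes i j k :: 3
  assumes distinct: "i \<noteq> j" "i \<noteq> k" "j \<noteq> k"
begin

lemma UNIV_ijk: "(UNIV :: 3 set) = {i, j, k}"
  using distinct exhaust_3[of i] exhaust_3[of j] exhaust_3[of k] unfolding UNIV_3 by auto

text \<open>The representative with i-th homogeneous coordinate 1; \<open>line (emb z)\<close> is
  the inverse of the affine chart.\<close>

definition emb :: "complex^2 \<Rightarrow> complex^3" where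
  "emb z = (\<chi> l. if l = i then 1 else if l = j then z $ 1 else z $ 2)"

lemma emb_simps [simp]: "emb z $ i = 1" "emb z $ j = z $ 1" "emb z $ k = z $ 2"
  unfolding emb_def using distinct by auto

lemma all_ijk: "(\<forall>l. P l) \<longleftrightarrow> P i \<and> P j \<and> P k"
  using UNIV_ijk by (metis UNIV_I insertE singletonD)

lemma emb_nonzero: "emb z \<noteq> 0"
proof
  assume "emb z = 0"
  hence "emb z $ i = 0" by simp
  thus False by simp
qed

abbreviation ch where "ch \<equiv> affine_chart i j k"

lemma affine_rep_line:
  assumes "v $ i \<noteq> 0"
  shows "affine_rep i (line v) = (1 / v $ i) *s v"
  unfolding affine_rep_def
proof (rule the_equality)
  show "(1 / v $ i) *s v \<in> line v \<and> ((1 / v $ i) *s v) $ i = 1"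
    using assms unfolding line_def by auto
  fix u assume "u \<in> line v \<and> u $ i = 1"
  then obtain c where "u = c *s v" "u $ i = 1" unfolding line_def by blast
  hence "c = 1 / v $ i" using assms by (simp add: field_simps)
  thus "u = (1 / v $ i) *s v" using \<open>u = c *s v\<close> by simp
qed

lemma snd_ch: "v $ i \<noteq> 0 \<Longrightarrow> snd ch (line v) = vector [v $ j / v $ i, v $ k / v $ i]"
  unfolding affine_chart_def by (simp add: affine_rep_line)

lemma fst_ch: "fst ch = line ` {v. v $ i \<noteq> 0}" unfolding affine_chart_def by simp

lemma fst_ch_subset: "fst ch \<subseteq> line ` (- {0})"
  unfolding fst_ch by (rule image_mono) auto

lemma line_in_ch:
  assumes "v \<noteq> 0"
  shows "line v \<in> fst ch \<longleftrightarrow> v $ i \<noteq> 0"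
proof
  assume "line v \<in> fst ch"
  then obtain u where u: "line v = line u" "u $ i \<noteq> 0" unfolding fst_ch by blast
  have "u \<in> line v" unfolding u(1) by (rule in_line)
  thus "v $ i \<noteq> 0" using u(2) unfolding line_def by auto
qed (auto simp: fst_ch)

lemma snd_ch_emb: "snd ch (line (emb z)) = z"
  by (subst snd_ch) (simp_all add: vec_eq_iff forall_2)

lemma line_emb_snd:
  assumes "L \<in> fst ch"
  shows "line (emb (snd ch L)) = L"
proof -
  obtain v where v: "L = line v" "v $ i \<noteq> 0" using assms unfolding fst_ch by blast
  have "emb (snd ch L) = (1 / v $ i) *s v"
    unfolding v(1) snd_ch[OF v(2)] vec_eq_iff all_ijk using v(2) by simp
  hence "emb (snd ch L) \<in> line v" unfolding line_def by auto
  moreover have "v \<noteq> 0" using v(2) by auto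
  ultimately show ?thesis using line_eq_iff emb_nonzero v(1) by blast
qed

lemma emb_in_ch: "line (emb z) \<in> fst ch" by (simp add: line_in_ch emb_nonzero)

lemma image_ch: "snd ch ` fst ch = UNIV"
  using snd_ch_emb emb_in_ch by (metis UNIV_eq_I image_eqI)

lemma cont_emb: "continuous_on UNIV emb"
  unfolding emb_def
proof (rule continuous_on_vec_lambda)
  show "continuous_on UNIV (\<lambda>z. if l = i then 1 else if l = j then z $ 1 else (z $ 2 :: complex))" for l
    by (cases "l = i"; cases "l = j") (auto intro!: continuous_intros)
qed

lemma openin_fst_ch: "openin projective_topology (fst ch)"
proof -
  have eq: "v \<noteq> 0 \<and> line v \<in> fst ch \<longleftrightarrow> v $ i \<noteq> 0" for v
    by (cases "v = 0") (simp_all add: line_in_ch)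
  have "{v. v \<noteq> 0 \<and> line v \<in> fst ch} = {v. v $ i \<noteq> 0}" by (rule Collect_cong[OF eq])
  moreover have "open {v :: complex^3. v $ i \<noteq> 0}"
    using open_Collect_neq[of "\<lambda>v :: complex^3. v $ i" "\<lambda>_. 0"] by (simp add: continuous_on_component)
  moreover have "fst ch \<subseteq> line ` (- {0})" by (rule fst_ch_subset)
  ultimately show ?thesis unfolding openin_projective_topology by simp
qed

text \<open>Openness in the quotient topology is tested on the cone of nonzero vectors over a set.
  Preimages under the chart have cones given by the quotients of coordinates, and the image of
  \<open>U\<close> under the chart is the preimage under \<open>emb\<close> of the cone over
  \<open>U\<close>.\<close>

lemma is_chart_ch: "is_chart projective_topology ch"
  unfolding is_chart_def image_ch
proof (intro conjI openin_fst_ch open_UNIV)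
  have top: "topspace (subtopology projective_topology (fst ch)) = fst ch"
    by (rule topspace_subtopology_subset[OF openin_subset[OF openin_fst_ch]])
  show "homeomorphic_map (subtopology projective_topology (fst ch)) (top_of_set UNIV) (snd ch)"
  proof (rule bijective_open_imp_homeomorphic_map)
    show "continuous_map (subtopology projective_topology (fst ch)) (top_of_set UNIV) (snd ch)"
      unfolding continuous_map_alt top
    proof (intro conjI allI impI)
      fix O' :: "(complex^2) set" assume "openin (top_of_set UNIV) O'"
      hence O': "open O'" by simp
      have "{v. v \<noteq> 0 \<and> line v \<in> snd ch -` O' \<inter> fst ch} =
         {v. v $ i \<noteq> 0} \<inter> (\<lambda>v. vector [v $ j / v $ i, v $ k / v $ i]) -` O'"
      proof (rule set_eqI)
        fix v
        show "v \<in> {v. v \<noteq> 0 \<and> line v \<in> snd ch -` O' \<inter> fst ch} \<longleftrightarrow>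
          v \<in> {v. v $ i \<noteq> 0} \<inter> (\<lambda>v. vector [v $ j / v $ i, v $ k / v $ i]) -` O'"
          using line_in_ch[of v] snd_ch[of v] by (cases "v = 0"; cases "v $ i = 0") simp_all
      qed
      moreover have "open ({v. v $ i \<noteq> 0} \<inter> (\<lambda>v::complex^3. vector [v $ j / v $ i, v $ k / v $ i] :: complex^2) -` O')"
      proof (rule continuous_open_preimage)
        show "open {v :: complex^3. v $ i \<noteq> 0}"
    using open_Collect_neq[of "\<lambda>v :: complex^3. v $ i" "\<lambda>_. 0"] by (simp add: continuous_on_component)
        have "continuous_on {v :: complex^3. v $ i \<noteq> 0} (\<lambda>v. \<chi> l::2. if l = 1 then v $ j / v $ i else v $ k / v $ i)"
        proof (rule continuous_on_vec_lambda)
          show "continuous_on {v :: complex^3. v $ i \<noteq> 0} (\<lambda>v. if l = 1 then v $ j / v $ i else v $ k / v $ i)" for l :: 2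
            by (cases "l = 1") (auto intro!: continuous_intros)
        qed
        thus "continuous_on {v :: complex^3. v $ i \<noteq> 0} (\<lambda>v. vector [v $ j / v $ i, v $ k / v $ i] :: complex^2)"
          by (rule continuous_on_eq) (simp add: vec_eq_iff forall_2)
      qed (rule O')
      ultimately have "openin projective_topology (snd ch -` O' \<inter> fst ch)"
        unfolding openin_projective_topology using fst_ch_subset by (simp only:) blast
      thus "openin (subtopology projective_topology (fst ch)) (snd ch -` O' \<inter> fst ch)"
        using openin_fst_ch by (simp add: openin_open_subtopology)
    qed simp
    show "open_map (subtopology projective_topology (fst ch)) (top_of_set UNIV) (snd ch)"
      unfolding open_map_def
    proof (intro allI impI)
      fix U assume "openin (subtopology projective_topology (fst ch)) U"
      hence U: "openin projective_topology U" "U \<subseteq> fst ch" using openin_fst_ch by (simp_all add: openin_open_subtopology)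
      have "snd ch ` U = emb -` {v. v \<noteq> 0 \<and> line v \<in> U}"
      proof (intro set_eqI iffI)
        fix z assume "z \<in> snd ch ` U"
        thus "z \<in> emb -` {v. v \<noteq> 0 \<and> line v \<in> U}" using line_emb_snd U(2) emb_nonzero by auto
      next
        fix z assume "z \<in> emb -` {v. v \<noteq> 0 \<and> line v \<in> U}"
        hence "line (emb z) \<in> U" by simp
        thus "z \<in> snd ch ` U" using snd_ch_emb by (metis image_eqI)
      qed
      moreover have "open {v. v \<noteq> 0 \<and> line v \<in> U}" using U(1) unfolding openin_projective_topology by blast
      ultimately have "open (snd ch ` U)" using open_vimage[OF _ cont_emb, of "{v. v \<noteq> 0 \<and> line v \<in> U}"] by (simp only:)
      thus "openin (top_of_set UNIV) (snd ch ` U)" by simp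
    qed
    show "snd ch ` topspace (subtopology projective_topology (fst ch)) = topspace (top_of_set UNIV)"
      unfolding top image_ch by simp
    show "inj_on (snd ch) (topspace (subtopology projective_topology (fst ch)))"
      unfolding top by (rule inj_on_inverseI[of _ "\<lambda>z. line (emb z)"]) (rule line_emb_snd)
  qed
qed

lemma cinv_ch: "cinv ch z = line (emb z)"
proof -
  interpret chart projective_topology ch by standard (rule is_chart_ch)
  show ?thesis using cinv_snd[OF emb_in_ch] unfolding snd_ch_emb .
qed

lemma hol_emb: "hol (\<lambda>z. emb z $ l) z"
proof (cases "l = i")
  case True
  thus ?thesis unfolding emb_def by (simp add: hol_const)
next
  case False
  thus ?thesis unfolding emb_def by (cases "l = j") (simp_all add: hol_coord)
qed

lemma norm_ijk: "(norm v)\<^sup>2 = (norm (v $ i))\<^sup>2 + (norm (v $ j))\<^sup>2 + (norm (v $ k))\<^sup>2" for v :: "complex^3"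
proof -
  have "(norm v)\<^sup>2 = (\<^bold>\<Sum>l. (norm (v $ l))\<^sup>2)"
    unfolding norm_vec_def L2_set_def by (simp add: sum_nonneg)
  thus ?thesis unfolding UNIV_ijk using distinct by simp
qed

lemma norm_emb: "(norm (emb z))\<^sup>2 = 1 + (norm z)\<^sup>2"
proof -
  have "(norm z)\<^sup>2 = (norm (z $ 1))\<^sup>2 + (norm (z $ 2))\<^sup>2"
    unfolding norm_vec_def L2_set_def by (simp add: sum_nonneg sum_2)
  thus ?thesis unfolding norm_ijk by simp
qed

end

section \<open>Agreement of the Fubini-Study metric on overlaps of affine charts\<close>

lemma has_wd_ln_norm_hol:
  assumes "hol e z" "e z \<noteq> 0"
  shows "has_wd (\<lambda>w. of_real (ln ((norm (e w))\<^sup>2))) (\<lambda>l. pd e l z / e z) (\<lambda>l. cnj (pd e l z / e z)) z"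
proof -
  have "has_wd (\<lambda>w. e w * cnj (e w)) (\<lambda>l. pd e l z * cnj (e z) + e z * cnj 0) (\<lambda>l. 0 * cnj (e z) + e z * cnj (pd e l z)) z"
    using has_wd_mult[OF assms(1)[unfolded hol_def] has_wd_cnj[OF assms(1)[unfolded hol_def]]] .
  hence "has_wd (\<lambda>w. of_real ((norm (e w))\<^sup>2)) (\<lambda>l. pd e l z * cnj (e z)) (\<lambda>l. e z * cnj (pd e l z)) z"
    by (simp only: complex_norm_square complex_cnj_zero mult_zero_left mult_zero_right add_0_left add_0_right)
  moreover have "(ln has_real_derivative 1 / (norm (e z))\<^sup>2) (at ((norm (e z))\<^sup>2))"
    using assms(2) DERIV_ln[of "(norm (e z))\<^sup>2"] by (simp add: field_simps)
  ultimately have "has_wd (\<lambda>w. of_real (ln ((norm (e w))\<^sup>2)))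
     (\<lambda>l. of_real (1 / (norm (e z))\<^sup>2) * (pd e l z * cnj (e z))) (\<lambda>l. of_real (1 / (norm (e z))\<^sup>2) * (e z * cnj (pd e l z))) z"
    by (rule has_wd_Re_comp)
  thus ?thesis
  proof (rule has_wd_cong)
    have n: "complex_of_real (1 / (norm (e z))\<^sup>2) = 1 / (e z * cnj (e z))" 
      by (simp only: of_real_divide of_real_1 complex_norm_square)
    fix l
    show "complex_of_real (1 / (norm (e z))\<^sup>2) * (pd e l z * cnj (e z)) = pd e l z / e z"
      unfolding n using assms(2) by simp
    show "complex_of_real (1 / (norm (e z))\<^sup>2) * (e z * cnj (pd e l z)) = cnj (pd e l z / e z)"
      unfolding n using assms(2) by simp
  qed
qed

text \<open>\<open>ln |e|\<^sup>2\<close> is pluriharmonic for a holomorphic function \<open>e\<close> without zeros.\<close>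

lemma levi_diff_ln_norm_hol:
  assumes "open S" "z \<in> S" "\<And>w. w \<in> S \<Longrightarrow> hol e w" "\<And>w. w \<in> S \<Longrightarrow> e w \<noteq> 0"
    and d1: "\<And>w. w \<in> S \<Longrightarrow> (\<lambda>w. complex_of_real (\<Phi> w)) differentiable (at w)"
    and d2: "\<And>j. pdbar (\<lambda>w. complex_of_real (\<Phi> w)) j differentiable (at z)"
  shows "levi (\<lambda>w. \<Phi> w - ln ((norm (e w))\<^sup>2)) z = levi \<Phi> z"
proof -
  have "pdbar (\<lambda>w. complex_of_real (\<Phi> w - ln ((norm (e w))\<^sup>2))) j w =
     pdbar (\<lambda>w. complex_of_real (\<Phi> w)) j w - cnj (pd e j w / e w)" if "w \<in> S" for j w
    using has_wd_pd(2)[OF has_wd_diff[OF differentiable_imp_has_wd[OF d1[OF that]]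
       has_wd_ln_norm_hol[OF assms(3,4)[OF that]]]] by simp
  from pd_cong_open(1)[OF assms(1,2) this]
  have "pd (pdbar (\<lambda>w. complex_of_real (\<Phi> w - ln ((norm (e w))\<^sup>2))) j) i z =
     pd (\<lambda>w. pdbar (\<lambda>w. complex_of_real (\<Phi> w)) j w - cnj (pd e j w / e w)) i z" for i j .
  also have "pd (\<lambda>w. pdbar (\<lambda>w. complex_of_real (\<Phi> w)) j w - cnj (pd e j w / e w)) i z =
      pd (pdbar (\<lambda>w. complex_of_real (\<Phi> w)) j) i z - cnj 0" for i j
  proof -
    have "hol (\<lambda>w. inverse (e w)) z"
      using hol_field_comp[OF assms(3)[OF assms(2)] DERIV_inverse[OF assms(4)[OF assms(2)]]] .
    from hol_mult[OF hol_pd[OF assms(1,3,2)] this] have "hol (\<lambda>w. pd e j w / e w) z"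
      by (simp add: divide_inverse)
    from has_wd_pd(1)[OF has_wd_diff[OF differentiable_imp_has_wd[OF d2] has_wd_cnj[OF this[unfolded hol_def]]]]
    show ?thesis .
  qed
  finally show ?thesis unfolding levi_def by simp
qed

lemma potential_smooth:
  fixes w :: "complex^'n::finite"
  shows "(\<lambda>w. complex_of_real (ln (1 + (norm w)\<^sup>2))) differentiable (at w)"
    "pdbar (\<lambda>w. complex_of_real (ln (1 + (norm w)\<^sup>2))) j differentiable (at w)"
proof -
  have d: "((\<lambda>t. ln (1 + t)) has_real_derivative 1 / (1 + (norm w)\<^sup>2)) (at ((norm w)\<^sup>2))" for w :: "complex^'n"
    by (auto intro!: derivative_eq_intros simp: add_pos_nonneg)
  have d2: "((\<lambda>t. 1 / (1 + t)) has_real_derivative - 1 / (1 + (norm w)\<^sup>2)\<^sup>2) (at ((norm w)\<^sup>2))"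
    by (auto intro!: derivative_eq_intros simp: power2_eq_square add_nonneg_eq_0_iff)
  show "(\<lambda>w. complex_of_real (ln (1 + (norm w)\<^sup>2))) differentiable (at w)"
    by (rule has_wd_imp_differentiable[OF has_wd_radial[OF d]])
  have "pdbar (\<lambda>w. complex_of_real (ln (1 + (norm w)\<^sup>2))) j = (\<lambda>w. of_real (1 / (1 + (norm w)\<^sup>2)) * w $ j)"
    using has_wd_pd(2)[OF has_wd_radial[OF d]] by blast
  thus "pdbar (\<lambda>w. complex_of_real (ln (1 + (norm w)\<^sup>2))) j differentiable (at w)"
    using has_wd_imp_differentiable[OF has_wd_mult[OF has_wd_radial[OF d2] has_wd_coord]] by simp
qed

locale affine_pair = affine i j k + b: affine i' j' k' for i j k i' j' k' :: 3
begin

lemma overlap: "snd ch ` (fst ch \<inter> fst b.ch) = {z. emb z $ i' \<noteq> 0}"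
proof (intro set_eqI iffI)
  fix z assume "z \<in> snd ch ` (fst ch \<inter> fst b.ch)"
  then obtain L where L: "L \<in> fst ch" "L \<in> fst b.ch" "z = snd ch L" by blast
  hence "line (emb z) \<in> fst b.ch" using line_emb_snd by simp
  thus "z \<in> {z. emb z $ i' \<noteq> 0}" using b.line_in_ch[OF emb_nonzero] by simp
next
  fix z assume "z \<in> {z. emb z $ i' \<noteq> 0}"
  hence "line (emb z) \<in> fst ch \<inter> fst b.ch" using b.line_in_ch[OF emb_nonzero] emb_in_ch by simp
  thus "z \<in> snd ch ` (fst ch \<inter> fst b.ch)" using snd_ch_emb by (metis image_eqI)
qed

lemma open_overlap: "open {z. emb z $ i' \<noteq> 0}"
proof -
  have "continuous_on UNIV (\<lambda>z. emb z $ i')" by (rule continuous_on_component[OF cont_emb])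
  thus ?thesis using open_Collect_neq[of "\<lambda>z. emb z $ i'" "\<lambda>_. 0"] by simp
qed

lemma transition_ch: "emb z $ i' \<noteq> 0 \<Longrightarrow>
    transition ch b.ch z = vector [emb z $ j' / emb z $ i', emb z $ k' / emb z $ i']"
  unfolding transition_def by (simp add: cinv_ch b.snd_ch)

lemma holo_transition_ch: "holo_on (transition ch b.ch) (snd ch ` (fst ch \<inter> fst b.ch))"
  unfolding overlap
proof (subst holo_on_cong[OF open_overlap])
  show "z \<in> {z. emb z $ i' \<noteq> 0} \<Longrightarrow> transition ch b.ch z = vector [emb z $ j' / emb z $ i', emb z $ k' / emb z $ i']" for z
    using transition_ch by simp
  show "holo_on (\<lambda>z. vector [emb z $ j' / emb z $ i', emb z $ k' / emb z $ i'] :: complex^2) {z. emb z $ i' \<noteq> 0}"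
    unfolding holo_on_iff[OF open_overlap]
  proof (intro ballI allI)
    fix z and a :: 2 assume "z \<in> {z. emb z $ i' \<noteq> 0}"
    hence nz: "emb z $ i' \<noteq> 0" by simp
    have q: "hol (\<lambda>z. emb z $ l / emb z $ i') z" for l
      using hol_mult[OF hol_emb hol_field_comp[OF hol_emb DERIV_inverse[OF nz]]] by (simp add: divide_inverse)
    have "(\<lambda>w. (vector [emb w $ j' / emb w $ i', emb w $ k' / emb w $ i'] :: complex^2) $ a) =
       (\<lambda>w. emb w $ (if a = 1 then j' else k') / emb w $ i')"
      using exhaust_2[of a] by auto
    thus "hol (\<lambda>w. (vector [emb w $ j' / emb w $ i', emb w $ k' / emb w $ i'] :: complex^2) $ a) z"
      using q by simp
  qed
qed

text \<open>Both 1 + |z|^2 and its value after the transition are squared norms of representatives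
  of the same line, so they differ by the factor |e|^2 for a holomorphic \<open>e\<close> without
  zeros. The two potentials differ by ln |e|^2, which has no complex Hessian.\<close>

lemma metric_transition:
  assumes "z \<in> snd ch ` (fst ch \<inter> fst b.ch)"
  shows "pullback (transition ch b.ch) (levi (\<lambda>z. ln (1 + (norm z)\<^sup>2))) z = levi (\<lambda>z. ln (1 + (norm z)\<^sup>2)) z"
proof -
  let ?S = "{z. emb z $ i' \<noteq> 0}" and ?\<tau> = "transition ch b.ch"
  have z: "z \<in> ?S" using assms unfolding overlap .
  have "levi (\<lambda>w. ln (1 + (norm (?\<tau> w))\<^sup>2)) z = pullback ?\<tau> (levi (\<lambda>z. ln (1 + (norm z)\<^sup>2))) z"
    by (rule levi_comp[OF open_overlap _ open_UNIV _ z])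
       (use holo_transition_ch overlap potential_smooth in auto)
  moreover have "ln (1 + (norm (?\<tau> w))\<^sup>2) = ln (1 + (norm w)\<^sup>2) - ln ((norm (emb w $ i'))\<^sup>2)" if "w \<in> ?S" for w
  proof -
    have nz: "emb w $ i' \<noteq> 0" using that by simp
    have "(norm (?\<tau> w))\<^sup>2 = (norm (?\<tau> w $ 1))\<^sup>2 + (norm (?\<tau> w $ 2))\<^sup>2"
      unfolding norm_vec_def L2_set_def by (simp add: sum_nonneg sum_2)
    hence "(norm (?\<tau> w))\<^sup>2 = ((norm (emb w $ j'))\<^sup>2 + (norm (emb w $ k'))\<^sup>2) / (norm (emb w $ i'))\<^sup>2"
      unfolding transition_ch[OF nz] by (simp add: norm_divide power_divide add_divide_distrib)
    hence "1 + (norm (?\<tau> w))\<^sup>2 = (norm (emb w))\<^sup>2 / (norm (emb w $ i'))\<^sup>2"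
      unfolding b.norm_ijk[of "emb w"] using nz by (simp add: field_simps)
    hence "1 + (norm (?\<tau> w))\<^sup>2 = (1 + (norm w)\<^sup>2) / (norm (emb w $ i'))\<^sup>2" unfolding norm_emb .
    moreover have "1 + (norm w)\<^sup>2 > 0" by (simp add: add_pos_nonneg)
    ultimately show ?thesis using nz by (simp add: ln_div)
  qed
  from levi_cong_open[OF open_overlap z this]
  have "levi (\<lambda>w. ln (1 + (norm (?\<tau> w))\<^sup>2)) z = levi (\<lambda>w. ln (1 + (norm w)\<^sup>2) - ln ((norm (emb w $ i'))\<^sup>2)) z" .
  also have "\<dots> = levi (\<lambda>w. ln (1 + (norm w)\<^sup>2)) z"
    by (rule levi_diff_ln_norm_hol[OF open_overlap z])
       (use hol_emb potential_smooth in auto)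
  ultimately show ?thesis by simp
qed

end

lemma standard_projective: "standard_manifold 1 projective_plane"
proof -
  have at: "\<exists>i j k. d = affine_chart i j k \<and> affine i j k" if "d \<in> atlas projective_plane" for d
  proof -
    have "affine 1 2 3" "affine 2 1 3" "affine 3 1 2" by standard simp_all
    thus ?thesis using that unfolding projective_plane_def by auto
  qed
  have G: "gmat projective_plane d = levi (\<lambda>z. ln (1 + (norm z)\<^sup>2))" for d unfolding projective_plane_def by simp
  have u: "under projective_plane = projective_topology" unfolding projective_plane_def by simp
  have pos: "1 + 1 * (norm z)\<^sup>2 > 0" for z :: "complex^2" by (simp add: add_pos_nonneg)
  have "topspace (under projective_plane) \<subseteq> (\<Union>d\<in>atlas projective_plane. fst d)"
  proof
    fix L assume "L \<in> topspace (under projective_plane)"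
    hence "L \<in> line ` (- {0})" unfolding u topspace_def openin_projective_topology by blast
    then obtain v where v: "L = line v" "v \<noteq> 0" by auto
    hence "v $ 1 \<noteq> 0 \<or> v $ 2 \<noteq> 0 \<or> v $ 3 \<noteq> 0" by (auto simp: vec_eq_iff forall_3)
    thus "L \<in> (\<Union>d\<in>atlas projective_plane. fst d)" unfolding projective_plane_def affine_chart_def v(1) by auto
  qed
  moreover have "is_chart (under projective_plane) d" if "d \<in> atlas projective_plane" for d
    unfolding u using at[OF that] affine.is_chart_ch by blast
  moreover have "gmat projective_plane d z = space_form 1 z" for d z
    unfolding G using levi_space_form[OF _ pos[of z]] by simp
  moreover have "compatible d d'" "\<forall>z\<in>snd d ` (fst d \<inter> fst d'). gmat projective_plane d z = pullback (transition d d') (gmat projective_plane d') z"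
    if d: "d \<in> atlas projective_plane" "d' \<in> atlas projective_plane" for d d'
  proof -
    obtain i j k i' j' k' where e: "d = affine_chart i j k" "affine i j k" "d' = affine_chart i' j' k'" "affine i' j' k'"
      using at d by metis
    have p: "affine_pair i j k i' j' k'" "affine_pair i' j' k' i j k" using e(2,4) by (simp_all add: affine_pair_def)
    show "compatible d d'" unfolding compatible_def e(1,3)
      using affine_pair.holo_transition_ch[OF p(1)] affine_pair.holo_transition_ch[OF p(2)] by (simp add: Int_commute)
    show "\<forall>z\<in>snd d ` (fst d \<inter> fst d'). gmat projective_plane d z = pullback (transition d d') (gmat projective_plane d') z"
      unfolding G e(1,3) using affine_pair.metric_transition[OF p(1)] by simp
  qed
  ultimately show ?thesis unfolding standard_manifold_def using pos by simp
qed

section \<open>Radial charts\<close>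

declare dreal.simps(2) [simp del]

lemma levi_radial_comp:
  fixes h :: "complex^'n::finite \<Rightarrow> complex^'m::finite"
  assumes "open S" "holo_on h S" "open T" "h ` S \<subseteq> T" "z \<in> S"
    and d: "\<And>w. w \<in> T \<Longrightarrow> (f has_real_derivative f1 ((norm w)\<^sup>2)) (at ((norm w)\<^sup>2))"
    and d1: "\<And>w. w \<in> T \<Longrightarrow> (f1 has_real_derivative f2 ((norm w)\<^sup>2)) (at ((norm w)\<^sup>2))"
  shows "levi (\<lambda>z. f ((norm (h z))\<^sup>2)) z = pullback h (radial_matrix f1 f2) z"
proof -
  have "levi (\<lambda>z. f ((norm (h z))\<^sup>2)) z = pullback h (levi (\<lambda>w. f ((norm w)\<^sup>2))) z"
  proof (rule levi_comp[OF assms(1-5)])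
    fix w assume w: "w \<in> T"
    show "(\<lambda>w. complex_of_real (f ((norm w)\<^sup>2))) differentiable (at w)"
      by (rule has_wd_imp_differentiable[OF has_wd_radial[OF d[OF w]]])
    fix j
    from has_wd_transform[OF has_wd_mult[OF has_wd_radial[OF d1[OF w]] has_wd_coord[of j]] assms(3) w,
        of "pdbar (\<lambda>w. complex_of_real (f ((norm w)\<^sup>2))) j"]
    show "pdbar (\<lambda>w. complex_of_real (f ((norm w)\<^sup>2))) j differentiable (at w)"
      by (intro has_wd_imp_differentiable) (simp add: has_wd_pd(2)[OF has_wd_radial[OF d]])
  qed
  also have "\<dots> = pullback h (radial_matrix f1 f2) z"
  proof (rule pullback_cong_metric)
    have "h z \<in> T" using assms(4,5) by blast
    thus "levi (\<lambda>w. f ((norm w)\<^sup>2)) (h z) = radial_matrix f1 f2 (h z)"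
      by (intro levi_radial[OF assms(3)] d d1)
  qed
  finally show ?thesis .
qed

lemma space_form_profile_deriv:
  fixes D k t :: real
  assumes "D > 0" "D - k * t > 0"
  shows "((\<lambda>t. if k = 0 then t / D else - ln (D - k * t) / k) has_real_derivative 1 / (D - k * t)) (at t)"
proof (cases "k = 0")
  case True
  thus ?thesis using DERIV_cdivide[OF DERIV_ident, of D t] by simp
next
  case False
  have "((\<lambda>t. - ln (D - k * t) / k) has_real_derivative - (1 / (D - k * t) * - k) / k) (at t)"
    using assms(2) False by (auto intro!: derivative_eq_intros)
  thus ?thesis using False by simp
qed

text \<open>As row vectors, u = v P with v = u Q, so the form of \<open>A\<close> at u is the form
  of P A adj P at v. Definiteness thus passes from an atlas chart, where it is given, to the radial
  chart.\<close>

lemma posdef_pullback: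
  fixes P :: "complex^'m::finite^'n::finite" and A :: "complex^'m^'m"
  assumes "Q ** P = mat 1"
    and pos: "\<And>v. v \<noteq> 0 \<Longrightarrow> 0 < Re (\<^bold>\<Sum>i j. (P ** A ** adj P) $ i $ j * v $ i * cnj (v $ j))"
    and "u \<noteq> 0"
  shows "0 < Re (\<^bold>\<Sum>a b. A $ a $ b * u $ a * cnj (u $ b))"
proof -
  define v where "v = (\<chi> i. \<^bold>\<Sum>a. Q $ a $ i * u $ a)"
  have vP: "(\<^bold>\<Sum>i. v $ i * P $ i $ b) = u $ b" for b
  proof -
    have "(\<^bold>\<Sum>i. v $ i * P $ i $ b) = (\<^bold>\<Sum>i a. Q $ a $ i * P $ i $ b * u $ a)"
      unfolding v_def by (simp add: sum_distrib_left mult_ac)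
    also have "\<dots> = (\<^bold>\<Sum>a. (Q ** P) $ a $ b * u $ a)"
      unfolding matrix_matrix_mult_def by (subst sum.swap) (simp add: sum_distrib_right)
    also have "\<dots> = (\<^bold>\<Sum>a. kron a b * u $ a)" unfolding assms(1) mat_def kron_def by simp
    finally show ?thesis by (simp only: sum_kron)
  qed
  have "v \<noteq> 0"
  proof
    assume "v = 0"
    hence "u $ b = 0" for b using vP[of b] by simp
    thus False using assms(3) by (simp add: vec_eq_iff)
  qed
  have PA: "(P ** A ** adj P) $ i $ j = (\<^bold>\<Sum>a b. P $ i $ a * cnj (P $ j $ b) * A $ a $ b)" for i j
  proof -
    have "(P ** A ** adj P) $ i $ j = (\<^bold>\<Sum>b a. P $ i $ a * cnj (P $ j $ b) * A $ a $ b)"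
      unfolding matrix_matrix_mult_def adj_def by (simp add: sum_distrib_left sum_distrib_right mult_ac)
    thus ?thesis by (subst sum.swap)
  qed
  have "(\<^bold>\<Sum>i j. (P ** A ** adj P) $ i $ j * v $ i * cnj (v $ j)) =
    (\<^bold>\<Sum>i j a b. A $ a $ b * (v $ i * P $ i $ a) * (cnj (v $ j) * cnj (P $ j $ b)))"
    unfolding PA sum_distrib_right by (simp add: mult_ac)
  also have "\<dots> = (\<^bold>\<Sum>a b i j. A $ a $ b * (v $ i * P $ i $ a) * (cnj (v $ j) * cnj (P $ j $ b)))"
    by (simp only: sum.cartesian_product UNIV_Times_UNIV)
       (rule sum.reindex_bij_witness[where i="\<lambda>(a,b,i,j). (i,j,a,b)" and j="\<lambda>(i,j,a,b). (a,b,i,j)"], auto)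
  also have "\<dots> = (\<^bold>\<Sum>a b. A $ a $ b * (\<^bold>\<Sum>i. v $ i * P $ i $ a) * cnj (\<^bold>\<Sum>j. v $ j * P $ j $ b))"
    by (simp add: sum_distrib_left sum_distrib_right mult_ac)
  also have "\<dots> = (\<^bold>\<Sum>a b. A $ a $ b * u $ a * cnj (u $ b))" unfolding vP ..
  finally show ?thesis using pos[OF \<open>v \<noteq> 0\<close>] by simp
qed

text \<open>The form is f1 |u|^2 + f2 |<u, w>|^2. Evaluating it at \<open>w\<close> and at a vector
  orthogonal to \<open>w\<close> isolates the two eigenvalues.\<close>

lemma radial_matrix_positive:
  fixes w :: "complex^'n::finite"
  defines "x \<equiv> (norm w)\<^sup>2"
  assumes "CARD('n) \<ge> 2" "w \<noteq> 0"
    and pos: "\<And>u. u \<noteq> 0 \<Longrightarrow> 0 < Re (\<^bold>\<Sum>a b. radial_matrix f1 f2 w $ a $ b * u $ a * cnj (u $ b))"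
  shows "f1 x > 0" "f1 x + x * f2 x > 0"
proof -
  define ip where "ip = (\<lambda>u. \<^bold>\<Sum>a. cnj (w $ a) * u $ a)"
  have form: "Re (\<^bold>\<Sum>a b. radial_matrix f1 f2 w $ a $ b * u $ a * cnj (u $ b)) =
     f1 x * (norm u)\<^sup>2 + f2 x * (norm (ip u))\<^sup>2" for u :: "complex^'n"
  proof -
    have "(\<^bold>\<Sum>a b. radial_matrix f1 f2 w $ a $ b * u $ a * cnj (u $ b)) =
      (\<^bold>\<Sum>a b. kron a b * (of_real (f1 x) * (u $ a * cnj (u $ b)))
         + of_real (f2 x) * ((cnj (w $ a) * u $ a) * (w $ b * cnj (u $ b))))"
      unfolding radial_matrix_nth x_def by (simp add: algebra_simps)
    also have "\<dots> = of_real (f1 x) * of_real ((norm u)\<^sup>2) + of_real (f2 x) * (ip u * cnj (ip u))"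
      by (simp only: sum.distrib sum_kron sum_distrib_left[symmetric] sum_distrib_right[symmetric] norm2_sum
          ip_def cnj_sum complex_cnj_mult complex_cnj_cnj)
    also have "\<dots> = of_real (f1 x * (norm u)\<^sup>2 + f2 x * (norm (ip u))\<^sup>2)"
      unfolding of_real_add of_real_mult complex_norm_square[of "ip u"] ..
    finally show ?thesis by (simp only: Re_complex_of_real)
  qed
  have x: "x > 0" unfolding x_def using assms(3) by simp
  have "ip w = of_real x" unfolding ip_def norm2_sum x_def ..
  hence "f1 x * x + f2 x * x\<^sup>2 > 0" using pos[OF assms(3)] unfolding form x_def[symmetric] using x by simp
  hence "x * (f1 x + x * f2 x) > 0" by (simp add: algebra_simps power2_eq_square)
  thus "f1 x + x * f2 x > 0" using x by (simp add: zero_less_mult_iff)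
  obtain i where i: "w $ i \<noteq> 0" using assms(3) by (auto simp: vec_eq_iff)
  have "\<exists>j. j \<noteq> i"
  proof (rule ccontr)
    assume "\<nexists>j. j \<noteq> i"
    hence "(UNIV :: 'n set) = {i}" by blast
    thus False using assms(2) by (metis card.empty card.insert empty_iff finite.emptyI not_less_eq_eq numeral_2_eq_2 le_refl)
  qed
  then obtain j where j: "j \<noteq> i" by blast
  \<comment> \<open>A nonzero vector orthogonal to \<open>w\<close>, built from two coordinates;
    this is where dimension at least two is used.\<close>
  define u where "u = axis i (cnj (w $ j)) - axis j (cnj (w $ i))"
  have "u $ j = - cnj (w $ i)" unfolding u_def using j by (simp add: axis_def)
  hence u: "u \<noteq> 0" using i by (metis complex_cnj_zero_iff neg_equal_0_iff_equal zero_index)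
  have "ip u = 0" unfolding ip_def u_def by (simp add: right_diff_distrib sum_subtractf sum_axis)
  hence "f1 x * (norm u)\<^sup>2 > 0" using pos[OF u] unfolding form by simp
  thus "f1 x > 0" using u by (simp add: zero_less_mult_iff)
qed

text \<open>\<open>c\<close> ranges over the maximal atlas, while smoothness of the potential and
  the Levi form identity are stated in atlas charts only. Both have to be carried over by transition
  maps.\<close>

locale radial_chart =
  fixes X :: "('a, 'n::finite) hmfd" and c :: "('a, 'n) chart" and f :: "real \<Rightarrow> real"
  assumes dim: "CARD('n) \<ge> 2" and kaehler: "kaehler_manifold X"
    and holomorphic: "holomorphic_chart X c"
    and potential: "kaehler_potential X (fst c) (\<lambda>q. f ((norm (snd c q))\<^sup>2))"
begin

sublocale chart "under X" c by standard (use holomorphic in \<open>simp add: holomorphic_chart_def\<close>)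

abbreviation V where "V \<equiv> snd c ` fst c"

lemma atlas_chart: "c' \<in> atlas X \<Longrightarrow> chart (under X) c'"
  using kaehler_manifoldD(1)[OF kaehler] by (simp add: chart_def)

lemma obtain_chart:
  assumes "w \<in> V"
  obtains c' where "c' \<in> atlas X" "cinv c w \<in> fst c'"
proof -
  have "cinv c w \<in> topspace (under X)" using cinv_in[OF assms] openin_dom by (blast dest: openin_subset)
  thus ?thesis using kaehler that unfolding kaehler_manifold_def complex_manifold_def by blast
qed

lemma transitions:
  assumes "c' \<in> atlas X"
  shows "holo_on (transition c c') (snd c ` (fst c \<inter> fst c'))" "holo_on (transition c' c) (snd c' ` (fst c \<inter> fst c'))"
    and "q \<in> fst c \<inter> fst c' \<Longrightarrow> transition c c' (snd c q) = snd c' q"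
    and "q \<in> fst c \<inter> fst c' \<Longrightarrow> transition c' c (snd c' q) = snd c q"
    and "open (snd c ` (fst c \<inter> fst c'))" "open (snd c' ` (fst c \<inter> fst c'))"
proof -
  interpret c': chart "under X" c' by (rule atlas_chart[OF assms])
  have "compatible c c'" using holomorphic assms unfolding holomorphic_chart_def by blast
  thus "holo_on (transition c c') (snd c ` (fst c \<inter> fst c'))" "holo_on (transition c' c) (snd c' ` (fst c \<inter> fst c'))"
    unfolding compatible_def by blast+
  show "transition c c' (snd c q) = snd c' q" if "q \<in> fst c \<inter> fst c'"
    using transition_snd[OF chart] that by blast
  show "transition c' c (snd c' q) = snd c q" if "q \<in> fst c \<inter> fst c'"
    using transition_snd[OF c'.chart] that by blast
  have o: "openin (under X) (fst c \<inter> fst c')" using openin_dom c'.openin_dom by blast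
  show "open (snd c ` (fst c \<inter> fst c'))" by (rule open_image[OF o]) blast
  show "open (snd c' ` (fst c \<inter> fst c'))" by (rule c'.open_image[OF o]) blast
qed

lemma potential_transition:
  assumes c': "c' \<in> atlas X"
  defines "\<Phi> \<equiv> (\<lambda>q. f ((norm (snd c q))\<^sup>2)) \<circ> cinv c'"
  shows "z \<in> snd c' ` (fst c \<inter> fst c') \<Longrightarrow> \<Phi> z = f ((norm (transition c' c z))\<^sup>2)"
    and "w \<in> snd c ` (fst c \<inter> fst c') \<Longrightarrow> \<Phi> (transition c c' w) = f ((norm w)\<^sup>2)"
    and "Ck_on k \<Phi> (snd c' ` (fst c \<inter> fst c'))"
    and "z \<in> snd c' ` (fst c \<inter> fst c') \<Longrightarrow> gmat X c' z = levi \<Phi> z"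
proof -
  interpret c': chart "under X" c' by (rule atlas_chart[OF c'])
  show "\<Phi> z = f ((norm (transition c' c z))\<^sup>2)" if "z \<in> snd c' ` (fst c \<inter> fst c')"
    unfolding \<Phi>_def transition_def by simp
  show "\<Phi> (transition c c' w) = f ((norm w)\<^sup>2)" if "w \<in> snd c ` (fst c \<inter> fst c')"
  proof -
    from that obtain q where q: "q \<in> fst c \<inter> fst c'" "w = snd c q" by blast
    thus ?thesis using transitions(3)[OF c' q(1)] c'.cinv_snd unfolding \<Phi>_def by simp
  qed
  show "Ck_on k \<Phi> (snd c' ` (fst c \<inter> fst c'))"
    using potential c' unfolding kaehler_potential_def \<Phi>_def smooth_on_def by blast
  show "gmat X c' z = levi \<Phi> z" if "z \<in> snd c' ` (fst c \<inter> fst c')"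
    using potential c' that unfolding kaehler_potential_def \<Phi>_def by blast
qed

text \<open>Unlike \<open>smooth_profile\<close> this includes the origin of the chart, where it
  extends the formula found elsewhere.\<close>

lemma continuous_potential:
  assumes "w \<in> V"
  shows "isCont (\<lambda>w. f ((norm w)\<^sup>2)) w"
proof -
  obtain c' where c': "c' \<in> atlas X" "cinv c w \<in> fst c'" using obtain_chart[OF assms] .
  let ?O = "snd c ` (fst c \<inter> fst c')" and ?\<Phi> = "(\<lambda>q. f ((norm (snd c q))\<^sup>2)) \<circ> cinv c'"
  have w: "w \<in> ?O" using c'(2) cinv_in[OF assms] snd_cinv[OF assms] by (metis IntI image_eqI)
  have im: "transition c c' ` ?O \<subseteq> snd c' ` (fst c \<inter> fst c')"
    using transitions(3)[OF c'(1)] by auto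
  have "continuous_on ?O (\<lambda>w. ?\<Phi> (transition c c' w))"
    using continuous_on_compose2[of "snd c' ` (fst c \<inter> fst c')" ?\<Phi> ?O "transition c c'"]
      potential_transition(3)[OF c'(1), of 0] holo_on_imp_continuous_on[OF transitions(1)[OF c'(1)]] im by simp
  hence "continuous_on ?O (\<lambda>w. f ((norm w)\<^sup>2))"
    by (rule continuous_on_eq) (rule potential_transition(2)[OF c'(1)])
  thus ?thesis using w transitions(5)[OF c'(1)] continuous_on_eq_continuous_at by blast
qed

text \<open>The potential is restricted to the ray through \<open>w\<close>, which shows that f(t^2)
  is smooth, and then composed with the square root. The latter is smooth only at positive
  arguments, hence the condition w \<noteq> 0.\<close>

lemma smooth_profile:
  assumes "w \<in> V" "w \<noteq> 0"
  shows "(dreal j f has_real_derivative dreal (Suc j) f ((norm w)\<^sup>2)) (at ((norm w)\<^sup>2))"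
proof -
  obtain c' where c': "c' \<in> atlas X" "cinv c w \<in> fst c'" using obtain_chart[OF assms(1)] .
  let ?O = "snd c ` (fst c \<inter> fst c')" and ?\<Phi> = "(\<lambda>q. f ((norm (snd c q))\<^sup>2)) \<circ> cinv c'"
  have w: "w \<in> ?O" using c'(2) cinv_in[OF assms(1)] snd_cinv[OF assms(1)] by (metis IntI image_eqI)
  have im: "transition c c' ` ?O \<subseteq> snd c' ` (fst c \<inter> fst c')"
    using transitions(3)[OF c'(1)] by auto
  have S1: "Ck_on k (\<lambda>w. ?\<Phi> (transition c c' w)) ?O" for k
    by (rule Ck_on_compose[OF transitions(5)[OF c'(1)] Ck_on_holo[OF transitions(5)[OF c'(1)] transitions(1)[OF c'(1)]] im])
       (rule potential_transition(3)[OF c'(1)])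
  define u where "u = w /\<^sub>R norm w"
  have nu: "norm u = 1" unfolding u_def using assms(2) by simp
  define J where "J = (\<lambda>t::real. t *\<^sub>R u) -` ?O"
  have oJ: "open J" unfolding J_def
    by (rule open_vimage[OF transitions(5)[OF c'(1)]]) (intro continuous_intros)
  have lin: "Ck_on k (\<lambda>t::real. t *\<^sub>R u) J" for k
    by (rule Ck_on_linear[OF bounded_linear_scaleR_left oJ Ck_on_id[OF oJ]])
  have S2: "Ck_on k (\<lambda>t. ?\<Phi> (transition c c' (t *\<^sub>R u))) J" for k
    by (rule Ck_on_compose[OF oJ lin _ S1]) (auto simp: J_def)
  have "?\<Phi> (transition c c' (t *\<^sub>R u)) = f (t\<^sup>2)" if "t \<in> J" for t
    using potential_transition(2)[OF c'(1), of "t *\<^sub>R u"] that nu unfolding J_def by (simp add: power2_eq_square)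
  hence S3: "Ck_on k (\<lambda>t. f (t\<^sup>2)) J" for k
    using S2[of k] Ck_on_cong[OF oJ, of "\<lambda>t. ?\<Phi> (transition c c' (t *\<^sub>R u))" "\<lambda>t. f (t\<^sup>2)" k] by blast
  define I where "I = {0<..} \<inter> sqrt -` J"
  have oI: "open I" unfolding I_def by (intro continuous_open_preimage[OF _ _ oJ] continuous_intros)
  have S4: "Ck_on k (\<lambda>x. f ((sqrt x)\<^sup>2)) I" for k
    by (rule Ck_on_compose[OF oI Ck_on_subset[OF Ck_on_sqrt] _ S3]) (auto simp: I_def)
  have S5: "Ck_on k f I" for k
    using S4[of k] Ck_on_cong[OF oI, of "\<lambda>x. f ((sqrt x)\<^sup>2)" f k] unfolding I_def by simp
  have "norm w *\<^sub>R u = w" unfolding u_def using assms(2) by simp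
  hence "(norm w)\<^sup>2 \<in> I" unfolding I_def J_def using assms(2) w by simp
  from dreal_has_derivative[OF S5 this] show ?thesis .
qed

abbreviation "f1 \<equiv> dreal 1 f"
abbreviation "f2 \<equiv> dreal 2 f"
abbreviation "f3 \<equiv> dreal 3 f"
abbreviation "f4 \<equiv> dreal 4 f"

lemma profile_derivs:
  assumes "w \<in> V" "w \<noteq> 0"
  shows "(f has_real_derivative f1 ((norm w)\<^sup>2)) (at ((norm w)\<^sup>2))"
    "(f1 has_real_derivative f2 ((norm w)\<^sup>2)) (at ((norm w)\<^sup>2))"
    "(f2 has_real_derivative f3 ((norm w)\<^sup>2)) (at ((norm w)\<^sup>2))"
    "(f3 has_real_derivative f4 ((norm w)\<^sup>2)) (at ((norm w)\<^sup>2))"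
proof -
  have "Suc 0 = 1" "Suc 1 = 2" "Suc 2 = 3" "Suc 3 = 4" by simp_all
  thus "(f has_real_derivative f1 ((norm w)\<^sup>2)) (at ((norm w)\<^sup>2))"
    "(f1 has_real_derivative f2 ((norm w)\<^sup>2)) (at ((norm w)\<^sup>2))"
    "(f2 has_real_derivative f3 ((norm w)\<^sup>2)) (at ((norm w)\<^sup>2))"
    "(f3 has_real_derivative f4 ((norm w)\<^sup>2)) (at ((norm w)\<^sup>2))"
    using smooth_profile[OF assms, of 0] smooth_profile[OF assms, of 1] smooth_profile[OF assms, of 2] smooth_profile[OF assms, of 3]
    by (simp_all only: dreal.simps(1))
qed

text \<open>Provides the setting \<open>radial_pullback\<close> at any point of a radial chart other
  than its origin. The positivity of the eigenvalues is recovered from the definiteness of the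
  metric in the atlas chart.\<close>

lemma local_pullback:
  assumes w: "w \<in> V" "w \<noteq> 0" and B: "open B" "w \<in> B" "B \<subseteq> V"
  obtains c' S T z Q where "c' \<in> atlas X" "S \<subseteq> snd c' ` fst c'" "T \<subseteq> B - {0}" "z \<in> S" "transition c' c z = w"
    "radial_pullback S T (transition c' c) (gmat X c') (radial_matrix f1 f2) f1 f2 f3 f4 Q"
proof -
  obtain c' where c': "c' \<in> atlas X" "cinv c w \<in> fst c'" using obtain_chart[OF w(1)] .
  interpret c': chart "under X" c' by (rule atlas_chart[OF c'(1)])
  let ?O = "snd c ` (fst c \<inter> fst c')" and ?h = "transition c' c" and ?k = "transition c c'"
  let ?\<Phi> = "(\<lambda>q. f ((norm (snd c q))\<^sup>2)) \<circ> cinv c'"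
  define T where "T = (B \<inter> ?O) - {0}"
  define S where "S = snd c' ` (cinv c ` T)"
  have TO: "T \<subseteq> ?O" and TV: "T \<subseteq> V" and TB: "T \<subseteq> B - {0}" unfolding T_def by auto
  have oT: "open T" unfolding T_def using B(1) transitions(5)[OF c'(1)] by (intro open_delete open_Int)
  have cT: "cinv c ` T \<subseteq> fst c \<inter> fst c'"
  proof
    fix q assume "q \<in> cinv c ` T"
    then obtain r where "r \<in> fst c \<inter> fst c'" "q = cinv c (snd c r)" using TO by blast
    thus "q \<in> fst c \<inter> fst c'" using cinv_snd by simp
  qed
  have oS: "open S" unfolding S_def by (rule c'.open_image[OF open_preimage[OF oT TV]]) (use cT in blast)
  have SO: "S \<subseteq> snd c' ` (fst c \<inter> fst c')" unfolding S_def using cT by blast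
  have hS: "?h z \<in> T \<and> ?k (?h z) = z" if z: "z \<in> S" for z
  proof -
    obtain t where t: "t \<in> T" "z = snd c' (cinv c t)" using z unfolding S_def by blast
    have q: "cinv c t \<in> fst c \<inter> fst c'" using t(1) cT by blast
    have "?h z = t" unfolding t(2) transitions(4)[OF c'(1) q] using t(1) TV snd_cinv by blast
    moreover have "?k t = z" using transitions(3)[OF c'(1) q] t TV snd_cinv by (metis subsetD)
    ultimately show ?thesis using t(1) by simp
  qed
  have hST: "?h ` S = T"
  proof
    show "?h ` S \<subseteq> T" using hS by blast
    show "T \<subseteq> ?h ` S"
    proof
      fix t assume t: "t \<in> T"
      have q: "cinv c t \<in> fst c \<inter> fst c'" using t cT by blast
      have "?h (snd c' (cinv c t)) = t" unfolding transitions(4)[OF c'(1) q] using t TV snd_cinv by blast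
      thus "t \<in> ?h ` S" using t unfolding S_def by (metis image_eqI)
    qed
  qed
  have hh: "holo_on ?h S" by (rule holo_on_subset[OF transitions(2)[OF c'(1)] SO])
  have kh: "holo_on ?k (?h ` S)" unfolding hST by (rule holo_on_subset[OF transitions(1)[OF c'(1)] TO])
  have ohS: "open (?h ` S)" unfolding hST by (rule oT)
  have ji: "jac ?k (?h z) ** jac ?h z = mat 1" if "z \<in> S" for z
    using jac_inverse(2)[OF oS hh ohS kh _ that] hS by blast
  have Sc': "S \<subseteq> snd c' ` fst c'" using SO by blast
  have G: "gmat X c' z = pullback ?h (radial_matrix f1 f2) z" if z: "z \<in> S" for z
  proof -
    have "gmat X c' z = levi ?\<Phi> z" using potential_transition(4)[OF c'(1)] SO z by blast
    also have "\<dots> = levi (\<lambda>z. f ((norm (?h z))\<^sup>2)) z"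
      by (rule levi_cong_open[OF oS z]) (use potential_transition(1)[OF c'(1)] SO in blast)
    also have "\<dots> = pullback ?h (radial_matrix f1 f2) z"
    proof (rule levi_radial_comp[OF oS hh oT _ z])
      show "?h ` S \<subseteq> T" using hST by simp
      fix t assume "t \<in> T"
      hence "t \<in> V" "t \<noteq> 0" using TV TB by auto
      from profile_derivs(1,2)[OF this]
      show "(f has_real_derivative f1 ((norm t)\<^sup>2)) (at ((norm t)\<^sup>2))"
        "(f1 has_real_derivative f2 ((norm t)\<^sup>2)) (at ((norm t)\<^sup>2))" .
    qed
    finally show ?thesis .
  qed
  have pos: "f1 ((norm t)\<^sup>2) > 0 \<and> f1 ((norm t)\<^sup>2) + (norm t)\<^sup>2 * f2 ((norm t)\<^sup>2) > 0" if t: "t \<in> T" for t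
  proof -
    obtain z where z: "z \<in> S" "?h z = t" using t hST by blast
    have "0 < Re (\<^bold>\<Sum>a b. radial_matrix f1 f2 t $ a $ b * u $ a * cnj (u $ b))" if "u \<noteq> 0" for u
    proof (rule posdef_pullback[OF ji[OF z(1)] _ that])
      fix v :: "complex^'n" assume "v \<noteq> 0"
      have "jac ?h z ** radial_matrix f1 f2 t ** adj (jac ?h z) = gmat X c' z"
        unfolding G[OF z(1)] pullback_matrix z(2) ..
      thus "0 < Re (\<^bold>\<Sum>i j. (jac ?h z ** radial_matrix f1 f2 t ** adj (jac ?h z)) $ i $ j * v $ i * cnj (v $ j))"
        using kaehler_manifoldD(5)[OF kaehler c'(1) _ \<open>v \<noteq> 0\<close>] z(1) Sc' by auto
    qed
    from radial_matrix_positive[OF dim _ this] show ?thesis using t TB by blast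
  qed
  have rad: "radial_on (radial_matrix f1 f2) f1 f2 f3 f4 T"
    unfolding radial_on_def
  proof (intro conjI ballI)
    fix t assume t: "t \<in> T"
    hence "t \<in> V" "t \<noteq> 0" using TV TB by auto
    from profile_derivs(2-4)[OF this]
    show "(f1 has_real_derivative f2 ((norm t)\<^sup>2)) (at ((norm t)\<^sup>2))"
      "(f2 has_real_derivative f3 ((norm t)\<^sup>2)) (at ((norm t)\<^sup>2))"
      "(f3 has_real_derivative f4 ((norm t)\<^sup>2)) (at ((norm t)\<^sup>2))" .
    show "0 < f1 ((norm t)\<^sup>2)" "0 < f1 ((norm t)\<^sup>2) + (norm t)\<^sup>2 * f2 ((norm t)\<^sup>2)" using pos[OF t] by simp_all
  qed (rule oT refl)+
  have rp: "radial_pullback S T ?h (gmat X c') (radial_matrix f1 f2) f1 f2 f3 f4 (\<lambda>z. jac ?k (?h z))"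
  proof
    fix z assume z: "z \<in> S"
    hence z': "z \<in> snd c' ` fst c'" using Sc' by blast
    show "gmat X c' z = pullback ?h (radial_matrix f1 f2) z" by (rule G[OF z])
    show "jac ?k (?h z) ** jac ?h z = mat 1" by (rule ji[OF z])
    show "invertible (gmat X c' z)" "mdiff (gmat X c') z" "gmat X c' z $ i $ j = cnj (gmat X c' z $ j $ i)" for i j
      by (rule kaehler_manifoldD(2-4)[OF kaehler c'(1) z'])+
  qed (use oS hh hST rad in auto)
  have "w \<in> ?O" using c'(2) cinv_in[OF w(1)] snd_cinv[OF w(1)] by (metis IntI image_eqI)
  hence "w \<in> T" unfolding T_def using w(2) B(2) by blast
  then obtain z where z: "z \<in> S" "?h z = w" using hST by blast
  show ?thesis by (rule that[OF c'(1) Sc' TB z rp])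
qed

context
  fixes \<kappa> k :: real
  assumes k_eq: "k = \<kappa> / (real CARD('n) + 1)"
    and ke: "\<And>c' z i j. c' \<in> atlas X \<Longrightarrow> z \<in> snd c' ` fst c' \<Longrightarrow> ric (gmat X c') i j z = complex_of_real \<kappa> * gmat X c' z $ i $ j"
    and a3_zero: "a3_vanishes X"
begin

text \<open>The values |w|^2 on the punctured set form an open interval of positive numbers, since
  removing a point from a connected open set of real dimension at least two keeps it connected. So
  the integration constants \<open>D\<close> and \<open>C\<close> are the same throughout, and
  continuity adds the origin.\<close>

lemma profile_on_ball:
  assumes B: "open B" "connected B" "B \<noteq> {}" "B \<subseteq> V"
  shows "CARD('n) = 2 \<or> \<kappa> = 0" and "\<exists>D>0. \<exists>C. \<forall>w\<in>B. D - k * (norm w)\<^sup>2 > 0 \<and>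
      f ((norm w)\<^sup>2) = (if k = 0 then (norm w)\<^sup>2 / D else - ln (D - k * (norm w)\<^sup>2) / k) + C"
proof -
  define I where "I = (\<lambda>w. (norm w)\<^sup>2) ` (B - {0})"
  have conn: "connected (B - {0})"
    by (rule connected_open_delete[OF B(1,2)]) (use dim in simp)
  have "connected I" unfolding I_def
    by (rule connected_continuous_image[OF _ conn]) (intro continuous_intros)
  hence int: "is_interval I" by (simp add: is_interval_connected_1)
  have Ipos: "I \<subseteq> {0<..}" unfolding I_def by auto
  have "B - {0} \<noteq> {}"
  proof
    assume "B - {0} = {}"
    hence "finite B" by (meson Diff_eq_empty_iff finite.emptyI finite.insertI finite_subset)
    thus False using B(1,3) finite_imp_not_open by blast
  qed
  hence Ine: "I \<noteq> {}" unfolding I_def by blast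
  have oI: "open I"
  proof (subst open_subopen, intro ballI)
    fix x assume "x \<in> I"
    then obtain w where w: "w \<in> B" "w \<noteq> 0" "x = (norm w)\<^sup>2" unfolding I_def by blast
    define u where "u = w /\<^sub>R norm w"
    have nu: "norm u = 1" unfolding u_def using w by simp
    define U where "U = {0<..} \<inter> (\<lambda>t. sqrt t *\<^sub>R u) -` B"
    have "open U" unfolding U_def
      by (rule continuous_open_preimage[OF _ _ B(1)]) (auto intro!: continuous_intros)
    moreover have "norm w *\<^sub>R u = w" unfolding u_def using w by simp
    hence "x \<in> U" unfolding U_def using w by simp
    moreover have "U \<subseteq> I"
    proof
      fix t assume t: "t \<in> U"
      hence "sqrt t *\<^sub>R u \<in> B - {0}" "(norm (sqrt t *\<^sub>R u))\<^sup>2 = t" using nu unfolding U_def by auto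
      thus "t \<in> I" unfolding I_def by (metis image_eqI)
    qed
    ultimately show "\<exists>T. open T \<and> x \<in> T \<and> T \<subseteq> I" by blast
  qed
  have Iw: "\<exists>w. w \<in> B \<and> w \<noteq> 0 \<and> t = (norm w)\<^sup>2" if "t \<in> I" for t using that unfolding I_def by blast
  define K where "K = real CARD('n) * (real CARD('n) - 1) * (real CARD('n) + 1) * (real CARD('n) + 2)"
  define c0 where "c0 = 2 * real CARD('n) * \<kappa>\<^sup>2 / (real CARD('n) + 1)"
  have Idf: "(f has_real_derivative f1 t) (at t)" "(f1 has_real_derivative f2 t) (at t)" "(f2 has_real_derivative f3 t) (at t)"
    if t: "t \<in> I" for t
  proof -
    obtain w where w: "w \<in> B" "w \<noteq> 0" "t = (norm w)\<^sup>2" using Iw[OF t] by blast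
    hence "w \<in> V" using B(4) by blast
    from profile_derivs(1-3)[OF this w(2)]
    show "(f has_real_derivative f1 t) (at t)" "(f1 has_real_derivative f2 t) (at t)" "(f2 has_real_derivative f3 t) (at t)"
      unfolding w(3) .
  qed
  have loc: "f1 t > 0 \<and> f1 t + t * f2 t > 0 \<and>
      radial_A (f1 t) (f2 t) * (real CARD('n) + 1) + radial_B (f1 t) (f2 t) (f3 t) * (t / (f1 t + t * f2 t)) = \<kappa> \<and>
      (\<forall>v1 v2. (\<forall>t\<in>I. ((\<lambda>t. c0 + K * (radial_A (f1 t) (f2 t) - k)\<^sup>2) has_real_derivative v1 t) (at t)) \<longrightarrow>
         (\<forall>t\<in>I. (v1 has_real_derivative v2 t) (at t)) \<longrightarrow>
         v1 t / f1 t * (real CARD('n) - f2 t * t / (f1 t + t * f2 t)) + v2 t * t / (f1 t + t * f2 t)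
        + (2 - real CARD('n)) * \<kappa> * (c0 + K * (radial_A (f1 t) (f2 t) - k)\<^sup>2) - real CARD('n) * (real CARD('n) - 2)\<^sup>2 * \<kappa> ^ 3 = 0)"
    if t: "t \<in> I" for t
  proof -
    obtain w where w: "w \<in> B" "w \<noteq> 0" "t = (norm w)\<^sup>2" using Iw[OF t] by blast
    have wV: "w \<in> V" using w B(4) by blast
    obtain c' S T z Q where *: "c' \<in> atlas X" "S \<subseteq> snd c' ` fst c'" "T \<subseteq> B - {0}" "z \<in> S" "transition c' c z = w"
      "radial_pullback S T (transition c' c) (gmat X c') (radial_matrix f1 f2) f1 f2 f3 f4 Q"
      using local_pullback[OF wV w(2) B(1) w(1) B(4)] .
    interpret R: radial_pullback S T "transition c' c" "gmat X c'" "radial_matrix f1 f2" f1 f2 f3 f4 Q by (rule *(6))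
    have ke': "ric (gmat X c') i j z = of_real \<kappa> * gmat X c' z $ i $ j" if "z \<in> S" for z i j
      using ke[OF *(1)] that *(2) by blast
    have xx: "R.xx z = t" using *(5) w(3) by simp
    have nz: "transition c' c z \<noteq> 0" if "z \<in> S" for z using R.in_T[OF that] *(3) by blast
    have co: "R.AA (R.xx z) * (real CARD('n) + 1) + R.BB (R.xx z) * R.tau (R.xx z) = \<kappa>"
      "R.BB (R.xx z) * (real CARD('n) + 2) + R.CC (R.xx z) * R.tau (R.xx z) = 0"
      if "z \<in> S" for z
    proof -
      have "R.AA (R.xx z) * real (CARD('n) + 1) + R.BB (R.xx z) * R.tau (R.xx z) = \<kappa>"
        by (rule R.einstein_coefficients(1)[OF ke' that dim nz[OF that]])
      thus "R.AA (R.xx z) * (real CARD('n) + 1) + R.BB (R.xx z) * R.tau (R.xx z) = \<kappa>"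
        by (simp only: of_nat_add of_nat_1)
      have "R.BB (R.xx z) * real (CARD('n) + 2) + R.CC (R.xx z) * R.tau (R.xx z) = 0"
        by (rule R.einstein_coefficients(2)[OF ke' that dim nz[OF that]])
      thus "R.BB (R.xx z) * (real CARD('n) + 2) + R.CC (R.xx z) * R.tau (R.xx z) = 0"
        by (simp only: of_nat_add of_nat_numeral)
    qed
    define v where "v = (\<lambda>t. c0 + K * (radial_A (f1 t) (f2 t) - k)\<^sup>2)"
    have nR: "norm2_R (gmat X c') z = of_real (v (R.xx z))" if z: "z \<in> S" for z
    proof -
      have "norm2_R (gmat X c') z = of_real (2 * R.AA (R.xx z) * \<kappa> * CARD('n) + 4 * R.BB (R.xx z) * \<kappa> * R.tau (R.xx z)
       + R.CC (R.xx z) * (R.tau (R.xx z))\<^sup>2 * (2 * R.AA (R.xx z) + 4 * R.BB (R.xx z) * R.tau (R.xx z)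
         + R.CC (R.xx z) * (R.tau (R.xx z))\<^sup>2))"
        by (rule R.norm2_R'[OF ke' z])
      also have "\<dots> = of_real (v (R.xx z))"
        unfolding v_def c0_def K_def k_eq by (subst norm2_in_defect[OF co[OF z] _ refl]) simp_all
      finally show ?thesis .
    qed
    have R1: "f1 t > 0" "f1 t + t * f2 t > 0" using R.pos[OF *(4)] unfolding xx by auto
    \<comment> \<open>Stated for arbitrary derivatives \<open>v1\<close> and \<open>v2\<close>,
      because their values are found only later from the Einstein equation. They must be derivatives
      on all of \<open>I\<close>, as the Laplacian looks at a neighbourhood.\<close>
    have R2: "v1 t / f1 t * (real CARD('n) - f2 t * t / (f1 t + t * f2 t)) + v2 t * t / (f1 t + t * f2 t)
        + (2 - real CARD('n)) * \<kappa> * v t - real CARD('n) * (real CARD('n) - 2)\<^sup>2 * \<kappa> ^ 3 = 0"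
      if v1: "\<forall>t\<in>I. (v has_real_derivative v1 t) (at t)" and v2: "\<forall>t\<in>I. (v1 has_real_derivative v2 t) (at t)" for v1 v2
    proof -
      have TI: "(norm u)\<^sup>2 \<in> I" if "u \<in> T" for u using that *(3) unfolding I_def by blast
      have "lap (gmat X c') (norm2_R (gmat X c')) z = lap (gmat X c') (\<lambda>z. of_real (v (R.xx z))) z"
        by (rule lap_cong_open[OF R.S *(4) nR])
      also have "\<dots> = of_real (v1 (R.xx z) / f1 (R.xx z) * (CARD('n) - f2 (R.xx z) * R.xx z / (f1 (R.xx z) + R.xx z * f2 (R.xx z)))
        + v2 (R.xx z) * R.xx z / (f1 (R.xx z) + R.xx z * f2 (R.xx z)))"
        by (rule R.lap'[OF *(4)]) (use v1 v2 TI in auto)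
      finally have lap: "lap (gmat X c') (norm2_R (gmat X c')) z =
        of_real (v1 t / f1 t * (CARD('n) - f2 t * t / (f1 t + t * f2 t)) + v2 t * t / (f1 t + t * f2 t))" unfolding xx .
      have "a3 (gmat X c') z = 0" using a3_zero *(1,2,4) unfolding a3_vanishes_def by blast
      moreover have "a3 (gmat X c') z = (1/48) * (lap (gmat X c') (norm2_R (gmat X c')) z
         + (2 - of_nat CARD('n)) * of_real \<kappa> * norm2_R (gmat X c') z - of_nat CARD('n) * (of_nat CARD('n) - 2)\<^sup>2 * of_real \<kappa> ^ 3)"
        by (rule R.a3'[OF ke' *(4)])
      ultimately have "of_real (v1 t / f1 t * (CARD('n) - f2 t * t / (f1 t + t * f2 t)) + v2 t * t / (f1 t + t * f2 t))
         + (2 - of_nat CARD('n)) * of_real \<kappa> * of_real (v t) - of_nat CARD('n) * (of_nat CARD('n) - 2)\<^sup>2 * of_real \<kappa> ^ 3 = (0::complex)"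
        unfolding lap nR[OF *(4)] xx by simp
      hence "complex_of_real (v1 t / f1 t * (CARD('n) - f2 t * t / (f1 t + t * f2 t)) + v2 t * t / (f1 t + t * f2 t)
         + (2 - real CARD('n)) * \<kappa> * v t - real CARD('n) * (real CARD('n) - 2)\<^sup>2 * \<kappa> ^ 3) = of_real 0"
        by (simp only: of_real_add of_real_diff of_real_mult of_real_power of_real_of_nat_eq of_real_numeral of_real_0)
      thus ?thesis by (simp only: of_real_eq_iff)
    qed
    show ?thesis using R1 co(1)[OF *(4)] R2 unfolding xx v_def by blast
  qed
  have main: "\<exists>D>0. \<forall>t\<in>I. D - k * t > 0 \<and> f1 t = 1 / (D - k * t)" "CARD('n) = 2 \<or> \<kappa> = 0"
  proof -
    note ode = radial_einstein_a3_zero[where I = I and n = "CARD('n)" and ?f1.0 = f1 and ?f2.0 = f2 and ?f3.0 = f3 and \<kappa> = \<kappa>, OF oI int Ine Ipos dim Idf(2,3)]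
    show "\<exists>D>0. \<forall>t\<in>I. D - k * t > 0 \<and> f1 t = 1 / (D - k * t)"
      unfolding k_eq by (rule ode(1)) (use loc in \<open>auto simp: c0_def K_def k_eq\<close>)
    show "CARD('n) = 2 \<or> \<kappa> = 0"
      by (rule ode(2)) (use loc in \<open>auto simp: c0_def K_def k_eq\<close>)
  qed
  show "CARD('n) = 2 \<or> \<kappa> = 0" by (rule main(2))
  obtain D where D: "D > 0" "\<And>t. t \<in> I \<Longrightarrow> D - k * t > 0" "\<And>t. t \<in> I \<Longrightarrow> f1 t = 1 / (D - k * t)"
    using main(1) by blast
  define F where "F = (\<lambda>t. if k = 0 then t / D else - ln (D - k * t) / k)"
  have "(F has_real_derivative 1 / (D - k * t)) (at t)" if "D - k * t > 0" for t
    unfolding F_def by (rule space_form_profile_deriv[OF D(1) that])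
  hence DF: "((\<lambda>t. f t - F t) has_real_derivative 0) (at t within I)" if "t \<in> I" for t
    using DERIV_diff[OF Idf(1)[OF that], of F "1 / (D - k * t)"] D(2,3)[OF that] by (simp add: has_field_derivative_at_within)
  obtain C where C: "\<And>t. t \<in> I \<Longrightarrow> f t - F t = C"
    using has_field_derivative_zero_constant[OF _ DF] int by (auto simp: is_interval_convex)
  have "D - k * (norm w)\<^sup>2 > 0 \<and> f ((norm w)\<^sup>2) = F ((norm w)\<^sup>2) + C" if w: "w \<in> B" for w
  proof (cases "w = 0")
    case False
    hence "(norm w)\<^sup>2 \<in> I" unfolding I_def using w by blast
    thus ?thesis using D(2) C by fastforce
  next
    \<comment> \<open>At the origin f - F is the limit of its constant value on the punctured
      neighbourhood.\<close>
    case True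
    have c1: "isCont (\<lambda>w. f ((norm w)\<^sup>2)) (0 :: complex^'n)" using continuous_potential w B(4) True by blast
    have c2: "isCont (\<lambda>w. F ((norm w)\<^sup>2)) (0 :: complex^'n)"
      unfolding F_def using D(1) by (cases "k = 0") (auto intro!: continuous_intros)
    have "isCont (\<lambda>w. f ((norm w)\<^sup>2) - F ((norm w)\<^sup>2)) (0 :: complex^'n)" by (rule continuous_diff[OF c1 c2])
    hence "((\<lambda>w. f ((norm w)\<^sup>2) - F ((norm w)\<^sup>2)) \<longlongrightarrow> f 0 - F 0) (at (0 :: complex^'n))"
      unfolding isCont_def by simp
    moreover have "((\<lambda>w. f ((norm w)\<^sup>2) - F ((norm w)\<^sup>2)) \<longlongrightarrow> C) (at (0 :: complex^'n))"
    proof (rule tendsto_eventually)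
      have "\<forall>\<^sub>F w in at (0 :: complex^'n). w \<in> B - {0}"
        using B(1) w True by (simp add: eventually_at_topological) blast
      thus "\<forall>\<^sub>F w in at (0 :: complex^'n). f ((norm w)\<^sup>2) - F ((norm w)\<^sup>2) = C"
        by eventually_elim (use C in \<open>auto simp: I_def\<close>)
    qed
    ultimately have "f 0 - F 0 = C" by (rule tendsto_unique[rotated]) simp
    thus ?thesis using D(1) True by simp
  qed
  thus "\<exists>D>0. \<exists>C. \<forall>w\<in>B. D - k * (norm w)\<^sup>2 > 0 \<and>
      f ((norm w)\<^sup>2) = (if k = 0 then (norm w)\<^sup>2 / D else - ln (D - k * (norm w)\<^sup>2) / k) + C"
    using D(1) unfolding F_def by blast
qed

end

end

text \<open>For k \<noteq> 0 the potential -ln(D - k t)/k equals r ln(1 + \<epsilon> s^2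
  t)/\<epsilon> up to a constant exactly if \<epsilon> = -k r and s^2 = 1/(r D), so scaling
  coordinates by s is the isometry; the same s works for k = 0. The bijection \<sigma> relabels
  coordinates between index types of equal cardinality.\<close>

lemma pullback_scaling:
  fixes \<sigma> :: "'m::finite \<Rightarrow> 'n::finite" and \<sigma>' :: "'n \<Rightarrow> 'm" and \<epsilon> r s D k :: real
  assumes \<sigma>: "\<And>a. \<sigma>' (\<sigma> a) = a" "\<And>i. \<sigma> (\<sigma>' i) = i"
    and eq: "s\<^sup>2 = 1 / (r * D)" "\<epsilon> = - k * r" and pos: "r > 0" "D > 0" "D - k * (norm w)\<^sup>2 > 0"
    and A: "A = (\<lambda>w. \<chi> a. of_real s * w $ \<sigma> a)"
  shows "(norm (A w))\<^sup>2 = s\<^sup>2 * (norm w)\<^sup>2" "1 + \<epsilon> * (norm (A w))\<^sup>2 = (D - k * (norm w)\<^sup>2) / D"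
    and "pullback A (\<lambda>u. r *\<^sub>R space_form \<epsilon> u) w = radial_matrix (\<lambda>t. 1 / (D - k * t)) (\<lambda>t. k / (D - k * t)\<^sup>2) w"
proof -
  let ?x = "(norm w)\<^sup>2"
  have bij: "bij \<sigma>" using \<sigma> by (metis bij_betw_byWitness subset_UNIV)
  have "(norm (A w))\<^sup>2 = (\<^bold>\<Sum>a. s\<^sup>2 * (norm (w $ \<sigma> a))\<^sup>2)"
    by (simp add: norm_vec_def L2_set_def A sum_nonneg norm_mult power_mult_distrib)
  also have "\<dots> = (\<^bold>\<Sum>i. s\<^sup>2 * (norm (w $ i))\<^sup>2)"
    using sum.reindex_bij_betw[OF bij, of "\<lambda>i. s\<^sup>2 * (norm (w $ i))\<^sup>2"] .
  also have "\<dots> = s\<^sup>2 * ?x"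
    unfolding norm_vec_def L2_set_def by (simp add: sum_nonneg sum_distrib_left)
  finally show nA: "(norm (A w))\<^sup>2 = s\<^sup>2 * ?x" .
  show e: "1 + \<epsilon> * (norm (A w))\<^sup>2 = (D - k * ?x) / D"
    unfolding nA eq using pos by (simp add: field_simps)
  have jacA: "jac A w $ i $ a = of_real s * kron (\<sigma>' i) a" for i a
  proof -
    have "jac A w $ i $ a = of_real s * (if i = \<sigma> a then 1 else 0)"
      unfolding jac_def A using has_wd_pd(1)[OF has_wd_cmult[OF has_wd_coord[of "\<sigma> a" w], of "of_real s"], of i] by simp
    thus ?thesis unfolding kron_def using \<sigma> by metis
  qed
  have "pullback A (\<lambda>u. r *\<^sub>R space_form \<epsilon> u) w $ i $ j =
    radial_matrix (\<lambda>t. 1 / (D - k * t)) (\<lambda>t. k / (D - k * t)\<^sup>2) w $ i $ j" for i j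
  proof -
    have "pullback A (\<lambda>u. r *\<^sub>R space_form \<epsilon> u) w $ i $ j =
      (\<^bold>\<Sum>a b. jac A w $ i $ a * cnj (jac A w $ j $ b) * (r *\<^sub>R space_form \<epsilon> (A w) $ a $ b))"
      unfolding pullback_def jac_def by simp
    also have "\<dots> = (\<^bold>\<Sum>a. kron (\<sigma>' i) a * (\<^bold>\<Sum>b. kron (\<sigma>' j) b * (of_real (s\<^sup>2) * (r *\<^sub>R space_form \<epsilon> (A w) $ a $ b))))"
    proof -
      have "cnj (kron (\<sigma>' j) b) = kron (\<sigma>' j) b" for b by (simp add: kron_def)
      thus ?thesis unfolding jacA by (simp add: sum_distrib_left power2_eq_square scaleR_conv_of_real mult_ac)
    qed
    also have "\<dots> = of_real (s\<^sup>2 * r) * space_form \<epsilon> (A w) $ \<sigma>' i $ \<sigma>' j"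
      unfolding sum_kron by (simp add: scaleR_conv_of_real)
    also have "\<dots> = of_real (s\<^sup>2 * r * (D / (D - k * ?x))) * kron i j
        + of_real (s\<^sup>2 * r * (- \<epsilon> * (D / (D - k * ?x))\<^sup>2) * s\<^sup>2) * (cnj (w $ i) * w $ j)"
    proof -
      have kr: "kron (\<sigma>' i) (\<sigma>' j) = kron i j" unfolding kron_def using \<sigma>(2) by metis
      have Aw: "A w $ \<sigma>' i = of_real s * w $ i" for i unfolding A using \<sigma>(2) by simp
      have q: "1 / (1 + \<epsilon> * (norm (A w))\<^sup>2) = D / (D - k * ?x)"
        "- \<epsilon> / (1 + \<epsilon> * (norm (A w))\<^sup>2)\<^sup>2 = - \<epsilon> * (D / (D - k * ?x))\<^sup>2"
        unfolding e by (simp_all add: power_divide)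
      show ?thesis unfolding space_form_def radial_matrix_nth q kr Aw
        unfolding of_real_mult complex_cnj_mult complex_cnj_complex_of_real of_real_power by algebra
    qed
    also have "s\<^sup>2 * r * (D / (D - k * ?x)) = 1 / (D - k * ?x)" unfolding eq using pos by simp
    also have "s\<^sup>2 * r * (- \<epsilon> * (D / (D - k * ?x))\<^sup>2) * s\<^sup>2 = k / (D - k * ?x)\<^sup>2"
      unfolding eq using pos by (simp add: power_divide power2_eq_square)
    finally show ?thesis unfolding radial_matrix_nth .
  qed
  thus "pullback A (\<lambda>u. r *\<^sub>R space_form \<epsilon> u) w = radial_matrix (\<lambda>t. 1 / (D - k * t)) (\<lambda>t. k / (D - k * t)\<^sup>2) w"
    by (simp add: vec_eq_iff)
qed

text \<open>On a ball in the chart the potential is that of a space form up to scaling, so the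
  scaled coordinates compared with the chart \<open>e\<close> give the isometry. The hypothesis that
  \<open>e\<close> covers all points with 1 + \<epsilon> |u|^2 > 0 keeps the image of the ball
  inside one chart.\<close>

lemma (in radial_chart) local_isometry:
  fixes \<kappa> :: real and Y :: "('b, 'm::finite) hmfd"
  assumes ke: "\<And>c' z i j. c' \<in> atlas X \<Longrightarrow> z \<in> snd c' ` fst c' \<Longrightarrow> ric (gmat X c') i j z = complex_of_real \<kappa> * gmat X c' z $ i $ j"
    and a3_zero: "a3_vanishes X" and p: "p \<in> fst c"
    and Y: "standard_manifold \<epsilon> Y" "e \<in> atlas Y" "{u. 1 + \<epsilon> * (norm u)\<^sup>2 > 0} \<subseteq> snd e ` fst e"
    and r: "r > 0" "\<epsilon> = - (\<kappa> / (real CARD('n) + 1)) * r" and card: "CARD('m) = CARD('n)"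
  shows "\<exists>W W' F. p \<in> W \<and> biholomorphic_isometry X (rescale r Y) W W' F"
proof -
  define k where "k = \<kappa> / (real CARD('n) + 1)"
  obtain \<rho> where \<rho>: "\<rho> > 0" "ball (snd c p) \<rho> \<subseteq> V" using open_range p openE by blast
  define B where "B = ball (snd c p) \<rho>"
  have B: "open B" "connected B" "B \<noteq> {}" "B \<subseteq> V" "snd c p \<in> B"
    using \<rho> unfolding B_def by (auto simp: connected_ball)
  obtain D C where D: "D > 0" and f: "\<And>w. w \<in> B \<Longrightarrow> D - k * (norm w)\<^sup>2 > 0 \<and>
      f ((norm w)\<^sup>2) = (if k = 0 then (norm w)\<^sup>2 / D else - ln (D - k * (norm w)\<^sup>2) / k) + C"
    using profile_on_ball(2)[OF k_def ke a3_zero B(1-4)] by blast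
  define s where "s = sqrt (1 / (r * D))"
  have s: "s\<^sup>2 = 1 / (r * D)" "s > 0" unfolding s_def using r D by simp_all
  obtain \<sigma> :: "'m \<Rightarrow> 'n" where "bij \<sigma>" using card finite_same_card_bij[of "UNIV :: 'm set" "UNIV :: 'n set"] by auto
  then obtain \<sigma>' where \<sigma>: "\<And>a. \<sigma>' (\<sigma> a) = a" "\<And>i. \<sigma> (\<sigma>' i) = i"
    by (metis bij_inv_eq_iff)
  define A :: "complex^'n \<Rightarrow> complex^'m" where "A = (\<lambda>w. \<chi> a. of_real s * w $ \<sigma> a)"
  define A' :: "complex^'m \<Rightarrow> complex^'n" where "A' = (\<lambda>u. \<chi> i. of_real (1 / s) * u $ \<sigma>' i)"
  have hA: "holo_on A UNIV" "holo_on A' UNIV"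
    unfolding holo_on_iff[OF open_UNIV] A_def A'_def vec_lambda_beta
    by (intro ballI allI hol_mult hol_const hol_coord)+
  have AA': "A' (A w) = w" "A (A' u) = u" for w u
    unfolding A_def A'_def using s(2) \<sigma> by (simp_all add: vec_eq_iff)
  note scal = pullback_scaling[OF \<sigma> s(1) r(2)[folded k_def] r(1) D _ A_def]
  have AB: "A ` B \<subseteq> snd e ` fst e"
  proof
    fix u assume "u \<in> A ` B"
    then obtain w where w: "w \<in> B" "u = A w" by blast
    have "1 + \<epsilon> * (norm u)\<^sup>2 > 0" using scal(2)[of w] f[OF w(1)] D unfolding w(2) by simp
    thus "u \<in> snd e ` fst e" using Y(3) by blast
  qed
  define H :: "complex^'n \<Rightarrow> complex^'n^'n" where "H = radial_matrix (\<lambda>t. 1 / (D - k * t)) (\<lambda>t. k / (D - k * t)\<^sup>2)"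
  show ?thesis
  proof (rule biholomorphic_isometry_from_chart[OF _ holomorphic p B(5) B(1,4) _ _ _ _ hA AA' AB, of "rescale r Y" H])
    show "c' \<in> atlas X \<Longrightarrow> is_chart (under X) c'" for c' by (rule kaehler_manifoldD(1)[OF kaehler])
    show "is_chart (under (rescale r Y)) d" if "d \<in> atlas (rescale r Y)" for d
      using Y(1) that unfolding standard_manifold_def by simp
    show "compatible d d'" if "d \<in> atlas (rescale r Y)" "d' \<in> atlas (rescale r Y)" for d d'
      using Y(1) that unfolding standard_manifold_def by simp
    show "gmat (rescale r Y) d z = pullback (transition d d') (gmat (rescale r Y) d') z"
      if "d \<in> atlas (rescale r Y)" "d' \<in> atlas (rescale r Y)" "z \<in> snd d ` (fst d \<inter> fst d')" for d d' z
      by (rule standard_rescale[OF Y(1)]) (use that in simp_all)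
    show "e \<in> atlas (rescale r Y)" using Y(2) by simp
  next
    fix w assume w: "w \<in> B"
    have Aw: "A w \<in> snd e ` fst e" using AB w by blast
    have "\<forall>z\<in>snd e ` fst e. 1 + \<epsilon> * (norm z)\<^sup>2 > 0 \<and> gmat Y e z = space_form \<epsilon> z"
      using Y(1,2) unfolding standard_manifold_def by blast
    from bspec[OF this Aw] have u: "gmat Y e (A w) = space_form \<epsilon> (A w)" by simp
    have "H w = pullback A (\<lambda>u. r *\<^sub>R space_form \<epsilon> u) w" unfolding H_def using scal(3) f[OF w] by simp
    also have "\<dots> = pullback A (gmat (rescale r Y) e) w"
      by (rule pullback_cong_metric) (simp add: u)
    finally show "H w = pullback A (gmat (rescale r Y) e) w" .
  next
    fix c' z assume c': "c' \<in> atlas X" and z: "z \<in> snd c' ` (fst c' \<inter> fst c)" and zB: "transition c' c z \<in> B"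
    let ?h = "transition c' c" and ?\<Phi> = "(\<lambda>q. f ((norm (snd c q))\<^sup>2)) \<circ> cinv c'"
    let ?O = "snd c' ` (fst c \<inter> fst c')"
    have zO: "z \<in> ?O" using z by (simp add: Int_commute)
    define S where "S = ?O \<inter> ?h -` B"
    have oS: "open S" unfolding S_def
      by (rule continuous_open_preimage[OF holo_on_imp_continuous_on[OF transitions(2)[OF c']] transitions(6)[OF c'] B(1)])
    have zS: "z \<in> S" unfolding S_def using zO zB by simp
    have hS: "holo_on ?h S" by (rule holo_on_subset[OF transitions(2)[OF c']]) (simp add: S_def)
    define F where "F = (\<lambda>t. (if k = 0 then t / D else - ln (D - k * t) / k) + C)"
    have "gmat X c' z = levi ?\<Phi> z" by (rule potential_transition(4)[OF c' zO])
    also have "\<dots> = levi (\<lambda>z. F ((norm (?h z))\<^sup>2)) z"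
    proof (rule levi_cong_open[OF oS zS])
      fix v assume "v \<in> S"
      hence "v \<in> ?O" "?h v \<in> B" unfolding S_def by auto
      thus "?\<Phi> v = F ((norm (?h v))\<^sup>2)" using potential_transition(1)[OF c'] f unfolding F_def by simp
    qed
    also have "\<dots> = pullback ?h H z"
      unfolding H_def
    proof (rule levi_radial_comp[OF oS hS B(1) _ zS])
      show "?h ` S \<subseteq> B" unfolding S_def by blast
      fix w assume "w \<in> B"
      hence pos: "D - k * (norm w)\<^sup>2 > 0" using f by blast
      show "(F has_real_derivative 1 / (D - k * (norm w)\<^sup>2)) (at ((norm w)\<^sup>2))"
        unfolding F_def using DERIV_add[OF space_form_profile_deriv[OF D pos] DERIV_const[of C]] by simp
      show "((\<lambda>t. 1 / (D - k * t)) has_real_derivative k / (D - k * (norm w)\<^sup>2)\<^sup>2) (at ((norm w)\<^sup>2))"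
        using pos by (auto intro!: derivative_eq_intros simp: power2_eq_square)
    qed
    finally show "gmat X c' z = pullback ?h H z" .
  qed
qed

theorem corollary1:
  fixes X :: "('a, 'n::finite) hmfd"
  assumes "CARD('n) \<ge> 2"
    and "kaehler_manifold X"
    and "kaehler_einstein X"
    and "radial X"
  shows "a3_vanishes X \<longleftrightarrow>
    (\<exists>r>0. locally_biholomorphically_isometric X (rescale r (flat_space :: (complex^'n, 'n) hmfd))
         \<or> locally_biholomorphically_isometric X (rescale r hyperbolic_plane)
         \<or> locally_biholomorphically_isometric X (rescale r projective_plane))"
proof
  assume a3: "a3_vanishes X"
  obtain \<kappa> where ke: "\<And>c z i j. c \<in> atlas X \<Longrightarrow> z \<in> snd c ` fst c \<Longrightarrow> ric (gmat X c) i j z = complex_of_real \<kappa> * gmat X c z $ i $ j"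
    using assms(3) unfolding kaehler_einstein_def by blast
  define k where "k = \<kappa> / (real CARD('n) + 1)"
  have k0: "k = 0 \<longleftrightarrow> \<kappa> = 0" unfolding k_def by (simp add: add_eq_0_iff)
  have rad: "\<exists>c f. radial_chart X c f \<and> p \<in> fst c" if "p \<in> topspace (under X)" for p
    using assms(1,2,4) that unfolding radial_def radial_chart_def by blast
  \<comment> \<open>On the empty manifold \<kappa> is arbitrary and there is no chart to argue in;
    being locally isometric is then vacuous. The condition on \<open>card\<close> below is guarded
    in the same way.\<close>
  have dim: "CARD('n) = 2 \<or> \<kappa> = 0" if ne: "topspace (under X) \<noteq> {}"
  proof -
    obtain p c f where p: "radial_chart X c f" "p \<in> fst c" using rad ne by blast
    interpret radial_chart X c f by (rule p(1))
    obtain \<rho> where \<rho>: "\<rho> > 0" "ball (snd c p) \<rho> \<subseteq> V" using open_range p(2) openE by blast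
    show ?thesis using profile_on_ball(1)[OF k_def ke a3 open_ball connected_ball _ \<rho>(2)] \<rho>(1) by simp
  qed
  have iso: "locally_biholomorphically_isometric X (rescale r Y)"
    if Y: "standard_manifold \<epsilon> Y" "e \<in> atlas Y" "{u. 1 + \<epsilon> * (norm u)\<^sup>2 > 0} \<subseteq> snd e ` fst e"
      and r: "r > 0" "\<epsilon> = - k * r" and card: "topspace (under X) \<noteq> {} \<Longrightarrow> CARD('m) = CARD('n)"
    for r \<epsilon> :: real and Y :: "('b, 'm::finite) hmfd" and e
    unfolding locally_biholomorphically_isometric_def
  proof
    fix p assume p: "p \<in> topspace (under X)"
    then obtain c f where c: "radial_chart X c f" "p \<in> fst c" using rad by blast
    show "\<exists>V W F. p \<in> V \<and> biholomorphic_isometry X (rescale r Y) V W F"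
      by (rule radial_chart.local_isometry[OF c(1) ke a3 c(2) Y r(1) r(2)[unfolded k_def] card]) (use p in auto)
  qed
  show "\<exists>r>0. locally_biholomorphically_isometric X (rescale r (flat_space :: (complex^'n, 'n) hmfd))
         \<or> locally_biholomorphically_isometric X (rescale r hyperbolic_plane)
         \<or> locally_biholomorphically_isometric X (rescale r projective_plane)"
  proof -
    \<comment> \<open>The sign of k selects \<epsilon> = 0, 1 or -1, and \<epsilon> = -k r then
      fixes the scale: r = 1, -1/k or 1/k.\<close>
    consider "k = 0" | "k < 0" | "k > 0" by linarith
    thus ?thesis
    proof cases
      case 1
      have "locally_biholomorphically_isometric X (rescale 1 (flat_space :: (complex^'n, 'n) hmfd))"
        by (rule iso[OF standard_flat, of "(UNIV, \<lambda>z. z)"]) (use 1 in \<open>auto simp: flat_space_def\<close>)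
      thus ?thesis using zero_less_one by blast
    next
      case 2
      interpret affine 1 2 3 by standard simp_all
      have "locally_biholomorphically_isometric X (rescale (- 1 / k) projective_plane)"
        by (rule iso[OF standard_projective, of "affine_chart 1 2 3"])
           (use 2 dim k0 image_ch in \<open>auto simp: projective_plane_def divide_simps\<close>)
      moreover have "- 1 / k > 0" using 2 by (simp add: divide_simps)
      ultimately show ?thesis by blast
    next
      case 3
      have "locally_biholomorphically_isometric X (rescale (1 / k) hyperbolic_plane)"
        by (rule iso[OF standard_hyperbolic, of "(ball 0 1, \<lambda>z. z)"])
           (use 3 dim k0 in \<open>auto simp: hyperbolic_plane_def abs_square_less_1\<close>)
      moreover have "1 / k > 0" using 3 by simp
      ultimately show ?thesis by blast
    qed
  qed
next
  assume "\<exists>r>0. locally_biholomorphically_isometric X (rescale r (flat_space :: (complex^'n, 'n) hmfd))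
         \<or> locally_biholomorphically_isometric X (rescale r hyperbolic_plane)
         \<or> locally_biholomorphically_isometric X (rescale r projective_plane)"
  then obtain r where r: "r > 0" and "locally_biholomorphically_isometric X (rescale r (flat_space :: (complex^'n, 'n) hmfd))
         \<or> locally_biholomorphically_isometric X (rescale r hyperbolic_plane)
         \<or> locally_biholomorphically_isometric X (rescale r projective_plane)" by blast
  thus "a3_vanishes X"
    using a3_vanishes_of_model[OF assms(2,3) model_of_standard[OF standard_flat r]]
      a3_vanishes_of_model[OF assms(2,3) model_of_standard[OF standard_hyperbolic r]]
      a3_vanishes_of_model[OF assms(2,3) model_of_standard[OF standard_projective r]]
    by auto
qed

end
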